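(* Let $p>3$ be a prime. Then $$\sum_{n=0}^{p-1}\frac{n+1}{8^n}\sum_{k=0}^n\binom{2k}{k}^2\binom{2n-2k}{n-k}^2\equiv(-1)^{(p-1)/2}p+5p^3E_{p-3}\pmod{p^4}$$ and $$\sum_{n=0}^{p-1}\frac{2n+1}{(-16)^n}\sum_{k=0}^n\binom{2k}{k}^2\binom{2n-2k}{n-k}^2\equiv(-1)^{(p-1)/2}p+3p^3E_{p-3}\pmod{p^4}.$$
   Context: The Euler numbers $E_n$ ($n\in\mathbb{N}$) are defined by $E_0=1$ and $\sum_{k=0,\,2\mid k}^{n}\binom{n}{k}E_{n-k}=0$ for $n=1,2,\ldots$. Congruences between rational numbers whose denominators are prime to $p$ are understood in the ring of $p$-integral rationals. *)

theory Defs
  imports "HOL-Number_Theory.Number_Theory"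
begin

(* The defining recurrence, solved for its k = 0 term. *)
fun euler_number :: "nat \<Rightarrow> int" where
  "euler_number n =
    (if n = 0 then 1
     else - (\<Sum>k\<in>{k\<in>{1..n}. even k}. int (n choose k) * euler_number (n - k)))"

declare euler_number.simps [simp del]

lemma euler_number_0: "euler_number 0 = 1"
  by (simp add: euler_number.simps)

lemma euler_number_recurrence:
  assumes "n \<ge> 1"
  shows "(\<Sum>k\<in>{k\<in>{0..n}. even k}. int (n choose k) * euler_number (n - k)) = 0"
proof -
  let ?A = "{k\<in>{1..n}. even k}" and ?f = "\<lambda>k. int (n choose k) * euler_number (n - k)"
  have "{k\<in>{0..n}. even k} = insert 0 ?A"
    using not_less_eq_eq by auto
  moreover have "sum ?f (insert 0 ?A) = ?f 0 + sum ?f ?A"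
    by (rule sum.insert) auto
  moreover have "?f 0 = - sum ?f ?A"
    using assms euler_number.simps[of n] by simp
  ultimately show ?thesis
    by simp
qed

definition p_integral :: "nat \<Rightarrow> rat \<Rightarrow> bool" where
  "p_integral p x \<longleftrightarrow> coprime (snd (quotient_of x)) (int p)"

(* x and y are congruent modulo p^a in the ring of p-integral rationals;
   in particular both sides have to lie in that ring. *)
definition p_cong :: "nat \<Rightarrow> nat \<Rightarrow> rat \<Rightarrow> rat \<Rightarrow> bool" where
  "p_cong p a x y \<longleftrightarrow> p_integral p x \<and> p_integral p y \<and>
     (\<exists>z. p_integral p z \<and> x - y = of_nat p ^ a * z)"

end

theory Submission
  imports Defs "HOL-Computational_Algebra.Formal_Power_Series"
begin

text \<open>
  Write s(n) for the convolution of the squared central binomial coefficients, c(k) for the cube of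
  the central binomial coefficient C(2k,k), N = (p-1)/2, and A and B for the two sums of the theorem.
  A third-order differential operator in the style of Clausen's identity shows
  s(n) = \<Sum>k. c(k) C(k,n-k) (-16)^(n-k) = 16^n \<Sum>k. C(n+k,2k) c(k) / (-16)^k.

  Inserting the second formula into B, the sum over n telescopes and leaves
  B = p \<Sum>k<p. C(2k,k)^2/16^k \<Prod>j\<le>k. (1 - p^2/j^2). Here C(2k,k)^2/16^k is the value at X = 0 of an even
  polynomial in X that gives the k-th coefficient of the Legendre polynomial P_n(1-2z) at X = 2n+1.
  At multiples of p this polynomial is linear in X^2 modulo p^4, so the values at X = p and X = 3p,
  where a Wilf-Zeilberger recurrence in n evaluates the sums over k, determine the value at X = 0.

  With S = \<Sum>k<p. (3k+1) c(k) / (-8)^k, the first formula gives A + S \<equiv> 2 B modulo p^4, term by term in k,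
  because 1/8 and -1/16 are exchanged by x \<mapsto> 1/16 - x. A Wilf-Zeilberger pair evaluates S: its boundary
  terms are divisible by p^3, and what remains is Wolstenholme's and Morley's congruences.
  All harmonic sums that occur reduce modulo p to \<Sum>i\<le>N. (-1)^i/i^2, which is congruent to
  2 (-1)^N E(p-3) by the alternating power sums of odd numbers.
\<close>

section \<open>Two formulas for the convolution\<close>

text \<open>Both formulas come from the series 2F1(1/2,1/2;1;z) = sum of C(2k,k)^2 (z/16)^k: Clausen
  writes its square as a 3F2 series at 4z(1-z), and Pfaff's substitution z -> z/(z-1) turns this
  into the second expansion. The bases 1/8 and -1/16 are the points z = 2 and z = -1, where z(1-z)
  has the same value -2; this is the origin of the -8 in S. For truncated sums the symmetry z -> 1-z
  has to be replaced by finite identities. For k <= N the inner sums are complete and the identity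
  is exact; for k > N the factor c(k) contributes p^3 and leaves only a claim modulo p. For B the
  obstacle is that X = 0 would be the degree n = -1/2. The odd multiples X = p and X = 3p are the
  genuine degrees N and p + N, and since B carries a factor p, the sums there are needed only modulo
  p^3.\<close>

definition theta :: "'a::comm_ring_1 fps \<Rightarrow> 'a fps" where
  "theta f = fps_X * fps_deriv f"

lemma theta_nth [simp]: "fps_nth (theta f) n = of_nat n * fps_nth f n"
  by (cases n) (simp_all add: theta_def)

lemma theta_add: "theta (f + g) = theta f + theta g"
  and theta_diff: "theta (f - g) = theta f - theta g"
  and theta_mult: "theta (f * g) = theta f * g + f * theta g"
  and theta_const: "theta (fps_const c) = 0"
  and theta_X: "theta fps_X = fps_X"
  and theta_one: "theta 1 = 0"
  and theta_numeral: "theta (numeral k) = 0"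
  by (simp_all add: theta_def algebra_simps numeral_fps_const)

lemma fps_nth_one_minus_X_mult:
  fixes f :: "'a::comm_ring_1 fps"
  shows "fps_nth ((1 - fps_X) * f) n = fps_nth f n - (if n = 0 then 0 else fps_nth f (n - 1))"
  by (simp add: algebra_simps)

text \<open>
  Equals \<open>\<theta>^3 - z (2 \<theta>^3 + 3 \<theta>^2 + 2 \<theta> + 1/2) + z^2 (\<theta> + 1)^3\<close>, the symmetric square of the operator
  that annihilates the generating function of C(2k,k)^2/16^k.
\<close>

definition clausen_op :: "rat fps \<Rightarrow> rat fps" where
  "clausen_op Y = (1 - fps_X)^2 * theta (theta (theta Y))
     - 3 * fps_X * (1 - fps_X) * theta (theta Y)
     - (2 * fps_X - 3 * fps_X^2) * theta Y
     - (fps_const (1/2) * fps_X - fps_X^2) * Y"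

lemma clausen_op_nth:
  "fps_nth (clausen_op Y) n = of_nat n ^ 3 * fps_nth Y n
     - (if n = 0 then 0 else
         (2 * (of_nat n - 1) ^ 3 + 3 * (of_nat n - 1) ^ 2 + 2 * (of_nat n - 1) + 1/2) * fps_nth Y (n - 1))
     + (if n < 2 then 0 else (of_nat n - 1) ^ 3 * fps_nth Y (n - 2))"
proof -
  let ?t = "theta"
  have e: "clausen_op Y = ?t (?t (?t Y))
     - fps_X * (2 * ?t (?t (?t Y)) + 3 * ?t (?t Y) + 2 * ?t Y + fps_const (1/2) * Y)
     + fps_X * (fps_X * (?t (?t (?t Y)) + 3 * ?t (?t Y) + 3 * ?t Y + Y))"
    unfolding clausen_op_def by (simp add: algebra_simps power2_eq_square)
  have num: "fps_nth (numeral k * f) m = numeral k * fps_nth f m"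
    "fps_nth (f * numeral k) m = fps_nth f m * numeral k" for k and f :: "rat fps" and m
    by (simp_all add: numeral_fps_const)
  consider "n = 0" | "n = 1" | m where "n = m + 2"
    by (metis One_nat_def Suc_1 add_2_eq_Suc' not0_implies_Suc)
  thus ?thesis
  proof cases
    case 3
    have "n - Suc 0 - Suc 0 = m" "n - 2 = m" "n - Suc 0 = Suc m" using 3 by auto
    thus ?thesis
      unfolding e using 3 by (simp add: num power3_eq_cube power2_eq_square algebra_simps)
  qed (simp_all add: e num)
qed

lemma clausen_op_add: "clausen_op (f + g) = clausen_op f + clausen_op g"
  by (simp add: clausen_op_def theta_add algebra_simps)

lemma clausen_op_const_mult: "clausen_op (fps_const c * f) = fps_const c * clausen_op f"
  by (simp add: clausen_op_def theta_mult theta_const algebra_simps)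

lemma clausen_op_0: "clausen_op 0 = 0"
  by (simp add: clausen_op_def theta_def)

text \<open>The leading coefficient of the recurrence is n^3, nonzero for n > 0, so each coefficient
  follows from the two before it. The bound K is there because the finite sums compared below are
  annihilated only up to the order at which they are cut.\<close>

lemma clausen_op_unique:
  assumes "\<And>m. m \<le> K \<Longrightarrow> fps_nth (clausen_op Y) m = 0" "\<And>m. m \<le> K \<Longrightarrow> fps_nth (clausen_op Z) m = 0"
    and "fps_nth Y 0 = fps_nth Z 0" "n \<le> K"
  shows "fps_nth Y n = fps_nth Z n"
  using assms(4)
proof (induction n rule: less_induct)
  case (less n)
  show ?case
  proof (cases "n = 0")
    case False
    have i1: "fps_nth Y (n - 1) = fps_nth Z (n - 1)" using less False by simp
    have i2: "n < 2 \<or> fps_nth Y (n - 2) = fps_nth Z (n - 2)" using less False by auto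
    have "fps_nth (clausen_op Y) n = fps_nth (clausen_op Z) n" using assms(1,2)[OF less.prems] by simp
    hence "of_nat n ^ 3 * fps_nth Y n = of_nat n ^ 3 * fps_nth Z n"
      using False i1 i2 by (auto simp: clausen_op_nth split: if_splits)
    thus ?thesis using False by simp
  qed (simp add: assms(3))
qed

lemma clausen_op_square:
  fixes y :: "rat fps"
  assumes "(1 - fps_X) * theta (theta y) = fps_X * theta y + fps_const (1/4) * fps_X * y"
  shows "clausen_op (y * y) = 0"
proof -
  define c :: "rat fps" where "c = fps_const (1/4)"
  define z :: "rat fps" where "z = fps_X"
  define u where "u = theta y"
  define v where "v = theta u"
  define w where "w = theta v"
  have c2: "fps_const (1/2) = 2 * c" by (simp add: c_def numeral_fps_const)
  have c1: "4 * c = 1" by (simp add: c_def numeral_fps_const)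
  have r1: "(1 - z) * v = z * u + c * z * y"
    using assms by (simp add: z_def u_def v_def c_def)
  have "theta ((1 - z) * v) = theta (z * u + c * z * y)" using r1 by simp
  hence r2: "(1 - z) * w = 2 * z * v + (1 + c) * z * u + c * z * y"
    by (simp add: theta_mult theta_diff theta_add theta_const theta_one theta_X z_def c_def
        w_def[symmetric] v_def[symmetric] u_def[symmetric] algebra_simps)
  have t1: "theta (y * y) = 2 * y * u" by (simp add: theta_mult u_def algebra_simps)
  have t2: "theta (theta (y * y)) = 2 * (u * u) + 2 * (y * v)"
    unfolding t1 by (simp add: theta_mult theta_numeral u_def v_def algebra_simps)
  have t3: "theta (theta (theta (y * y))) = 6 * (u * v) + 2 * (y * w)"
    unfolding t2 by (simp add: theta_mult theta_add theta_numeral u_def[symmetric] v_def[symmetric] w_def[symmetric])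
  have r3: "(1 - z) * ((1 - z) * w) = 2 * z * (z * u + c * z * y) + (1 - z) * ((1 + c) * z * u + c * z * y)"
    unfolding r2 r1[symmetric] by (simp add: algebra_simps)
  have "clausen_op (y * y) = 6 * (1 - z) * u * ((1 - z) * v) + 2 * y * ((1 - z) * ((1 - z) * w))
     - 3 * z * (2 * (1 - z) * (u * u) + 2 * y * ((1 - z) * v)) - (2 * z - 3 * z^2) * (2 * y * u)
     - (2 * c * z - z^2) * (y * y)"
    unfolding clausen_op_def t3 unfolding t2 unfolding t1 z_def[symmetric] c2 by (simp add: algebra_simps power2_eq_square)
  \<comment> \<open>The constant 1/4 is kept as an opaque \<open>c\<close>, so ring normalisation
    leaves a multiple of 4c - 1, which is 0.\<close>
  also have "\<dots> = (4 * c - 1) * (2 * z * (1 - z) * y * u - z^2 * y * y)"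
    unfolding r3 r1 by (simp add: algebra_simps power2_eq_square)
  finally show ?thesis using c1 by simp
qed

text \<open>If theta V = R V with R = r/(1-X), then theta R = g X/(1-X)^2, so every iterate of theta
  on V is a rational multiple of V with a power of 1-X as denominator. The outer factor 1-X is
  needed for theta^3 V, whose denominator is a cube while the operator supplies only a
  square.\<close>

lemma clausen_op_first_order:
  fixes V :: "rat fps" and a b :: rat
  assumes "(1 - fps_X) * theta V = (fps_const a + fps_const b * fps_X) * V"
  defines "r \<equiv> fps_const a + fps_const b * fps_X"
    and "g \<equiv> fps_const (a + b)"
  shows "(1 - fps_X) * clausen_op V =
     (r ^ 3 + 3 * r * fps_X * g + g * fps_X * (1 + fps_X) - 3 * fps_X * (r ^ 2 + g * fps_X)
      - (2 * fps_X - 3 * fps_X^2) * r - (1 - fps_X) * (fps_const (1/2) * fps_X - fps_X^2)) * V"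
proof -
  define z :: "rat fps" where "z = fps_X"
  define d where "d = (1 - z)"
  define A where "A = fps_const a"
  define B where "B = fps_const b"
  define u where "u = theta V"
  define v where "v = theta u"
  define w where "w = theta v"
  have r: "r = A + B * z" by (simp add: r_def A_def B_def z_def)
  have g: "g = A + B" by (simp add: g_def A_def B_def)
  have r1: "d * u = (A + B * z) * V" using assms(1) by (simp add: z_def u_def A_def B_def d_def)
  have "theta ((1 - z) * u) = theta ((A + B * z) * V)" using r1 d_def by simp
  hence r2: "d * v = z * u + (A + B * z) * u + B * z * V"
    by (simp add: theta_mult theta_diff theta_add theta_const theta_one theta_X z_def A_def B_def d_def
        w_def[symmetric] v_def[symmetric] u_def[symmetric] algebra_simps)
  hence "theta ((1 - z) * v) = theta (z * u + (A + B * z) * u + B * z * V)" using d_def by simp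
  hence r3: "d * w = 2 * z * v + (A + B * z) * v + (1 + 2 * B) * z * u + B * z * V"
    by (simp add: theta_mult theta_diff theta_add theta_const theta_one theta_X z_def A_def B_def d_def
        w_def[symmetric] v_def[symmetric] u_def[symmetric] algebra_simps)
  have dz: "z = 1 - d" by (simp add: d_def)
  have e2: "d^2 * v = (r^2 + g * z) * V"
  proof -
    have "d^2 * v = d * (d * v)" by (simp add: power2_eq_square)
    also have "\<dots> = (z + A + B * z) * (d * u) + B * z * d * V"
      unfolding r2 by (simp add: algebra_simps)
    also have "\<dots> = (r^2 + g * z) * V"
      unfolding r1 r g unfolding d_def by (simp add: algebra_simps power2_eq_square)
    finally show ?thesis .
  qed
  have e3: "d^3 * w = (r ^ 3 + 3 * r * z * g + g * z * (1 + z)) * V"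
  proof -
    have "d^3 * w = d^2 * (d * w)" by (simp add: power2_eq_square power3_eq_cube)
    also have "\<dots> = (2 * z + A + B * z) * (d^2 * v) + (1 + 2 * B) * z * d * (d * u) + B * z * d^2 * V"
      unfolding r3 by (simp add: algebra_simps power2_eq_square)
    also have "\<dots> = (r ^ 3 + 3 * r * z * g + g * z * (1 + z)) * V"
      unfolding r1 e2 r g unfolding d_def by (simp add: algebra_simps power2_eq_square power3_eq_cube)
    finally show ?thesis .
  qed
  have "(1 - fps_X) * clausen_op V = d^3 * w - 3 * z * (d^2 * v) - (2 * z - 3 * z^2) * (d * u)
      - d * (fps_const (1/2) * z - z^2) * V"
    unfolding clausen_op_def u_def v_def w_def d_def z_def
    by (simp add: algebra_simps power2_eq_square power3_eq_cube)
  also have "\<dots> = (r ^ 3 + 3 * r * z * g + g * z * (1 + z) - 3 * z * (r ^ 2 + g * z)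
      - (2 * z - 3 * z^2) * r - d * (fps_const (1/2) * z - z^2)) * V"
    unfolding e3 e2 r1 r[symmetric] by (simp add: algebra_simps)
  finally show ?thesis unfolding d_def z_def .
qed

section \<open>Recurrences for binomial coefficients\<close>

lemma central_binomial_Suc:
  "of_nat (Suc k) * of_nat (2 * Suc k choose Suc k) = 
     (2 * (2 * of_nat k + 1) * of_nat (2 * k choose k) :: 'a::field_char_0)"
proof -
  have b1: "of_nat (2 * Suc k choose Suc k) = (fact (2 * Suc k) / (fact (Suc k) * fact (Suc k)) :: 'a)"
    using binomial_fact[of "Suc k" "2 * Suc k", where 'a = 'a] by simp
  have b2: "of_nat (2 * k choose k) = (fact (2 * k) / (fact k * fact k) :: 'a)"
    using binomial_fact[of k "2 * k", where 'a = 'a] by simp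
  have f: "(fact (2 * Suc k) :: 'a) = (2 * of_nat k + 2) * (2 * of_nat k + 1) * fact (2 * k)"
    by (simp add: algebra_simps)
  have nz: "1 + of_nat k \<noteq> (0::'a)" by (metis of_nat_Suc of_nat_neq_0)
  show ?thesis
    unfolding b1 b2 f fact_Suc of_nat_Suc using nz by (simp add: divide_simps) (simp add: algebra_simps)
qed

lemma choose_Suc_down: "of_nat (n choose Suc k) = (of_nat (n choose k) * (of_nat n - of_nat k) / of_nat (Suc k) :: rat)"
proof (cases "k \<le> n")
  case True
  have "Suc k * (n choose Suc k) = (n - k) * (n choose k)"
    by (metis binomial_absorb_comp binomial_absorption mult.commute)
  hence "of_nat (Suc k) * of_nat (n choose Suc k) = (of_nat (n - k) * of_nat (n choose k) :: rat)"
    by (metis of_nat_mult)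
  thus ?thesis using True by (simp add: of_nat_diff field_simps del: of_nat_Suc)
qed (simp add: binomial_eq_0)

lemma choose_Suc_Suc: "of_nat (Suc n choose Suc k) = (of_nat (n choose k) * of_nat (Suc n) / of_nat (Suc k) :: rat)"
proof -
  have "Suc k * (Suc n choose Suc k) = Suc n * (n choose k)"
    by (metis Suc_times_binomial_eq mult.commute)
  hence "of_nat (Suc k) * of_nat (Suc n choose Suc k) = (of_nat (Suc n) * of_nat (n choose k) :: rat)"
    by (metis of_nat_mult)
  thus ?thesis by (simp add: field_simps del: of_nat_Suc binomial_Suc_Suc)
qed

text \<open>Differences are taken in \<open>rat\<close>, so there is no condition on i and k. It
  serves the differential equation of a kernel and, later, the alternating sum over n.\<close>

lemma choose_double_rec:
  "(of_nat (Suc i) - of_nat k) * of_nat ((Suc i + k) choose (2 * k)) =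
    (of_nat (Suc i + k) * of_nat ((i + k) choose (2 * k)) :: rat)"
  proof (cases "k \<le> i")
    case True
    have "(Suc (i + k) - 2 * k) * (Suc (i + k) choose (2 * k)) = Suc (i + k) * ((i + k) choose (2 * k))"
      using binomial_absorb_comp[of "Suc (i + k)" "2 * k"] by simp
    moreover have "of_nat (Suc (i + k) - 2 * k) = (of_nat (Suc i) - of_nat k :: rat)"
      using True by (simp add: of_nat_diff)
    ultimately show ?thesis
      by (metis add_Suc of_nat_mult)
  next
    case False
    thus ?thesis by (cases "k = Suc i") (auto simp: binomial_eq_0)
  qed

definition central_sq_fps :: "rat fps" where
  "central_sq_fps = Abs_fps (\<lambda>k. (of_nat (2 * k choose k) / 4 ^ k) ^ 2)"

lemma central_sq_fps_ode:
  "(1 - fps_X) * theta (theta central_sq_fps) = fps_X * theta central_sq_fps + fps_const (1/4) * fps_X * central_sq_fps"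
proof (rule fps_ext)
  fix n
  show "fps_nth ((1 - fps_X) * theta (theta central_sq_fps)) n = 
        fps_nth (fps_X * theta central_sq_fps + fps_const (1/4) * fps_X * central_sq_fps) n"
  proof (cases n)
    case 0
    thus ?thesis by (simp add: fps_nth_one_minus_X_mult mult.assoc)
  next
    case (Suc k)
    define q :: rat where "q = of_nat (2 * k choose k)"
    define q' :: rat where "q' = of_nat (2 * Suc k choose Suc k)"
    have "of_nat (Suc k) * q' = 2 * (2 * of_nat k + 1) * q"
      unfolding q_def q'_def by (rule central_binomial_Suc)
    hence "(of_nat (Suc k) * q') ^ 2 = (2 * (2 * of_nat k + 1) * q) ^ 2" by simp
    hence e: "of_nat (Suc k) * (of_nat (Suc k) * (q' / 4 ^ Suc k) ^ 2) = 
      ((of_nat k) ^ 2 + of_nat k + 1/4) * (q / 4 ^ k) ^ 2"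
      by (simp add: power_divide power_mult_distrib divide_simps) (simp add: algebra_simps power2_eq_square)
    define t where "t = (q / 4 ^ k) ^ 2"
    have "fps_nth (theta (theta central_sq_fps)) (Suc k) = (of_nat k ^ 2 + of_nat k + 1/4) * t"
      using e unfolding t_def by (simp only: theta_nth central_sq_fps_def fps_nth_Abs_fps q'_def)
    moreover have "fps_nth central_sq_fps k = t"
      by (simp add: central_sq_fps_def q_def t_def)
    ultimately show ?thesis unfolding Suc
      by (simp add: fps_nth_one_minus_X_mult mult.assoc del: of_nat_Suc theta_nth)
         (simp add: algebra_simps power2_eq_square)
  qed
qed

text \<open>The image of \<open>U k\<close> involves only \<open>U k\<close> and
  \<open>U (Suc k)\<close>, and the recursion for \<open>e\<close> makes neighbouring contributions
  cancel. The sum cut at K leaves one multiple of \<open>U (Suc K)\<close>, whose coefficients up to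
  K vanish by \<open>ord\<close>; removing the factor 1 - X does not change that.\<close>

lemma clausen_op_telescope:
  fixes U :: "nat \<Rightarrow> rat fps" and e :: "nat \<Rightarrow> rat" and s :: rat
  assumes U: "\<And>k. (1 - fps_X) * clausen_op (U k) =
      h * (fps_const (of_nat k ^ 3) * U k + fps_const (s * (4 * (of_nat k + 1/2) ^ 3)) * U (Suc k))"
    and e: "\<And>k. of_nat (Suc k) ^ 3 * e (Suc k) = - s * (4 * (of_nat k + 1/2) ^ 3) * e k"
    and ord: "\<And>n k. n < k \<Longrightarrow> fps_nth (U k) n = 0"
    and m: "m \<le> K"
  shows "fps_nth (clausen_op (\<Sum>k\<le>K. fps_const (e k) * U k)) m = 0"
proof -
  let ?c = "\<lambda>k. fps_const (s * (4 * (of_nat k + 1/2) ^ 3) * e k)"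
  have tel: "(1 - fps_X) * clausen_op (\<Sum>k\<le>K. fps_const (e k) * U k) = h * (?c K * U (Suc K))"
  proof (induction K)
    case 0
    show ?case by (simp add: clausen_op_const_mult mult.left_commute[of "1 - fps_X"] U) (simp add: ac_simps)
  next
    case (Suc K)
    have "(1 - fps_X) * clausen_op (\<Sum>k\<le>Suc K. fps_const (e k) * U k)
      = (1 - fps_X) * clausen_op (\<Sum>k\<le>K. fps_const (e k) * U k) + fps_const (e (Suc K)) * ((1 - fps_X) * clausen_op (U (Suc K)))"
      by (simp only: sum.atMost_Suc clausen_op_add clausen_op_const_mult) (simp add: algebra_simps)
    also have "\<dots> = h * ((?c K + fps_const (of_nat (Suc K) ^ 3 * e (Suc K))) * U (Suc K) + ?c (Suc K) * U (Suc (Suc K)))"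
      unfolding Suc.IH U by (simp only: fps_const_mult[symmetric] distrib_left distrib_right ac_simps)
    also have "?c K + fps_const (of_nat (Suc K) ^ 3 * e (Suc K)) = 0"
      unfolding e by (simp add: fps_const_add[symmetric] del: fps_const_add) (simp add: fps_eq_iff)
    finally show ?case by simp
  qed
  have z: "fps_nth ((1 - fps_X) * clausen_op (\<Sum>k\<le>K. fps_const (e k) * U k)) n = 0" if "n \<le> K" for n
    unfolding tel fps_mult_nth[of h] by (rule sum.neutral) (use that in \<open>simp add: ord\<close>)
  show ?thesis using m
  proof (induction m)
    case 0
    thus ?case using z[of 0] by (simp add: fps_nth_one_minus_X_mult)
  next
    case (Suc m)
    thus ?case using z[of "Suc m"] by (simp add: fps_nth_one_minus_X_mult)
  qed
qed

lemma half_cube: "fps_const (4 * (of_nat k + 1/2) ^ 3 :: rat) =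
  4 * fps_const (of_nat k) ^ 3 + 6 * fps_const (of_nat k) ^ 2 + 3 * fps_const (of_nat k) + fps_const (1/2)"
  by (simp add: numeral_fps_const fps_const_power) (simp add: fps_eq_iff field_simps power2_eq_square power3_eq_cube)

text \<open>The power series of \<open>(z (1 - z))^k\<close> and of \<open>z^k / (1 - z)^(2k+1)\<close>.\<close>

definition prod_kernel :: "nat \<Rightarrow> rat fps" where
  "prod_kernel k = Abs_fps (\<lambda>n. if k \<le> n then (-1) ^ (n - k) * of_nat (k choose (n - k)) else 0)"

definition koebe_kernel :: "nat \<Rightarrow> rat fps" where
  "koebe_kernel k = Abs_fps (\<lambda>n. of_nat ((n + k) choose (2 * k)))"

lemma prod_kernel_Suc: "prod_kernel (Suc k) = (fps_X - fps_X ^ 2) * prod_kernel k"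
proof (rule fps_ext)
  fix n
  consider "n \<le> k" | "n = Suc k" | i where "n = Suc (Suc (k + i))"
    by (metis Suc_leI add_Suc_shift le_Suc_ex not_less_eq_eq linorder_le_cases le_antisym add_Suc_right)
  thus "fps_nth (prod_kernel (Suc k)) n = fps_nth ((fps_X - fps_X ^ 2) * prod_kernel k) n"
    by cases (auto simp: prod_kernel_def left_diff_distrib fps_X_power_mult_nth power2_eq_square mult.assoc algebra_simps Suc_diff_le)
qed

lemma prod_kernel_ode:
  "(1 - fps_X) * theta (prod_kernel k) = (fps_const (of_nat k) + fps_const (- 2 * of_nat k) * fps_X) * prod_kernel k"
proof (rule fps_ext)
  fix n
  consider "n < k" | "n = k" | i where "n = Suc (k + i)"
    by (metis less_imp_Suc_add linorder_less_linear)
  thus "fps_nth ((1 - fps_X) * theta (prod_kernel k)) n =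
      fps_nth ((fps_const (of_nat k) + fps_const (- 2 * of_nat k) * fps_X) * prod_kernel k) n"
  proof cases
    case 3
    have e: "of_nat (Suc i) * of_nat (k choose Suc i) = ((of_nat k - of_nat i) * of_nat (k choose i) :: rat)"
      unfolding choose_Suc_down by simp
    have "fps_nth ((1 - fps_X) * theta (prod_kernel k)) n -
        fps_nth ((fps_const (of_nat k) + fps_const (- 2 * of_nat k) * fps_X) * prod_kernel k) n
       = - ((-1) ^ i) * (of_nat (Suc i) * of_nat (k choose Suc i) - (of_nat k - of_nat i) * of_nat (k choose i))"
      using 3 by (simp add: prod_kernel_def fps_nth_one_minus_X_mult distrib_right mult.assoc Suc_diff_le)
        (simp add: algebra_simps)
    thus ?thesis unfolding e by simp
  qed (auto simp: prod_kernel_def fps_nth_one_minus_X_mult distrib_right mult.assoc)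
qed

lemma clausen_op_prod_kernel:
  "(1 - fps_X) * clausen_op (prod_kernel k) =
      (1 - 2 * fps_X) * (fps_const (of_nat k ^ 3) * prod_kernel k + fps_const ((-1) * (4 * (of_nat k + 1/2) ^ 3)) * prod_kernel (Suc k))"
proof -
  define z :: "rat fps" where "z = fps_X"
  define A :: "rat fps" where "A = fps_const (of_nat k)"
  define h :: "rat fps" where "h = fps_const (1/2)"
  have h: "2 * h = 1" by (simp add: h_def numeral_fps_const)
  have A: "fps_const (- 2 * of_nat k) = - 2 * A" "fps_const (of_nat k + - 2 * of_nat k) = - A"
     "fps_const (of_nat k ^ 3) = A ^ 3" "fps_const ((-1) * (4 * (of_nat k + 1/2) ^ 3)) = - (4 * A^3 + 6 * A^2 + 3 * A + h)"
    using half_cube[of k]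
    by (simp_all add: A_def h_def numeral_fps_const fps_const_power fps_const_neg[symmetric] del: fps_const_neg)
  have "(1 - fps_X) * clausen_op (prod_kernel k) = ((A - 2 * A * z) ^ 3 + 3 * (A - 2 * A * z) * z * (- A) + (- A) * z * (1 + z)
      - 3 * z * ((A - 2 * A * z) ^ 2 + (- A) * z)
      - (2 * z - 3 * z^2) * (A - 2 * A * z) - (1 - z) * (h * z - z^2)) * prod_kernel k"
    using clausen_op_first_order[OF prod_kernel_ode[of k]] unfolding A z_def[symmetric] h_def[symmetric] A_def[symmetric] by simp
  \<comment> \<open>\<open>h\<close> is the opaque constant 1/2; the term with 1 - 2h is what
    remains when it is treated as a variable, and it vanishes in the next step.\<close>
  also have "\<dots> = ((1 - 2 * z) * (A ^ 3 - (4 * A^3 + 6 * A^2 + 3 * A + h) * (z - z^2)) + (1 - 2 * h) * (z^2 - z^3)) * prod_kernel k"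
    by (simp add: algebra_simps power2_eq_square power3_eq_cube)
  also have "\<dots> = (1 - 2 * z) * (A ^ 3 * prod_kernel k - (4 * A^3 + 6 * A^2 + 3 * A + h) * prod_kernel (Suc k))"
    unfolding h prod_kernel_Suc z_def[symmetric] by (simp add: algebra_simps)
  finally show ?thesis unfolding A z_def unfolding mult_minus_left add_uminus_conv_diff .
qed

lemma koebe_kernel_Suc: "(1 - fps_X) ^ 2 * koebe_kernel (Suc k) = fps_X * koebe_kernel k"
proof (rule fps_ext)
  fix n
  have *: "(1 - fps_X) ^ 2 * koebe_kernel (Suc k) = (1 - fps_X) * ((1 - fps_X) * koebe_kernel (Suc k))"
    by (simp add: power2_eq_square mult.assoc)
  consider "n = 0" | "n = 1" | i where "n = Suc (Suc i)"
    by (metis One_nat_def not0_implies_Suc)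
  thus "fps_nth ((1 - fps_X) ^ 2 * koebe_kernel (Suc k)) n = fps_nth (fps_X * koebe_kernel k) n"
    unfolding * fps_nth_one_minus_X_mult
    by cases (auto simp: koebe_kernel_def binomial_eq_0 algebra_simps)
qed

lemma koebe_kernel_ode:
  "(1 - fps_X) * theta (koebe_kernel k) = (fps_const (of_nat k) + fps_const (of_nat k + 1) * fps_X) * koebe_kernel k"
proof (rule fps_ext)
  fix n
  show "fps_nth ((1 - fps_X) * theta (koebe_kernel k)) n =
      fps_nth ((fps_const (of_nat k) + fps_const (of_nat k + 1) * fps_X) * koebe_kernel k) n"
  proof (cases n)
    case (Suc i)
    have "(of_nat (Suc i) - of_nat k) * of_nat ((Suc i + k) choose (2 * k)) =
        (of_nat (Suc i + k) * of_nat ((i + k) choose (2 * k)) :: rat)"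
      by (rule choose_double_rec)
    thus ?thesis using Suc
      by (simp add: koebe_kernel_def fps_nth_one_minus_X_mult distrib_right mult.assoc) (simp add: algebra_simps)
  qed (auto simp: koebe_kernel_def fps_nth_one_minus_X_mult distrib_right mult.assoc)
qed

lemma clausen_op_koebe_kernel:
  "(1 - fps_X) * clausen_op (koebe_kernel k) =
      (1 - fps_X ^ 2) * (1 - fps_X) * (fps_const (of_nat k ^ 3) * koebe_kernel k + fps_const (1 * (4 * (of_nat k + 1/2) ^ 3)) * koebe_kernel (Suc k))"
proof -
  define z :: "rat fps" where "z = fps_X"
  define A :: "rat fps" where "A = fps_const (of_nat k)"
  define h :: "rat fps" where "h = fps_const (1/2)"
  have h: "2 * h = 1" by (simp add: h_def numeral_fps_const)
  have A: "fps_const (of_nat k + 1) = A + 1" "fps_const (of_nat k + (of_nat k + 1)) = 2 * A + 1"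
     "fps_const (of_nat k ^ 3) = A ^ 3" "fps_const (1 * (4 * (of_nat k + 1/2) ^ 3)) = 4 * A^3 + 6 * A^2 + 3 * A + h"
    using half_cube[of k]
    by (simp_all add: A_def h_def numeral_fps_const fps_const_power flip: fps_const_1_eq_1)
  have "(1 - fps_X) * clausen_op (koebe_kernel k) = ((A + (A + 1) * z) ^ 3 + 3 * (A + (A + 1) * z) * z * (2 * A + 1) + (2 * A + 1) * z * (1 + z)
      - 3 * z * ((A + (A + 1) * z) ^ 2 + (2 * A + 1) * z)
      - (2 * z - 3 * z^2) * (A + (A + 1) * z) - (1 - z) * (h * z - z^2)) * koebe_kernel k"
    using clausen_op_first_order[OF koebe_kernel_ode[of k]] unfolding A z_def[symmetric] h_def[symmetric] A_def[symmetric] by simp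
  also have "\<dots> = ((1 + z) * ((1 - z)^2 * A ^ 3 + (4 * A^3 + 6 * A^2 + 3 * A + h) * z) + (1 - 2 * h) * z) * koebe_kernel k"
    by (simp add: algebra_simps power2_eq_square power3_eq_cube)
  also have "\<dots> = (1 + z) * ((1 - z)^2 * A ^ 3 * koebe_kernel k + (4 * A^3 + 6 * A^2 + 3 * A + h) * (z * koebe_kernel k))"
    unfolding h by (simp add: algebra_simps)
  also have "\<dots> = (1 + z) * (1 - z)^2 * (A ^ 3 * koebe_kernel k + (4 * A^3 + 6 * A^2 + 3 * A + h) * koebe_kernel (Suc k))"
    unfolding z_def koebe_kernel_Suc[symmetric] by (simp add: algebra_simps)
  also have "(1 + z) * (1 - z)^2 = (1 - z^2) * (1 - z)" by (simp add: algebra_simps power2_eq_square)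
  finally show ?thesis unfolding A z_def .
qed

definition central_sq_conv :: "nat \<Rightarrow> rat" where
  "central_sq_conv n = (\<Sum>k = 0..n. of_nat ((2 * k) choose k) ^ 2 * of_nat ((2 * n - 2 * k) choose (n - k)) ^ 2)"

lemma central_sq_conv_fps: "fps_nth (central_sq_fps * central_sq_fps) n = central_sq_conv n / 16 ^ n"
proof -
  have "(of_nat (2 * k choose k) / 4 ^ k) ^ 2 * (of_nat (2 * (n - k) choose (n - k)) / 4 ^ (n - k)) ^ 2 =
     (of_nat ((2 * k) choose k) ^ 2 * of_nat ((2 * n - 2 * k) choose (n - k)) ^ 2) / (16 ^ n :: rat)" if "k \<le> n" for k
  proof -
    have "(16::rat) ^ n = (4 ^ k) ^ 2 * (4 ^ (n - k)) ^ 2"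
    proof -
      have "(4 ^ k) ^ 2 * (4 ^ (n - k)) ^ 2 = ((4 ^ k * 4 ^ (n - k)) ^ 2 :: rat)" by (simp add: power_mult_distrib)
      also have "4 ^ k * 4 ^ (n - k) = (4 ^ n :: rat)" using that by (simp flip: power_add)
      also have "(4 ^ n) ^ 2 = ((4 ^ 2) ^ n :: rat)" by (simp only: power_mult[symmetric] mult.commute)
      finally show ?thesis by simp
    qed
    thus ?thesis by (simp add: power_divide diff_mult_distrib2)
  qed
  thus ?thesis
    by (simp add: fps_mult_nth central_sq_fps_def central_sq_conv_def sum_divide_distrib)
qed

text \<open>Both generating functions have constant term 1 and are annihilated by
  \<open>clausen_op\<close>, the right one up to order n, which is all that the n-th coefficient
  needs. Cutting the sum at n loses nothing because the k-th kernel starts at z^k.\<close>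

lemma central_sq_conv_formula1:
  "central_sq_conv n = (\<Sum>k\<le>n. of_nat (2 * k choose k) ^ 3 * of_nat (k choose (n - k)) * (- 16) ^ (n - k))"
proof -
  define e :: "nat \<Rightarrow> rat" where "e = (\<lambda>k. of_nat (2 * k choose k) ^ 3 / 16 ^ k)"
  have e: "of_nat (Suc k) ^ 3 * e (Suc k) = - (- 1) * (4 * (of_nat k + 1/2) ^ 3) * e k" for k
  proof -
    have "(of_nat (Suc k) * of_nat (2 * Suc k choose Suc k)) ^ 3 = (2 * (2 * of_nat k + 1) * of_nat (2 * k choose k) :: rat) ^ 3"
      by (simp only: central_binomial_Suc)
    thus ?thesis unfolding e_def
      by (simp add: power_mult_distrib divide_simps) (simp add: algebra_simps power3_eq_cube)
  qed
  have "fps_nth (central_sq_fps * central_sq_fps) n = fps_nth (\<Sum>k\<le>n. fps_const (e k) * prod_kernel k) n"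
  proof (rule clausen_op_unique[of n])
    show "fps_nth (clausen_op (\<Sum>k\<le>n. fps_const (e k) * prod_kernel k)) m = 0" if "m \<le> n" for m
      by (rule clausen_op_telescope[OF clausen_op_prod_kernel e _ that]) (simp add: prod_kernel_def)
    show "fps_nth (central_sq_fps * central_sq_fps) 0 = fps_nth (\<Sum>k\<le>n. fps_const (e k) * prod_kernel k) 0"
      by (simp add: fps_sum_nth central_sq_fps_def prod_kernel_def e_def if_distrib[of "\<lambda>x. _ * x"] cong: if_cong)
  qed (simp_all add: clausen_op_square[OF central_sq_fps_ode])
  hence "central_sq_conv n = (\<Sum>k\<le>n. 16 ^ n * (e k * fps_nth (prod_kernel k) n))"
    unfolding sum_distrib_left[symmetric] by (simp add: central_sq_conv_fps fps_sum_nth divide_simps mult.commute)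
  also have "\<dots> = (\<Sum>k\<le>n. of_nat (2 * k choose k) ^ 3 * of_nat (k choose (n - k)) * (- 16) ^ (n - k))"
  proof (rule sum.cong)
    fix k assume "k \<in> {..n}"
    hence "(16::rat) ^ n = 16 ^ k * 16 ^ (n - k)" "(- 16 :: rat) ^ (n - k) = (-1) ^ (n - k) * 16 ^ (n - k)" "k \<le> n"
      by (simp_all flip: power_add add: power_mult_distrib[symmetric])
    thus "16 ^ n * (e k * fps_nth (prod_kernel k) n) = of_nat (2 * k choose k) ^ 3 * of_nat (k choose (n - k)) * (- 16) ^ (n - k)"
      by (simp add: e_def prod_kernel_def)
  qed simp
  finally show ?thesis .
qed

text \<open>The same argument with the other kernels; the opposite sign \<open>s\<close> in the
  telescoping lemma turns 16^k into (-16)^k.\<close>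

lemma central_sq_conv_formula2:
  "central_sq_conv n = 16 ^ n * (\<Sum>k\<le>n. of_nat (2 * k choose k) ^ 3 / (- 16) ^ k * of_nat ((n + k) choose (2 * k)))"
proof -
  define e :: "nat \<Rightarrow> rat" where "e = (\<lambda>k. of_nat (2 * k choose k) ^ 3 / (- 16) ^ k)"
  have e: "of_nat (Suc k) ^ 3 * e (Suc k) = - 1 * (4 * (of_nat k + 1/2) ^ 3) * e k" for k
  proof -
    have "(of_nat (Suc k) * of_nat (2 * Suc k choose Suc k)) ^ 3 = (2 * (2 * of_nat k + 1) * of_nat (2 * k choose k) :: rat) ^ 3"
      by (simp only: central_binomial_Suc)
    thus ?thesis unfolding e_def
      by (simp add: power_mult_distrib divide_simps) (simp add: algebra_simps power3_eq_cube)
  qed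
  have "fps_nth (central_sq_fps * central_sq_fps) n = fps_nth (\<Sum>k\<le>n. fps_const (e k) * koebe_kernel k) n"
  proof (rule clausen_op_unique[of n])
    show "fps_nth (clausen_op (\<Sum>k\<le>n. fps_const (e k) * koebe_kernel k)) m = 0" if "m \<le> n" for m
      by (rule clausen_op_telescope[OF clausen_op_koebe_kernel e _ that]) (simp add: koebe_kernel_def)
    have "(\<Sum>k\<le>n. e k * of_nat (k choose (2 * k))) = (\<Sum>k\<le>n. if k = 0 then 1 else 0)"
      by (rule sum.cong) (auto simp: e_def)
    thus "fps_nth (central_sq_fps * central_sq_fps) 0 = fps_nth (\<Sum>k\<le>n. fps_const (e k) * koebe_kernel k) 0"
      by (simp add: fps_sum_nth central_sq_fps_def koebe_kernel_def)
  qed (simp_all add: clausen_op_square[OF central_sq_fps_ode])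
  hence "central_sq_conv n = 16 ^ n * (\<Sum>k\<le>n. e k * fps_nth (koebe_kernel k) n)"
    by (simp add: central_sq_conv_fps fps_sum_nth divide_simps mult.commute)
  thus ?thesis by (simp add: e_def koebe_kernel_def)
qed

section \<open>Congruences between p-integral rationals\<close>

text \<open>For n = N, where 2N + 1 = p, this pairs j with p - j.\<close>

lemma sum_fold:
  fixes f :: "nat \<Rightarrow> 'a::comm_monoid_add"
  shows "(\<Sum>j = 1..2 * n. f j) = (\<Sum>j = 1..n. f j) + (\<Sum>j = 1..n. f (2 * n + 1 - j))"
proof -
  have "(\<Sum>j = 1..2 * n. f j) = (\<Sum>j = 1..n. f j) + (\<Sum>j = n+1..n+n. f j)"
    using sum.ub_add_nat[of 1 n f n] by (simp add: mult_2)
  also have "(\<Sum>j = n+1..n+n. f j) = (\<Sum>j = 1..n. f (2 * n + 1 - j))"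
    by (rule sum.reindex_bij_witness[of _ "\<lambda>j. 2 * n + 1 - j" "\<lambda>j. 2 * n + 1 - j"]) auto
  finally show ?thesis .
qed

lemma prod_fold:
  fixes f :: "nat \<Rightarrow> 'a::comm_monoid_mult"
  shows "(\<Prod>j = 1..2 * n. f j) = (\<Prod>j = 1..n. f j) * (\<Prod>j = 1..n. f (2 * n + 1 - j))"
proof -
  have "(\<Prod>j = 1..2 * n. f j) = (\<Prod>j = 1..n. f j) * (\<Prod>j = n+1..n+n. f j)"
    using prod.ub_add_nat[of 1 n f n] by (simp add: mult_2)
  also have "(\<Prod>j = n+1..n+n. f j) = (\<Prod>j = 1..n. f (2 * n + 1 - j))"
    by (rule prod.reindex_bij_witness[of _ "\<lambda>j. 2 * n + 1 - j" "\<lambda>j. 2 * n + 1 - j"]) auto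
  finally show ?thesis .
qed

text \<open>The odd indices are written as 2n + 1 - 2j so that for n = N they become p - 2j, which
  is -2j modulo p.\<close>

lemma sum_parity:
  fixes f :: "nat \<Rightarrow> 'a::comm_monoid_add"
  shows "(\<Sum>j = 1..2 * n. f j) = (\<Sum>j = 1..n. f (2 * j)) + (\<Sum>j = 1..n. f (2 * n + 1 - 2 * j))"
proof -
  have "(\<Sum>j = 1..2 * n. f j) = (\<Sum>j = 1..n. f (2 * j)) + (\<Sum>j = 1..n. f (2 * j - 1))"
    by (induction n) (simp_all add: ac_simps)
  also have "(\<Sum>j = 1..n. f (2 * j - 1)) = (\<Sum>j = 1..n. f (2 * n + 1 - 2 * j))"
    by (rule sum.reindex_bij_witness[of _ "\<lambda>j. n + 1 - j" "\<lambda>j. n + 1 - j"]) (auto simp: diff_mult_distrib2)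
  finally show ?thesis .
qed

lemma central_binomial_prod: "(\<Prod>j = 1..n. (2 * of_nat j - 1) / (2 * of_nat j)) = (of_nat (2 * n choose n) / 4 ^ n :: rat)"
proof (induction n)
  case (Suc n)
  have "of_nat (2 * Suc n choose Suc n) = (2 * (2 * of_nat n + 1) * of_nat (2 * n choose n) / of_nat (Suc n) :: rat)"
    using central_binomial_Suc[of n, where 'a = rat] by (simp add: field_simps del: binomial_Suc_Suc)
  thus ?case using Suc by (simp add: field_simps del: binomial_Suc_Suc)
qed simp

section \<open>Arithmetic of p-integral rationals\<close>

locale prime_gt3 =
  fixes p :: nat
  assumes prime_p: "prime p" and p_gt3: "p > 3"
begin

text \<open>Unlike \<open>p_cong\<close>, this asks for integrality of (x - y)/p^a only and not of x
  and y. Sums, differences and transitivity then carry no side conditions; integrality of the two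
  sides is restored once, through \<open>p_cong_iff\<close>.\<close>

definition pcong :: "nat \<Rightarrow> rat \<Rightarrow> rat \<Rightarrow> bool" where
  "pcong a x y \<longleftrightarrow> (\<exists>z. p_integral p z \<and> x - y = of_nat p ^ a * z)"

abbreviation Zp :: "rat \<Rightarrow> bool" where "Zp \<equiv> p_integral p"

definition N :: nat where "N = (p - 1) div 2"

lemma p_eq: "p = 2 * N + 1"
  using prime_p p_gt3 prime_odd_nat[of p] unfolding N_def by (auto elim!: oddE)

lemma of_nat_p: "of_nat p = (2 * of_nat N + 1 :: 'a::semiring_1)"
  by (subst p_eq) (simp only: of_nat_add of_nat_mult of_nat_numeral of_nat_1)

lemma p_minus_1: "p - 1 = 2 * N" "p - Suc 0 = 2 * N"
  using p_eq by linarith+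

text \<open>Any fraction with denominator prime to p will do, not only the reduced one, so closure
  under sums and products is a computation with common denominators. A denominator 0 is excluded
  because p divides 0.\<close>

lemma Zp_iff: "Zp x \<longleftrightarrow> (\<exists>a b. x = of_int a / of_int b \<and> \<not> int p dvd b)"
proof
  have pr: "prime (int p)" using prime_p by simp
  obtain c d where q: "quotient_of x = (c, d)" by (cases "quotient_of x")
  have d: "d > 0" "coprime c d" "x = of_int c / of_int d"
    using quotient_of_denom_pos[OF q] quotient_of_coprime[OF q] quotient_of_div[OF q] by auto
  have Zp: "Zp x \<longleftrightarrow> \<not> int p dvd d"
    unfolding p_integral_def q snd_conv
    using pr by (metis coprime_commute prime_imp_coprime coprime_absorb_left not_prime_unit)
  show "\<exists>a b. x = of_int a / of_int b \<and> \<not> int p dvd b" if "Zp x"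
    using that d Zp by blast
  assume "\<exists>a b. x = of_int a / of_int b \<and> \<not> int p dvd b"
  then obtain a b where ab: "x = of_int a / of_int b" "\<not> int p dvd b" by blast
  hence "b \<noteq> 0" by auto
  hence "(of_int a * of_int d :: rat) = of_int c * of_int b"
    using d(1) ab(1) d(3) by (simp add: frac_eq_eq)
  hence "a * d = c * b" by (metis of_int_mult of_int_eq_iff)
  hence "d dvd c * b" by (metis dvd_triv_right)
  hence "d dvd b" using d(2) by (simp add: coprime_commute coprime_dvd_mult_right_iff)
  thus "Zp x" using Zp ab(2) dvd_trans by blast
qed

lemma Zp_of_int [simp, intro]: "Zp (of_int a)"
proof -
  have "\<not> int p dvd 1" using p_gt3 by simp
  thus ?thesis unfolding Zp_iff by (intro exI[of _ a] exI[of _ 1]) simp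
qed

lemma Zp_of_nat [simp, intro]: "Zp (of_nat a)"
  using Zp_of_int[of "int a"] by simp

lemma Zp_num [simp, intro]: "Zp 0" "Zp 1" "Zp (numeral k)"
  using Zp_of_int[of 0] Zp_of_int[of 1] Zp_of_int[of "numeral k"] by simp_all

lemma Zp_add [simp, intro]: assumes "Zp x" "Zp y" shows "Zp (x + y)"
  and Zp_mult [simp, intro]: "Zp (x * y)"
proof -
  obtain a b c d where *: "x = of_int a / of_int b" "\<not> int p dvd b" "y = of_int c / of_int d" "\<not> int p dvd d"
    using assms unfolding Zp_iff by blast
  hence bd: "\<not> int p dvd b * d" using prime_p by (simp add: prime_dvd_mult_iff)
  have "b \<noteq> 0" "d \<noteq> 0" using * by auto
  hence "x + y = of_int (a * d + c * b) / of_int (b * d)" "x * y = of_int (a * c) / of_int (b * d)"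
    unfolding * by (simp_all add: field_simps)
  thus "Zp (x + y)" "Zp (x * y)" using bd unfolding Zp_iff by blast+
qed

lemma Zp_minus [simp, intro]: "Zp x \<Longrightarrow> Zp (- x)"
  using Zp_mult[OF Zp_of_int[of "- 1"], of x] by simp

lemma Zp_diff [simp, intro]: "Zp x \<Longrightarrow> Zp y \<Longrightarrow> Zp (x - y)"
  using Zp_add[of x "- y"] by simp

lemma Zp_power [simp, intro]: "Zp x \<Longrightarrow> Zp (x ^ n)"
  by (induction n) simp_all

lemma Zp_sum [intro]: "(\<And>i. i \<in> A \<Longrightarrow> Zp (f i)) \<Longrightarrow> Zp (sum f A)"
  by (induction A rule: infinite_finite_induct) simp_all

lemma Zp_prod [intro]: "(\<And>i. i \<in> A \<Longrightarrow> Zp (f i)) \<Longrightarrow> Zp (prod f A)"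
  by (induction A rule: infinite_finite_induct) simp_all

lemma Zp_inverse_nat: "\<not> p dvd n \<Longrightarrow> Zp (inverse (of_nat n))"
  unfolding Zp_iff by (intro exI[of _ 1] exI[of _ "int n"]) (simp add: field_simps)

lemma Zp_div_nat: "Zp x \<Longrightarrow> \<not> p dvd n \<Longrightarrow> Zp (x / of_nat n)"
  using Zp_mult[of x "inverse (of_nat n)"] Zp_inverse_nat[of n] by (simp add: field_simps)

lemma not_dvd_less: "0 < n \<Longrightarrow> n < p \<Longrightarrow> \<not> p dvd n"
  using dvd_imp_le by fastforce

lemma not_dvd_fact: "n < p \<Longrightarrow> \<not> p dvd fact n"
  using prime_p by (simp add: prime_dvd_fact_iff)

lemma not_dvd_2power: "\<not> p dvd 2 ^ n"
proof
  assume "p dvd 2 ^ n"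
  hence "p dvd 2" using prime_p prime_dvd_power by blast
  thus False using p_gt3 by (auto dest: dvd_imp_le)
qed

lemma Zp_div_2power: "Zp x \<Longrightarrow> Zp (x / 2 ^ n)"
  using Zp_div_nat[OF _ not_dvd_2power, of x n] by simp

lemma Zp_div_2: "Zp x \<Longrightarrow> Zp (x / 2)" "Zp x \<Longrightarrow> Zp (x / 4)" "Zp x \<Longrightarrow> Zp (x / 8)"
  using Zp_div_2power[of x 1] Zp_div_2power[of x 2] Zp_div_2power[of x 3] by simp_all

lemma pcongI: "Zp z \<Longrightarrow> x = y + of_nat p ^ a * z \<Longrightarrow> pcong a x y"
  unfolding pcong_def by (intro exI[of _ z]) simp

lemma pcongE: assumes "pcong a x y" obtains z where "Zp z" "x = y + of_nat p ^ a * z"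
  using assms unfolding pcong_def by (metis add.commute diff_add_cancel)

lemma pcong_refl [simp]: "pcong a x x"
  by (rule pcongI[of 0]) simp_all

lemma pcong_sym: assumes "pcong a x y" shows "pcong a y x"
proof -
  obtain z where "Zp z" "x = y + of_nat p ^ a * z" using assms by (rule pcongE)
  thus ?thesis by (intro pcongI[of "- z"]) simp_all
qed

lemma pcong_add: assumes "pcong a x y" "pcong a x' y'" shows "pcong a (x + x') (y + y')"
proof -
  obtain z where "Zp z" "x = y + of_nat p ^ a * z" using assms(1) by (rule pcongE)
  moreover obtain z' where "Zp z'" "x' = y' + of_nat p ^ a * z'" using assms(2) by (rule pcongE)
  ultimately show ?thesis by (intro pcongI[of "z + z'"]) (simp_all add: distrib_left)
qed

lemma pcong_trans [trans]: assumes "pcong a x y" "pcong a y z" shows "pcong a x z"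
  using pcong_add[OF assms] by (simp add: pcong_def)

lemma pcong_cmult: assumes "Zp c" "pcong a x y" shows "pcong a (c * x) (c * y)"
proof -
  obtain z where "Zp z" "x = y + of_nat p ^ a * z" using assms(2) by (rule pcongE)
  thus ?thesis using assms(1) by (intro pcongI[of "c * z"]) (simp_all add: algebra_simps)
qed

lemma pcong_minus: "pcong a x y \<Longrightarrow> pcong a (- x) (- y)"
  using pcong_cmult[OF Zp_minus[OF Zp_num(2)], of a x y] by simp

lemma pcong_diff: "pcong a x y \<Longrightarrow> pcong a x' y' \<Longrightarrow> pcong a (x - x') (y - y')"
  using pcong_add[of a x y "- x'" "- y'"] pcong_minus[of a x' y'] by simp

lemma pcong_multc: "Zp c \<Longrightarrow> pcong a x y \<Longrightarrow> pcong a (x * c) (y * c)"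
  using pcong_cmult[of c a x y] by (simp add: mult.commute)

lemma pcong_mult: "pcong a x y \<Longrightarrow> pcong a x' y' \<Longrightarrow> Zp x \<Longrightarrow> Zp y' \<Longrightarrow> pcong a (x * x') (y * y')"
  using pcong_trans[OF pcong_cmult[of x a x' y'] pcong_multc[of y' a x y]] by simp

lemma pcong_sum: "(\<And>i. i \<in> A \<Longrightarrow> pcong a (f i) (g i)) \<Longrightarrow> pcong a (sum f A) (sum g A)"
  by (induction A rule: infinite_finite_induct) (simp_all add: pcong_add)

lemma pcong_prod: "(\<And>i. i \<in> A \<Longrightarrow> pcong a (f i) (g i) \<and> Zp (f i) \<and> Zp (g i)) \<Longrightarrow> pcong a (prod f A) (prod g A)"
  by (induction A rule: infinite_finite_induct) (simp_all add: pcong_mult Zp_prod)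

lemma pcong_power: "pcong a x y \<Longrightarrow> Zp x \<Longrightarrow> Zp y \<Longrightarrow> pcong a (x ^ n) (y ^ n)"
  by (induction n) (simp_all add: pcong_mult)

lemma pcong_mono: assumes "pcong a x y" "b \<le> a" shows "pcong b x y"
proof -
  obtain z where "Zp z" "x = y + of_nat p ^ a * z" using assms(1) by (rule pcongE)
  moreover have "of_nat p ^ a = (of_nat p ^ b * of_nat p ^ (a - b) :: rat)"
    using assms(2) by (simp flip: power_add)
  ultimately show ?thesis by (intro pcongI[of "of_nat p ^ (a - b) * z"]) simp_all
qed

text \<open>The way precision is saved throughout: behind an explicit factor p^b, a claim modulo
  p^(a+b) needs only one modulo p^a.\<close>

lemma pcong_scale: assumes "pcong a x y" shows "pcong (a + b) (of_nat p ^ b * x) (of_nat p ^ b * y)"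
proof -
  obtain z where "Zp z" "x = y + of_nat p ^ a * z" using assms by (rule pcongE)
  thus ?thesis by (intro pcongI[of z]) (simp_all add: algebra_simps power_add)
qed

lemma pcong_Zp: assumes "pcong a x y" "Zp y" shows "Zp x"
proof -
  obtain z where "Zp z" "x = y + of_nat p ^ a * z" using assms(1) by (rule pcongE)
  thus ?thesis using assms(2) by simp
qed

lemma pcong_inverse:
  assumes "pcong a x y" "Zp (inverse x)" "Zp (inverse y)" "x \<noteq> 0" "y \<noteq> 0"
  shows "pcong a (inverse x) (inverse y)"
proof -
  have "pcong a (inverse x * inverse y * y) (inverse x * inverse y * x)"
    using assms by (intro pcong_cmult Zp_mult) (auto intro: pcong_sym)
  thus ?thesis using assms by (simp add: field_simps)
qed

lemma pcong_p_multiple: "Zp z \<Longrightarrow> pcong a (x + of_nat p ^ a * z) x"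
  unfolding pcong_def by auto

lemma pcong_of_int: assumes "[a = b] (mod int p ^ n)" shows "pcong n (of_int a) (of_int b)"
proof -
  obtain c where "a - b = int p ^ n * c" using assms unfolding cong_iff_dvd_diff by (rule dvdE)
  hence "a = b + int p ^ n * c" by simp
  thus ?thesis by (intro pcongI[of "of_int c"]) simp_all
qed

lemma p_cong_iff: "p_cong p a x y \<longleftrightarrow> Zp y \<and> pcong a x y"
  unfolding p_cong_def using pcong_Zp[of a x y] by (auto simp: pcong_def)

text \<open>Only the first-order terms survive, because a product of two perturbations already
  contains p^4.\<close>

lemma pcong_prod_one_plus_p2_linear:
  assumes "\<And>i. i \<in> A \<Longrightarrow> Zp (f i)"
  shows "pcong 4 (\<Prod>i\<in>A. 1 + of_nat p ^ 2 * f i) (1 + of_nat p ^ 2 * (\<Sum>i\<in>A. f i))"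
  using assms
proof (induction A rule: infinite_finite_induct)
  case (insert x A)
  have "pcong 4 ((1 + of_nat p ^ 2 * f x) * (\<Prod>i\<in>A. 1 + of_nat p ^ 2 * f i))
      ((1 + of_nat p ^ 2 * f x) * (1 + of_nat p ^ 2 * (\<Sum>i\<in>A. f i)))"
    using insert by (intro pcong_cmult) auto
  also have "\<dots> = (1 + of_nat p ^ 2 * (f x + (\<Sum>i\<in>A. f i))) + of_nat p ^ 4 * (f x * (\<Sum>i\<in>A. f i))"
    by (simp add: algebra_simps power2_eq_square power4_eq_xxxx)
  also have "pcong 4 \<dots> (1 + of_nat p ^ 2 * (f x + (\<Sum>i\<in>A. f i)))"
    using insert by (intro pcong_p_multiple Zp_mult Zp_sum) auto
  finally show ?case using insert by simp
qed simp_all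

lemma Zp_inv_sq: "0 < j \<Longrightarrow> j < p \<Longrightarrow> Zp (1 / of_nat j ^ 2)"
  using Zp_power[OF Zp_inverse_nat[OF not_dvd_less], of j 2] by (simp add: field_simps)

lemma pcong_inv_p_minus:
  assumes "0 < j" "j < p"
  shows "pcong 1 (1 / (of_nat p - of_nat j)) (- (1 / of_nat j))"
proof -
  have "pcong 1 (inverse (of_nat (p - j))) (inverse (- of_nat j))"
    by (rule pcong_inverse)
       (use assms Zp_inverse_nat[OF not_dvd_less, of j] Zp_inverse_nat[OF not_dvd_less, of "p - j"]
        in \<open>auto simp: of_nat_diff pcong_def\<close>)
  thus ?thesis using assms by (simp add: of_nat_diff field_simps)
qed

lemma pcong_inv_sq_p_minus:
  assumes "0 < j" "j < p"
  shows "pcong 1 (1 / (of_nat p - of_nat j) ^ 2) (1 / of_nat j ^ 2)"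
proof -
  have "Zp (1 / (of_nat p - of_nat j))" "Zp (1 / of_nat j)"
    using assms Zp_inverse_nat[OF not_dvd_less, of j] Zp_inverse_nat[OF not_dvd_less, of "p - j"]
    by (auto simp: of_nat_diff field_simps)
  thus ?thesis
    using pcong_power[OF pcong_inv_p_minus[OF assms], of 2] by (simp add: power_divide)
qed

section \<open>Harmonic sums and the congruences of Wolstenholme and Morley\<close>

definition harm2 :: "nat \<Rightarrow> rat" where "harm2 n = (\<Sum>j = 1..n. 1 / of_nat j ^ 2)"

definition alt_harm2 :: "nat \<Rightarrow> rat" where "alt_harm2 n = (\<Sum>j = 1..n. (- 1) ^ j / of_nat j ^ 2)"

lemma Zp_harm2: "n < p \<Longrightarrow> Zp (harm2 n)"
  unfolding harm2_def by (intro Zp_sum Zp_inv_sq) auto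

text \<open>Let H be the sum in question. Folding j to p - j shows that the sum up to p - 1 is 2H
  modulo p, while splitting by parity shows that it is H/4 + H/4. Hence 3H/2 vanishes modulo p, and
  3 is invertible because p > 3.\<close>

lemma harm2_N: "pcong 1 (harm2 N) 0"
proof -
  have e: "2 * N + 1 - j = p - j" for j using p_eq by simp
  have "pcong 1 (harm2 (2 * N)) (harm2 N + harm2 N)"
    unfolding harm2_def sum_fold e
    by (intro pcong_add pcong_sum pcong_refl) (use p_eq in \<open>auto simp: of_nat_diff simp del: One_nat_def intro!: pcong_inv_sq_p_minus\<close>)
  moreover have "pcong 1 (harm2 (2 * N)) (harm2 N / 4 + harm2 N / 4)"
    unfolding harm2_def sum_parity e sum_divide_distrib
  proof (intro pcong_add pcong_sum)
    fix i assume "i \<in> {1..N}"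
    hence "pcong 1 (1 / of_nat (p - 2 * i) ^ 2) (1 / of_nat (2 * i) ^ 2)"
      using pcong_inv_sq_p_minus[of "2 * i"] p_eq by (simp add: of_nat_diff)
    thus "pcong 1 (1 / of_nat (p - 2 * i) ^ 2) (1 / of_nat i ^ 2 / 4)"
      by (simp add: power_mult_distrib mult.commute)
  qed (simp add: power_mult_distrib mult.commute)
  ultimately have "pcong 1 (harm2 N + harm2 N) (harm2 N / 4 + harm2 N / 4)"
    using pcong_sym pcong_trans by blast
  hence "pcong 1 (harm2 N + harm2 N - (harm2 N / 4 + harm2 N / 4)) 0"
    using pcong_diff[OF _ pcong_refl, of 1 _ _ "harm2 N / 4 + harm2 N / 4"] by fastforce
  moreover have "\<not> p dvd 3" using p_gt3 by (intro not_dvd_less) auto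
  hence "Zp (2 * inverse (of_nat 3))" by (intro Zp_mult Zp_inverse_nat) auto
  ultimately have "pcong 1 (2 * inverse (of_nat 3) * (harm2 N + harm2 N - (harm2 N / 4 + harm2 N / 4))) (2 * inverse (of_nat 3) * 0)"
    by (rule pcong_cmult[rotated])
  thus ?thesis by (simp add: field_simps)
qed

text \<open>The sum of the \<open>f j\<close> vanishes modulo p because the harmonic sum does.\<close>

lemma pcong_prod_one_plus_p2:
  assumes "\<And>j. j \<in> {1..N} \<Longrightarrow> Zp (f j) \<and> pcong 1 (f j) (c * (1 / of_nat j ^ 2))" "Zp c"
  shows "pcong 3 (\<Prod>j = 1..N. 1 + of_nat p ^ 2 * f j) 1"
proof -
  have "pcong 1 (\<Sum>j = 1..N. f j) (c * harm2 N)"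
    unfolding harm2_def sum_distrib_left using assms by (intro pcong_sum) auto
  also have "pcong 1 (c * harm2 N) (c * 0)" using harm2_N assms by (intro pcong_cmult)
  finally have "pcong (1 + 2) (of_nat p ^ 2 * (\<Sum>j = 1..N. f j)) (of_nat p ^ 2 * 0)"
    by (intro pcong_scale) simp
  hence "pcong 3 (of_nat p ^ 2 * (\<Sum>j = 1..N. f j)) 0" by (simp add: numeral_3_eq_3)
  hence "pcong 3 (1 + of_nat p ^ 2 * (\<Sum>j = 1..N. f j)) (1 + 0)"
    by (intro pcong_add) auto
  moreover have "pcong 3 (\<Prod>j = 1..N. 1 + of_nat p ^ 2 * f j) (1 + of_nat p ^ 2 * (\<Sum>j = 1..N. f j))"
    using assms by (intro pcong_mono[OF pcong_prod_one_plus_p2_linear]) auto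
  ultimately show ?thesis using pcong_trans by fastforce
qed

lemma Zp_inv: "0 < j \<Longrightarrow> j < p \<Longrightarrow> Zp (1 / of_nat j)" "0 < j \<Longrightarrow> j < p \<Longrightarrow> Zp (1 / (of_nat p - of_nat j))"
  using Zp_inverse_nat[OF not_dvd_less, of j] Zp_inverse_nat[OF not_dvd_less, of "p - j"]
  by (auto simp: of_nat_diff field_simps)

text \<open>After pairing j with p - j, the factors combine to (p + j)(2p - j)/(j(p - j)) = 1 +
  2p^2/(j(p - j)), so no term of first order in p occurs.\<close>

lemma wolstenholme: "pcong 3 (of_nat ((2 * p - 1) choose (p - 1))) 1"
proof -
  have prod: "(\<Prod>j = 1..n. (of_nat m + of_nat j) / of_nat j) = (of_nat ((m + n) choose n) :: rat)" for m n
  proof (induction n)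
    case (Suc n)
    have "Suc n * ((m + Suc n) choose Suc n) = (m + Suc n) * ((m + n) choose n)"
      using Suc_times_binomial_eq[of "m + n" n] by (simp add: mult.commute)
    hence "of_nat (Suc n) * of_nat ((m + Suc n) choose Suc n) = (of_nat (m + Suc n) * of_nat ((m + n) choose n) :: rat)"
      by (metis of_nat_mult)
    thus ?case using Suc by (simp add: field_simps del: binomial_Suc_Suc)
  qed simp
  have "of_nat ((2 * p - 1) choose (p - 1)) = (of_nat ((p + 2 * N) choose (2 * N)) :: rat)"
  proof -
    have "2 * p - 1 = p + 2 * N" "p - 1 = 2 * N" using p_eq by auto
    thus ?thesis by simp
  qed
  also have "\<dots> = (\<Prod>j = 1..2 * N. (of_nat p + of_nat j) / of_nat j)" by (rule prod[symmetric])
  also have "\<dots> = (\<Prod>j = 1..N. 1 + of_nat p ^ 2 * (2 * (1 / of_nat j) * (1 / (of_nat p - of_nat j))))"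
    unfolding prod_fold prod.distrib[symmetric]
  proof (rule prod.cong)
    fix j assume "j \<in> {1..N}"
    hence j: "of_nat (2 * N + 1 - j) = (of_nat p - of_nat j :: rat)" "of_nat j \<noteq> (0::rat)" 
      "of_nat p - of_nat j \<noteq> (0::rat)" using p_eq by (auto simp: of_nat_diff)
    show "(of_nat p + of_nat j) / of_nat j * ((of_nat p + of_nat (2 * N + 1 - j)) / of_nat (2 * N + 1 - j)) =
         1 + of_nat p ^ 2 * (2 * (1 / of_nat j) * (1 / (of_nat p - of_nat j) :: rat))"
      unfolding j(1) using j(2,3) by (simp add: divide_simps) (simp add: algebra_simps power2_eq_square)
  qed simp
  also have "pcong 3 \<dots> 1"
  proof (rule pcong_prod_one_plus_p2[of _ "-2"])
    fix j assume "j \<in> {1..N}"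
    hence j: "0 < j" "j < p" using p_eq by auto
    have "pcong 1 (2 * (1 / of_nat j) * (1 / (of_nat p - of_nat j))) (2 * (1 / of_nat j) * (- (1 / of_nat j)))"
      using j by (intro pcong_cmult Zp_mult pcong_inv_p_minus Zp_inv) auto
    moreover have "Zp (2 * (1 / of_nat j) * (1 / (of_nat p - of_nat j)))"
      using j by (intro Zp_mult Zp_inv Zp_num)
    ultimately show "Zp (2 * (1 / of_nat j) * (1 / (of_nat p - of_nat j))) \<and>
      pcong 1 (2 * (1 / of_nat j) * (1 / (of_nat p - of_nat j))) (- 2 * (1 / of_nat j ^ 2))"
      by (simp add: power2_eq_square)
  qed auto
  finally show ?thesis .
qed

text \<open>M = C(2N,N) has the two product forms prod (p - j)/j and 4^N prod (p - 2j)/(2j). In the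
  quotient (M/4^N)^2/M the terms of first order in p cancel, since (p - 2j)^2 = p^2 - 4j(p - j):
  each factor becomes -(1 - p^2/(4j(p - j))).\<close>

lemma morley: "pcong 3 (of_nat ((p - 1) choose N) / 4 ^ (p - 1)) ((- 1) ^ N)"
proof -
  define M where "M = (of_nat (2 * N choose N) :: rat)"
  have "(\<Prod>j = 1..m. of_nat p - of_nat j) * fact (p - 1 - m) = (fact (p - 1) :: rat)" if "m \<le> p - 1" for m
    using that
  proof (induction m)
    case (Suc m)
    have "fact (p - 1 - m) = (of_nat p - of_nat (Suc m)) * (fact (p - 1 - Suc m) :: rat)"
      using Suc.prems by (subst fact_reduce) (auto simp: of_nat_diff)
    thus ?case using Suc by (simp add: mult.assoc)
  qed simp
  moreover have "N \<le> p - 1" "p - 1 - N = N" "p - 1 = 2 * N" using p_eq by auto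
  ultimately have "(\<Prod>j = 1..N. of_nat p - of_nat j) * fact N = (fact (2 * N) :: rat)"
    by metis
  moreover have "M = fact (2 * N) / (fact N * fact N)"
    using binomial_fact[of N "2 * N", where 'a = rat] by (simp add: M_def)
  ultimately have "M = ((\<Prod>j = 1..N. of_nat p - of_nat j) * fact N) / (fact N * fact N)"
    by simp
  hence "M = (\<Prod>j = 1..N. of_nat p - of_nat j) / fact N"
    by simp
  hence M1: "M = (\<Prod>j = 1..N. (of_nat p - of_nat j) / of_nat j)"
    by (simp add: prod_dividef fact_prod)
  have "M / 4 ^ N = (\<Prod>j = 1..N. (2 * of_nat j - 1)) / (\<Prod>j = 1..N. 2 * of_nat j)"
    unfolding M_def central_binomial_prod[symmetric] by (rule prod_dividef)
  also have "(\<Prod>j = 1..N. (2 * of_nat j - 1 :: rat)) = (\<Prod>j = 1..N. (2 * of_nat N + 1) - 2 * of_nat j)"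
    by (rule prod.reindex_bij_witness[of _ "\<lambda>j. N + 1 - j" "\<lambda>j. N + 1 - j"]) (auto simp: of_nat_diff)
  also have "2 * of_nat N + 1 = (of_nat p :: rat)" by (rule of_nat_p[symmetric])
  finally have M2: "M / 4 ^ N = (\<Prod>j = 1..N. (of_nat p - 2 * of_nat j) / (2 * of_nat j))"
    by (simp add: prod_dividef)
  have sq_div: "prod f A ^ 2 / prod g A = (\<Prod>x\<in>A. f x ^ 2 / g x)" for f g :: "nat \<Rightarrow> rat" and A
    by (simp only: prod_power_distrib prod_dividef)
  have "M \<noteq> 0" by (simp add: M_def)
  hence "of_nat ((p - 1) choose N) / 4 ^ (p - 1) = (M / 4 ^ N) ^ 2 / M"
    unfolding p_minus_1 by (simp add: M_def power2_eq_square mult_2 power_add)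
  also have "\<dots> = (\<Prod>j = 1..N. ((of_nat p - 2 * of_nat j) / (2 * of_nat j)) ^ 2 / ((of_nat p - of_nat j) / of_nat j))"
    unfolding M2 unfolding M1 by (rule sq_div)
  also have "\<dots> = (\<Prod>j = 1..N. (- 1) * (1 + of_nat p ^ 2 * ((- 1 / 4) * (1 / of_nat j) * (1 / (of_nat p - of_nat j)))))"
  proof (rule prod.cong)
    fix j assume "j \<in> {1..N}"
    hence j: "of_nat j \<noteq> (0::rat)" "of_nat p - of_nat j \<noteq> (0::rat)" using p_eq by (auto simp: of_nat_diff)
    \<comment> \<open>With D = p - j as a variable, p is D + J and all denominators are plain
      variables, which \<open>field_simps\<close> can clear.\<close>
    have "((D - J) / (2 * J)) ^ 2 / (D / J) = - 1 * (1 + (D + J) ^ 2 * ((- 1 / 4) * (1 / J) * (1 / D)))"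
      if "J \<noteq> 0" "D \<noteq> 0" for D J :: rat
      using that by (simp add: field_simps power2_eq_square)
    from this[OF j] have "((of_nat p - of_nat j - of_nat j) / (2 * of_nat j)) ^ 2 / ((of_nat p - of_nat j) / of_nat j) =
         - 1 * (1 + (of_nat p - of_nat j + of_nat j) ^ 2 * ((- 1 / 4) * (1 / of_nat j) * (1 / (of_nat p - of_nat j) :: rat)))" .
    moreover have "of_nat p - of_nat j - of_nat j = (of_nat p - 2 * of_nat j :: rat)"
      "of_nat p - of_nat j + of_nat j = (of_nat p :: rat)" by simp_all
    ultimately show "((of_nat p - 2 * of_nat j) / (2 * of_nat j)) ^ 2 / ((of_nat p - of_nat j) / of_nat j) =
         - 1 * (1 + of_nat p ^ 2 * ((- 1 / 4) * (1 / of_nat j) * (1 / (of_nat p - of_nat j) :: rat)))"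
      by (simp only:)
  qed simp
  also have "\<dots> = (- 1) ^ N * (\<Prod>j = 1..N. 1 + of_nat p ^ 2 * ((- 1 / 4) * (1 / of_nat j) * (1 / (of_nat p - of_nat j))))"
    by (simp only: prod.distrib) simp
  also have "pcong 3 \<dots> ((- 1) ^ N * 1)"
  proof (intro pcong_cmult pcong_prod_one_plus_p2[of _ "1/4"])
    fix j assume "j \<in> {1..N}"
    hence j: "0 < j" "j < p" using p_eq by auto
    have i4: "Zp (- 1 / 4)" using Zp_minus[OF Zp_div_2(2)[OF Zp_num(2)]] by simp
    have "pcong 1 (- 1 / 4 * (1 / of_nat j) * (1 / (of_nat p - of_nat j))) (- 1 / 4 * (1 / of_nat j) * (- (1 / of_nat j)))"
      using j i4 by (intro pcong_cmult Zp_mult pcong_inv_p_minus Zp_inv) auto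
    moreover have "Zp (- 1 / 4 * (1 / of_nat j) * (1 / (of_nat p - of_nat j)))"
      using j i4 by (intro Zp_mult Zp_inv)
    ultimately show "Zp (- 1 / 4 * (1 / of_nat j) * (1 / (of_nat p - of_nat j))) \<and>
      pcong 1 (- 1 / 4 * (1 / of_nat j) * (1 / (of_nat p - of_nat j))) (1 / 4 * (1 / of_nat j ^ 2))"
      by (simp add: power2_eq_square mult.assoc)
  qed (use Zp_div_2(2)[OF Zp_num(2)] in simp_all)
  finally show ?thesis by (simp only: mult_1_right)
qed

end

section \<open>Euler numbers modulo p\<close>

text \<open>In terms of the classical Euler polynomials this is \<open>2^m E_m((x+1)/2)\<close>.\<close>

definition euler_poly :: "nat \<Rightarrow> int \<Rightarrow> int" where
  "euler_poly m x = (\<Sum>k\<le>m. int (m choose k) * euler_number k * x ^ (m - k))"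

text \<open>A Taylor expansion at x. Regrouped by t, the coefficient of x^(m-t) is a binomial
  convolution of the Euler numbers with powers of s, which is the shape of their recurrence.\<close>

lemma euler_poly_shift:
  "euler_poly m (x + s) = (\<Sum>t\<le>m. int (m choose t) * x ^ (m - t) * (\<Sum>i\<le>t. int (t choose i) * s ^ i * euler_number (t - i)))"
proof -
  define g where "g = (\<lambda>i k. int (m choose k) * euler_number k * (int ((m - k) choose i) * s ^ i * x ^ (m - k - i)))"
  have "euler_poly m (x + s) = (\<Sum>k\<le>m. \<Sum>i\<le>m - k. g i k)"
    unfolding euler_poly_def g_def
    by (simp add: add.commute[of x s] binomial_ring sum_distrib_left)
  also have "\<dots> = (\<Sum>(k, i)\<in>(SIGMA k:{..m}. {..m - k}). g i k)"
    by (simp add: sum.Sigma)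
  also have "\<dots> = (\<Sum>(t, i)\<in>(SIGMA t:{..m}. {..t}). g i (t - i))"
    by (rule sum.reindex_bij_witness[of _ "\<lambda>(t, i). (t - i, i)" "\<lambda>(k, i). (k + i, i)"]) auto
  also have "\<dots> = (\<Sum>t\<le>m. \<Sum>i\<le>t. g i (t - i))"
    by (simp add: sum.Sigma)
  also have "\<dots> = (\<Sum>t\<le>m. int (m choose t) * x ^ (m - t) * (\<Sum>i\<le>t. int (t choose i) * s ^ i * euler_number (t - i)))"
    unfolding sum_distrib_left
  proof (intro sum.cong refl)
    fix t i assume "t \<in> {..m}" "i \<in> {..t}"
    hence ti: "t \<le> m" "i \<le> t" by auto
    have "(m choose (t - i)) * ((m - (t - i)) choose i) = (m choose t) * (t choose i)"
      using choose_mult[of "t - i" t m] ti binomial_symmetric[of i t] by simp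
    hence "int (m choose (t - i)) * int ((m - (t - i)) choose i) = int (m choose t) * int (t choose i)"
      by (metis of_nat_mult)
    moreover have "m - (t - i) - i = m - t" using ti by simp
    ultimately show "g i (t - i) = int (m choose t) * x ^ (m - t) * (int (t choose i) * s ^ i * euler_number (t - i))"
      unfolding g_def by (simp add: ac_simps)
  qed
  finally show ?thesis .
qed

text \<open>Adding the expansions for s = 1 and s = -1 cancels the odd i and doubles the even ones,
  so the defining recurrence of the Euler numbers removes every t > 0.\<close>

lemma euler_poly_rec: "euler_poly m (x + 1) + euler_poly m (x - 1) = 2 * x ^ m"
proof -
  have z: "(\<Sum>i\<le>t. int (t choose i) * 1 ^ i * euler_number (t - i)) + (\<Sum>i\<le>t. int (t choose i) * (- 1) ^ i * euler_number (t - i))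
     = (if t = 0 then 2 else 0)" for t
  proof (cases "t = 0")
    case False
    have "(\<Sum>i\<le>t. int (t choose i) * 1 ^ i * euler_number (t - i)) + (\<Sum>i\<le>t. int (t choose i) * (- 1) ^ i * euler_number (t - i))
      = (\<Sum>i\<in>{0..t}. if even i then 2 * (int (t choose i) * euler_number (t - i)) else 0)"
      unfolding sum.distrib[symmetric] atMost_atLeast0 by (rule sum.cong) auto
    also have "\<dots> = 2 * (\<Sum>i\<in>{i\<in>{0..t}. even i}. int (t choose i) * euler_number (t - i))"
      by (simp add: sum.If_cases sum_distrib_left Int_def)
    finally show ?thesis using euler_number_recurrence[of t] False by simp
  qed (simp add: euler_number_0)
  have "euler_poly m (x + 1) + euler_poly m (x + (- 1)) = (\<Sum>t\<le>m. int (m choose t) * x ^ (m - t) * (if t = 0 then 2 else 0))"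
    unfolding euler_poly_shift sum.distrib[symmetric] distrib_left[symmetric] z[unfolded sum.distrib[symmetric]] ..
  also have "\<dots> = (\<Sum>t\<le>m. if t = 0 then 2 * x ^ m else 0)"
    by (rule sum.cong) auto
  also have "\<dots> = 2 * x ^ m" by simp
  finally show ?thesis by simp
qed

text \<open>Telescoping with \<open>euler_poly_rec\<close> at the odd points 2j + 1. The lower end
  contributes the Euler number because the polynomial at 0 reduces to its constant term.\<close>

lemma alternating_power_sum:
  "2 * (\<Sum>j<n. (- 1) ^ j * (2 * int j + 1) ^ m) = euler_number m - (- 1) ^ n * euler_poly m (2 * int n)"
proof (induction n)
  case 0
  have "euler_poly m 0 = (\<Sum>k\<le>m. if k = m then euler_number m else 0)"
    unfolding euler_poly_def by (rule sum.cong) auto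
  thus ?case by simp
next
  case (Suc n)
  have "euler_poly m (2 * int (Suc n)) + euler_poly m (2 * int n) = 2 * (2 * int n + 1) ^ m"
    using euler_poly_rec[of m "2 * int n + 1"] by (simp add: algebra_simps)
  hence "(- 1) ^ n * (euler_poly m (2 * int (Suc n)) + euler_poly m (2 * int n)) = (- 1) ^ n * (2 * (2 * int n + 1) ^ m)"
    by simp
  thus ?case using Suc by (simp add: algebra_simps)
qed

lemma euler_poly_cong: "[euler_poly m (2 * int n) = euler_number m] (mod int n)"
proof -
  have "euler_poly m (2 * int n) = euler_number m + (\<Sum>k<m. int (m choose k) * euler_number k * (2 * int n) ^ (m - k))"
    unfolding euler_poly_def by (simp flip: lessThan_Suc_atMost)
  moreover have "int n dvd (\<Sum>k<m. int (m choose k) * euler_number k * (2 * int n) ^ (m - k))"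
    by (intro dvd_sum dvd_mult) (auto simp: dvd_power dvd_trans[OF dvd_triv_right dvd_power])
  ultimately show ?thesis by (simp add: cong_iff_dvd_diff)
qed

context prime_gt3
begin

text \<open>In the alternating sum of (2j + 1)^(p-3) over j < p the index is centred at N: for j = N
  - i and j = N + i the base is p - 2i and p + 2i. As p - 3 is even, both powers are (2i)^(p-3)
  modulo p, which is (2i)^(-2) by Fermat; the centre itself is a positive power of p up to
  sign.\<close>

lemma euler_number_cong: "pcong 1 (of_int (euler_number (p - 3))) ((- 1) ^ N / 2 * alt_harm2 N)"
proof -
  define f :: "nat \<Rightarrow> int" where "f j = (- 1) ^ j * (2 * int j + 1) ^ (p - 3)" for j
  have odd: "odd p" using p_eq by presburger
  have "[2 * (\<Sum>j<p. f j) = euler_number (p - 3) + euler_number (p - 3)] (mod int p)"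
  proof -
    have "2 * (\<Sum>j<p. f j) = euler_number (p - 3) + euler_poly (p - 3) (2 * int p)"
      unfolding f_def alternating_power_sum using odd by simp
    thus ?thesis by (simp only:) (intro cong_add cong_refl euler_poly_cong)
  qed
  hence "[2 * (\<Sum>j<p. f j) = 2 * euler_number (p - 3)] (mod int p)" by simp
  moreover have "coprime 2 (int p)" using odd by simp
  ultimately have "[(\<Sum>j<p. f j) = euler_number (p - 3)] (mod int p)"
    using cong_mult_lcancel by blast
  hence "pcong 1 (of_int (\<Sum>j<p. f j)) (of_int (euler_number (p - 3)))"
    by (intro pcong_of_int) simp
  hence "pcong 1 (of_int (euler_number (p - 3))) (of_int (\<Sum>j<p. f j))" by (rule pcong_sym)
  also have "(\<Sum>j<p. f j) = f N + (\<Sum>i = 1..N. f (N - i) + f (N + i))"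
  proof -
    have "(\<Sum>j<2 * n + 1. f j) = f n + (\<Sum>i = 1..n. f (n - i) + f (n + i))" for n
    proof -
      have set: "{..<2 * n + 1} = {..<n} \<union> insert n {n+1..n+n}" by auto
      have "(\<Sum>j<2 * n + 1. f j) = sum f {..<n} + sum f (insert n {n+1..n+n})"
        unfolding set by (rule sum.union_disjoint) auto
      moreover have "sum f {..<n} = (\<Sum>i = 1..n. f (n - i))"
        by (rule sum.reindex_bij_witness[of _ "\<lambda>j. n - j" "\<lambda>j. n - j"]) auto
      moreover have "sum f {n+1..n+n} = (\<Sum>i = 1..n. f (n + i))"
        by (rule sum.reindex_bij_witness[of _ "\<lambda>j. n + j" "\<lambda>j. j - n"]) auto
      ultimately show ?thesis by (simp add: sum.distrib)
    qed
    from this[of N] show ?thesis using p_eq by metis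
  qed
  also have "pcong 1 (of_int (f N + (\<Sum>i = 1..N. f (N - i) + f (N + i)))) ((- 1) ^ N / 2 * alt_harm2 N)"
  proof -
    have fN: "pcong 1 (of_int (f N)) (of_int 0)"
    proof (rule pcong_of_int)
      have "f N = (- 1) ^ N * int p ^ (p - 3)" unfolding f_def using p_eq by (metis int_ops(2) of_nat_add of_nat_mult of_nat_numeral)
      moreover have "p - 3 > 0" using p_gt3 by simp
      ultimately show "[f N = 0] (mod int p ^ 1)" by (simp add: cong_0_iff)
    qed
    have trm: "pcong 1 (of_int (f (N - i) + f (N + i))) ((- 1) ^ N / 2 * ((- 1) ^ i / of_nat i ^ 2))" if "i \<in> {1..N}" for i
    proof -
      have i: "1 \<le> i" "i \<le> N" "2 * i < p" using that p_eq by auto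
      have pN: "2 * int N + 1 = int p" using p_eq by linarith
      have "[int p - 2 * int i = - (2 * int i)] (mod int p)" "[int p + 2 * int i = 2 * int i] (mod int p)"
        by (simp_all add: cong_iff_dvd_diff)
      hence "[(int p - 2 * int i) ^ (p - 3) = (- (2 * int i)) ^ (p - 3)] (mod int p)"
        "[(int p + 2 * int i) ^ (p - 3) = (2 * int i) ^ (p - 3)] (mod int p)"
        by (simp_all only: cong_pow)
      moreover have "even (p - 3)" using odd p_gt3 by simp
      ultimately have c1: "[(int p - 2 * int i) ^ (p - 3) = (2 * int i) ^ (p - 3)] (mod int p)"
        and c2: "[(int p + 2 * int i) ^ (p - 3) = (2 * int i) ^ (p - 3)] (mod int p)" by simp_all
      have s: "(- 1) ^ (N - i) = ((- 1) ^ N * (- 1) ^ i :: int)" "(- 1) ^ (N + i) = ((- 1) ^ N * (- 1) ^ i :: int)"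
        using i by (auto simp: power_add minus_one_power_iff)
      have "f (N - i) + f (N + i) = (- 1) ^ N * (- 1) ^ i * ((int p - 2 * int i) ^ (p - 3) + (int p + 2 * int i) ^ (p - 3))"
      proof -
        have "2 * int (N - i) + 1 = int p - 2 * int i" "2 * int (N + i) + 1 = int p + 2 * int i"
          using i pN by (auto simp: of_nat_diff)
        thus ?thesis unfolding f_def s by (simp only: distrib_left)
      qed
      also have "[\<dots> = (- 1) ^ N * (- 1) ^ i * ((2 * int i) ^ (p - 3) + (2 * int i) ^ (p - 3))] (mod int p)"
        by (intro cong_mult cong_add cong_refl c1 c2)
      finally have "pcong 1 (of_int (f (N - i) + f (N + i))) (of_int ((- 1) ^ N * (- 1) ^ i * ((2 * int i) ^ (p - 3) + (2 * int i) ^ (p - 3))))"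
        by (intro pcong_of_int) simp
      also have "\<dots> = (- 1) ^ N * (- 1) ^ i * 2 * (1 / of_nat (2 * i) ^ 2) * of_nat ((2 * i) ^ (p - 1))"
      proof -
        have "p - 1 = (p - 3) + 2" using p_gt3 by simp
        hence "of_nat ((2 * i) ^ (p - 1)) = (of_nat (2 * i) ^ (p - 3) * of_nat (2 * i) ^ 2 :: rat)"
          by (simp only: of_nat_power power_add of_nat_mult)
        moreover have "of_nat (2 * i) \<noteq> (0::rat)" using i by simp
        ultimately show ?thesis by simp
      qed
      also have "pcong 1 \<dots> ((- 1) ^ N * (- 1) ^ i * 2 * (1 / of_nat (2 * i) ^ 2) * 1)"
      proof (intro pcong_cmult Zp_mult Zp_power Zp_minus Zp_num Zp_inv_sq)
        have "[(2 * i) ^ (p - 1) = 1] (mod p)"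
          by (rule fermat_theorem[OF prime_p not_dvd_less]) (use i in auto)
        hence "[int ((2 * i) ^ (p - 1)) = int 1] (mod int p)" by (simp only: cong_int_iff)
        hence "pcong 1 (of_int (int ((2 * i) ^ (p - 1)))) (of_int (int 1))" by (intro pcong_of_int) simp
        thus "pcong 1 (of_nat ((2 * i) ^ (p - 1))) 1" by (simp only: of_int_of_nat_eq of_nat_1 of_int_1)
      qed (use i in auto)
      finally show ?thesis by (simp add: power_mult_distrib mult.commute)
    qed
    have "pcong 1 (of_int (f N) + (\<Sum>i = 1..N. of_int (f (N - i) + f (N + i))))
       (of_int 0 + (\<Sum>i = 1..N. (- 1) ^ N / 2 * ((- 1) ^ i / of_nat i ^ 2)))"
      by (intro pcong_add pcong_sum fN trm)
    thus ?thesis by (simp only: of_int_add of_int_sum of_int_0 add_0_left alt_harm2_def sum_distrib_left)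
  qed
  finally show ?thesis .
qed

end

section \<open>The second sum\<close>

text \<open>
  \<open>leg n k\<close> is the coefficient of z^k in the Legendre polynomial P_n(1-2z), and \<open>leg_at\<close> extends it
  to arbitrary arguments X = 2n+1; \<open>leg_wz\<close> is its Wilf-Zeilberger companion.
\<close>

definition leg :: "nat \<Rightarrow> nat \<Rightarrow> rat" where
  "leg n k = (- 1) ^ k * of_nat (n choose k) * of_nat ((n + k) choose k)"

definition leg_at :: "rat \<Rightarrow> nat \<Rightarrow> rat" where
  "leg_at X k = (\<Prod>j = 1..k. ((2 * of_nat j - 1) ^ 2 - X ^ 2) / (4 * of_nat j ^ 2))"

definition leg_wz :: "nat \<Rightarrow> nat \<Rightarrow> rat" where
  "leg_wz n k = 2 * (- 1) ^ k * of_nat (n choose k) * of_nat ((n + 1 + k) choose k)"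

lemma leg_Suc: "leg n (Suc k) = leg n k * ((of_nat k - of_nat n) * (of_nat n + of_nat k + 1) / of_nat (Suc k) ^ 2)"
proof -
  have "(n + Suc k) choose Suc k = Suc (n + k) choose Suc k" by simp
  thus ?thesis unfolding leg_def by (simp only: choose_Suc_down[of n] choose_Suc_Suc)
     (simp add: divide_simps power2_eq_square, simp add: algebra_simps)
qed

lemma leg_at_leg: "leg_at (of_nat (2 * n + 1)) k = leg n k"
proof (induction k)
  case (Suc k)
  have e: "((2 * of_nat (Suc k) - 1) ^ 2 - of_nat (2 * n + 1) ^ 2) / (4 * of_nat (Suc k) ^ 2) =
    ((of_nat k - of_nat n) * (of_nat n + of_nat k + 1) / of_nat (Suc k) ^ 2 :: rat)"
    by (simp add: divide_simps) (simp add: algebra_simps power2_eq_square)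
  have "leg_at (of_nat (2 * n + 1)) (Suc k) = leg_at (of_nat (2 * n + 1)) k *
      (((2 * of_nat (Suc k) - 1) ^ 2 - of_nat (2 * n + 1) ^ 2) / (4 * of_nat (Suc k) ^ 2))"
    unfolding leg_at_def by (subst prod.nat_ivl_Suc') auto
  thus ?case unfolding e leg_Suc Suc .
qed (simp add: leg_at_def leg_def)

lemma leg_wz_Suc: "leg_wz n (Suc k) = - leg_wz n k * ((of_nat n + 1) ^ 2 - (of_nat k + 1) ^ 2) / (of_nat k + 1) ^ 2"
proof -
  have "(n + 1 + Suc k) choose Suc k = Suc (n + 1 + k) choose Suc k" by simp
  thus ?thesis unfolding leg_wz_def by (simp only: choose_Suc_down[of n] choose_Suc_Suc)
     (simp add: divide_simps power2_eq_square, simp add: algebra_simps)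
qed

text \<open>The sum of \<open>leg n k\<close> over all k is P_n(-1). This is the relation
  P_(n+1)(-1) = -P_n(-1) at the level of summands: a sum in n is a difference in k.\<close>

lemma leg_leg_wz: "leg (Suc n) (Suc k) + leg n (Suc k) = leg_wz n (Suc k) - leg_wz n k"
proof -
  have c: "of_nat ((n + Suc k) choose Suc k) = (of_nat ((n + 1 + k) choose k) * (of_nat n + 1) / of_nat (Suc k) :: rat)"
    using choose_Suc_down[of "n + 1 + k" k] by simp
  have "(Suc n + Suc k) choose Suc k = Suc (n + 1 + k) choose Suc k" by simp
  thus ?thesis unfolding leg_wz_Suc unfolding leg_def leg_wz_def
    by (simp only: c choose_Suc_down[of n] choose_Suc_Suc)
     (simp add: divide_simps power2_eq_square, simp add: algebra_simps)
qed

lemma sum_leg_wz: "(\<Sum>k<Suc P. leg (Suc n) k) + (\<Sum>k<Suc P. leg n k) = leg_wz n P"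
proof (induction P)
  case (Suc P)
  thus ?case using leg_leg_wz[of n P] by simp
qed (simp add: leg_def leg_wz_def)


text \<open>Summation by parts leaves the sum of \<open>leg_wz n k\<close> / (k+1)^2. By
  \<open>leg_wz_Suc\<close> this summand equals (\<open>leg_wz n k\<close> -
  \<open>leg_wz n (Suc k)\<close>) / (n+1)^2, so it telescopes as well; the 2 is
  \<open>leg_wz n 0\<close>.\<close>

lemma sum_leg_harm2:
  "(\<Sum>k<Suc P. (leg (Suc n) k + leg n k) * (\<Sum>j = 1..k. 1 / of_nat j ^ 2)) =
     leg_wz n P * ((\<Sum>j = 1..P. 1 / of_nat j ^ 2) + 1 / (of_nat n + 1) ^ 2) - 2 / (of_nat n + 1) ^ 2"
proof (induction P)
  case (Suc P)
  define H :: rat where "H = (\<Sum>j = 1..P. 1 / of_nat j ^ 2)"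
  define m q :: rat where "m = (of_nat n + 1) ^ 2" and "q = (of_nat P + 1) ^ 2"
  have nz: "m \<noteq> 0" "q \<noteq> 0" unfolding m_def q_def by (auto simp flip: of_nat_Suc simp del: of_nat_Suc simp add: add.commute)
  have H: "(\<Sum>j = 1..Suc P. 1 / of_nat j ^ 2) = H + 1 / q" unfolding H_def q_def by (simp add: add.commute)
  have w: "leg_wz n (Suc P) = - leg_wz n P * (m - q) / q" unfolding m_def q_def by (rule leg_wz_Suc)
  have "(\<Sum>k<Suc (Suc P). (leg (Suc n) k + leg n k) * (\<Sum>j = 1..k. 1 / of_nat j ^ 2)) =
     (leg_wz n P * (H + 1 / m) - 2 / m) + (leg_wz n (Suc P) - leg_wz n P) * (H + 1 / q)"
    using Suc.IH leg_leg_wz[of n P] unfolding H[symmetric] H_def[symmetric] m_def by simp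
  also have "\<dots> = leg_wz n (Suc P) * ((H + 1 / q) + 1 / m) - 2 / m"
    unfolding w using nz by (simp add: field_simps)
  finally show ?case unfolding H m_def .
qed (simp add: leg_def leg_wz_def)

context prime_gt3
begin

section \<open>Legendre sums cut at k < p\<close>

lemma p_Suc: "p = Suc (2 * N)" using p_eq by simp

lemma sum_leg_rec: "(\<Sum>k<p. leg (Suc n) k) = leg_wz n (2 * N) - (\<Sum>k<p. leg n k)"
  using sum_leg_wz[where P = "2 * N" and n = n] by (simp only: p_Suc[symmetric] eq_diff_eq)

lemma leg_wz_zero: "n < 2 * N \<Longrightarrow> leg_wz n (2 * N) = 0"
  by (simp add: leg_wz_def)

text \<open>For n < p the range contains every nonzero coefficient, so this is P_n(-1).\<close>

lemma sum_leg_small: "n < p \<Longrightarrow> (\<Sum>k<p. leg n k) = (- 1) ^ n"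
proof (induction n)
  case 0
  have "(\<Sum>k<p. leg 0 k) = (\<Sum>k<p. if k = 0 then 1 else 0)"
    by (rule sum.cong) (auto simp: leg_def)
  thus ?case using p_gt3 by simp
next
  case (Suc n)
  hence "n < 2 * N" using p_eq by simp
  thus ?case using Suc by (simp add: sum_leg_rec leg_wz_zero)
qed

lemma sum_leg_harm2_small: "n < p \<Longrightarrow> (\<Sum>k<p. leg n k * harm2 k) = - 2 * (- 1) ^ n * alt_harm2 n"
proof (induction n)
  case 0
  have "(\<Sum>k<p. leg 0 k * harm2 k) = 0"
    by (rule sum.neutral) (auto simp: leg_def harm2_def intro!: sum.neutral)
  thus ?case by (simp add: alt_harm2_def)
next
  case (Suc n)
  hence "n < 2 * N" using p_eq by simp
  hence "(\<Sum>k<p. (leg (Suc n) k + leg n k) * harm2 k) = - 2 / (of_nat n + 1) ^ 2"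
    using sum_leg_harm2[where P = "2 * N" and n = n] leg_wz_zero[of n]
    unfolding harm2_def by (simp only: p_Suc[symmetric])
  hence "(\<Sum>k<p. leg (Suc n) k * harm2 k) = - 2 / (of_nat n + 1) ^ 2 - (\<Sum>k<p. leg n k * harm2 k)"
    by (simp add: distrib_right sum.distrib eq_diff_eq)
  also have "\<dots> = - 2 * (- 1) ^ Suc n * (alt_harm2 n + (- 1) ^ Suc n / of_nat (Suc n) ^ 2)"
    using Suc by (cases "even n") (simp_all add: algebra_simps)
  finally show ?case by (simp add: alt_harm2_def)
qed

lemma pcong_ratio:
  assumes "0 < a" "a < p" "pcong 1 x (of_nat a)" "pcong 1 y (of_nat a)" "x \<noteq> 0" "Zp (inverse x)"
  shows "pcong 1 (y / x) 1"
proof -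
  have "pcong 1 (inverse x * y) (inverse x * x)"
    by (rule pcong_cmult[OF assms(6) pcong_trans[OF assms(4) pcong_sym[OF assms(3)]]])
  thus ?thesis using assms(5) by (simp add: field_simps)
qed

lemma pcong_p_plus: "Zp x \<Longrightarrow> Zp c \<Longrightarrow> pcong 1 (of_nat p * c + x) x"
  using pcong_p_multiple[of c 1 x] by (simp add: add.commute)

lemma Zp_inverse_p_plus: "0 < a \<Longrightarrow> a < p \<Longrightarrow> Zp (inverse (of_nat (c * p + a)))"
  by (intro Zp_inverse_nat) (simp add: dvd_add_right_iff not_dvd_less)

text \<open>Raising i by one multiplies the binomial coefficient by ((c+1)p + i + 1)/(cp + i + 1), a
  quotient of two p-adic units that agree modulo p.\<close>

lemma choose_p_cong: "i < p \<Longrightarrow> pcong 1 (of_nat ((c * p + p + i) choose p)) (of_nat ((c * p + p) choose p))"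
proof (induction i)
  case (Suc i)
  let ?n = "c * p + p + i"
  have aux: "x * y = z * w \<Longrightarrow> x \<noteq> 0 \<Longrightarrow> y = z / x * w" for x y z w :: rat by (simp add: field_simps)
  have "(?n + 1 - p) * ((?n + 1) choose p) = (?n + 1) * (?n choose p)"
    using binomial_absorb_comp[of "?n + 1" p] by simp
  hence "of_nat (?n + 1 - p) * of_nat ((?n + 1) choose p) = (of_nat (?n + 1) * of_nat (?n choose p) :: rat)"
    by (metis of_nat_mult)
  moreover have "?n + 1 - p = c * p + Suc i" by simp
  moreover have "of_nat (c * p + Suc i) \<noteq> (0::rat)" by (simp del: of_nat_add of_nat_Suc)
  ultimately have eq: "of_nat ((?n + 1) choose p) = (of_nat (?n + 1) / of_nat (c * p + Suc i) * of_nat (?n choose p) :: rat)"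
    by (intro aux) simp_all
  have "pcong 1 (of_nat (?n + 1) / of_nat (c * p + Suc i)) 1"
  proof (rule pcong_ratio[of "Suc i"])
    show "pcong 1 (of_nat (c * p + Suc i)) (of_nat (Suc i))" "pcong 1 (of_nat (?n + 1)) (of_nat (Suc i))"
      using pcong_p_plus[of "of_nat (Suc i)" "of_nat c"] pcong_p_plus[of "of_nat (Suc i)" "of_nat (c + 1)"]
      by (simp_all add: algebra_simps)
  qed (use Suc.prems Zp_inverse_p_plus[of "Suc i" c] in \<open>auto simp del: of_nat_add of_nat_Suc\<close>)
  hence "pcong 1 (of_nat (?n + 1) / of_nat (c * p + Suc i) * of_nat (?n choose p)) (1 * of_nat (?n choose p))"
    by (intro pcong_multc) auto
  hence "pcong 1 (of_nat ((?n + 1) choose p)) (of_nat (?n choose p))"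
    unfolding eq by simp
  from pcong_trans[OF this] Suc show ?case by simp
qed simp

text \<open>For n = p + i the boundary term no longer vanishes, but raising the lower index from p -
  1 to p extracts a factor p from each of its two binomial coefficients. The cofactors are then
  needed only modulo p, where C(p+i,p) is 1 and C(2p+i,p) is 2.\<close>

lemma leg_wz_cong:
  assumes "i < N"
  shows "pcong 3 (leg_wz (p + i) (2 * N)) (of_nat p ^ 2 * (4 / of_nat (Suc i) ^ 2))"
proof -
  have ip: "Suc i < p" using assms p_eq by simp
  define u :: rat where "u = of_nat ((p + i) choose p)"
  define v :: rat where "v = of_nat ((2 * p + i) choose p)"
  have Iu: "Zp u" "Zp v" by (simp_all add: u_def v_def)
  have u: "pcong 1 u 1" using choose_p_cong[of i 0] ip by (simp add: u_def)
  have v: "pcong 1 v 2"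
  proof -
    have "(2 * p) choose p = 2 * ((2 * p - 1) choose (p - 1))"
      using p_gt3 binomial_symmetric[of p "2 * p - 1"] choose_reduce_nat[of "2 * p" p] by (simp add: mult_2)
    hence "of_nat ((2 * p) choose p) = (2 * of_nat ((2 * p - 1) choose (p - 1)) :: rat)" by simp
    also have "pcong 1 \<dots> (2 * 1)" by (intro pcong_cmult pcong_mono[OF wolstenholme]) auto
    finally have "pcong 1 (of_nat ((2 * p) choose p)) 2" by simp
    moreover have "pcong 1 v (of_nat ((2 * p) choose p))"
      using choose_p_cong[of i 1] ip by (simp add: v_def mult_2)
    ultimately show ?thesis using pcong_trans by blast
  qed
  have e1: "of_nat ((p + i) choose (2 * N)) = of_nat p * u / of_nat (Suc i)"
    using choose_Suc_down[of "p + i" "2 * N"] p_Suc by (simp add: u_def field_simps of_nat_p)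
  have e2: "of_nat ((p + i + 1 + 2 * N) choose (2 * N)) = of_nat p * v / of_nat (p + Suc i)"
  proof -
    have eq: "p + i + 1 + 2 * N = 2 * p + i" using p_eq by simp
    show ?thesis unfolding eq
      using choose_Suc_down[of "2 * p + i" "2 * N"] p_Suc by (simp add: v_def field_simps of_nat_p)
  qed
  have "leg_wz (p + i) (2 * N) = of_nat p ^ 2 * (2 * u * v * inverse (of_nat (Suc i)) * inverse (of_nat (p + Suc i)))"
    unfolding leg_wz_def e1 e2 by (simp add: field_simps power2_eq_square)
  also have "pcong (1 + 2) \<dots> (of_nat p ^ 2 * (2 * 1 * 2 * inverse (of_nat (Suc i)) * inverse (of_nat (Suc i))))"
  proof (intro pcong_scale pcong_mult)
    show "pcong 1 (inverse (of_nat (p + Suc i))) (inverse (of_nat (Suc i)))"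
      using pcong_p_plus[of "of_nat (Suc i)" 1] Zp_inverse_p_plus[of "Suc i" 1] Zp_inverse_p_plus[of "Suc i" 0] ip
      by (intro pcong_inverse) (auto simp: ac_simps)
  qed (use u v Iu Zp_inverse_p_plus[of "Suc i" 0] ip in auto)
  finally show ?thesis by (simp add: numeral_3_eq_3 field_simps power2_eq_square)
qed

text \<open>From n = p - 1, where the sum is exactly 1, the step to n = p has the boundary term 2
  C(2p-1,p-1), which Wolstenholme's congruence evaluates modulo p^3. Each later step contributes 4
  p^2/(i+1)^2, and the sign alternates.\<close>

lemma sum_leg_large: "i \<le> N \<Longrightarrow> pcong 3 (\<Sum>k<p. leg (p + i) k) ((- 1) ^ i * (1 + 4 * of_nat p ^ 2 * alt_harm2 i))"
proof (induction i)
  case 0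
  have p1: "Suc (p - 1) = p" using p_gt3 by simp
  have "(\<Sum>k<p. leg p k) = leg_wz (p - 1) (2 * N) - (\<Sum>k<p. leg (p - 1) k)"
    using sum_leg_rec[of "p - 1"] by (simp only: p1)
  also have "(\<Sum>k<p. leg (p - 1) k) = 1"
    using sum_leg_small[of "p - 1"] p_gt3 p_minus_1 by simp
  also have "leg_wz (p - 1) (2 * N) = 2 * of_nat ((2 * p - 1) choose (p - 1))"
  proof -
    have eq: "p - 1 + 1 + 2 * N = 2 * p - 1" using p_eq by auto
    show ?thesis unfolding leg_wz_def eq unfolding p_minus_1 by simp
  qed
  also have "pcong 3 (2 * of_nat ((2 * p - 1) choose (p - 1)) - 1) (2 * 1 - 1)"
    by (intro pcong_diff pcong_cmult wolstenholme) auto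
  finally show ?case by (simp add: alt_harm2_def)
next
  case (Suc i)
  have "(\<Sum>k<p. leg (p + Suc i) k) = leg_wz (p + i) (2 * N) - (\<Sum>k<p. leg (p + i) k)"
    using sum_leg_rec[of "p + i"] by simp
  also have "pcong 3 \<dots> (of_nat p ^ 2 * (4 / of_nat (Suc i) ^ 2) - (- 1) ^ i * (1 + 4 * of_nat p ^ 2 * alt_harm2 i))"
    using Suc by (intro pcong_diff leg_wz_cong) auto
  also have "\<dots> = (- 1) ^ Suc i * (1 + 4 * of_nat p ^ 2 * (alt_harm2 i + (- 1) ^ Suc i / of_nat (Suc i) ^ 2))"
    by (cases "even i") (simp_all add: algebra_simps)
  also have "alt_harm2 i + (- 1) ^ Suc i / of_nat (Suc i) ^ 2 = alt_harm2 (Suc i)"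
    by (simp add: alt_harm2_def)
  finally show ?case .
qed

text \<open>Each factor is q - X^2 c with p-integral q and c, so at X = rp everything beyond the
  first power of X^2 is 0 modulo p^4. The point is that \<open>u\<close> and \<open>d\<close> do not
  depend on r.\<close>

lemma leg_at_linear:
  "k < p \<Longrightarrow> \<exists>u d. Zp u \<and> Zp d \<and> (\<forall>r. Zp r \<longrightarrow> pcong 4 (leg_at (r * of_nat p) k) (u - r ^ 2 * of_nat p ^ 2 * d))"
proof (induction k)
  case 0
  show ?case by (rule exI[of _ 1], rule exI[of _ 0]) (simp add: leg_at_def)
next
  case (Suc k)
  obtain u d where ud: "Zp u" "Zp d" "\<And>r. Zp r \<Longrightarrow> pcong 4 (leg_at (r * of_nat p) k) (u - r ^ 2 * of_nat p ^ 2 * d)"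
    using Suc by (meson Suc_lessD)
  define c :: rat where "c = 1 / of_nat (Suc k) ^ 2 / 4"
  define q :: rat where "q = (2 * of_nat (Suc k) - 1) ^ 2 * c"
  have Ic: "Zp c" unfolding c_def by (intro Zp_div_2 Zp_inv_sq) (use Suc.prems in auto)
  hence Iq: "Zp q" unfolding q_def by (intro Zp_mult Zp_power Zp_diff) auto
  show ?case
  proof (intro exI conjI allI impI)
    show "Zp (u * q)" "Zp (d * q + u * c)" using ud Ic Iq by auto
    fix r assume r: "Zp r"
    have "leg_at (r * of_nat p) (Suc k) = leg_at (r * of_nat p) k * (q - r ^ 2 * of_nat p ^ 2 * c)"
      unfolding leg_at_def by (subst prod.nat_ivl_Suc') (auto simp: q_def c_def diff_divide_distrib power_mult_distrib)
    also have "pcong 4 \<dots> ((u - r ^ 2 * of_nat p ^ 2 * d) * (q - r ^ 2 * of_nat p ^ 2 * c))"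
      using ud Ic Iq r by (intro pcong_multc) auto
    also have "\<dots> = (u * q - r ^ 2 * of_nat p ^ 2 * (d * q + u * c)) + of_nat p ^ 4 * (r ^ 4 * d * c)"
      by (simp add: algebra_simps power2_eq_square power4_eq_xxxx)
    also have "pcong 4 \<dots> (u * q - r ^ 2 * of_nat p ^ 2 * (d * q + u * c))"
      using ud Ic r by (intro pcong_p_multiple) auto
    finally show "pcong 4 (leg_at (r * of_nat p) (Suc k)) (u * q - r ^ 2 * of_nat p ^ 2 * (d * q + u * c))" .
  qed
qed

text \<open>Extrapolation to X = 0 of a function that is linear in X^2 from its values at X = p and X = 3p.\<close>

lemma leg_at_three_points: "k < p \<Longrightarrow> pcong 4 (8 * leg_at 0 k) (9 * leg N k - leg (p + N) k)"
proof -
  assume "k < p"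
  then obtain u d where ud: "Zp u" "Zp d" "\<And>r. Zp r \<Longrightarrow> pcong 4 (leg_at (r * of_nat p) k) (u - r ^ 2 * of_nat p ^ 2 * d)"
    using leg_at_linear by meson
  have "2 * N + 1 = p" "2 * (p + N) + 1 = 3 * p" using p_eq by auto
  hence l: "leg_at (1 * of_nat p) k = leg N k" "leg_at (3 * of_nat p) k = leg (p + N) k"
    using leg_at_leg[of N k] leg_at_leg[of "p + N" k] by (simp_all only: of_nat_mult of_nat_numeral mult_1)
  \<comment> \<open>A function f that is linear in r^2 satisfies 9 f(1) - f(3) = 8 f(0).\<close>
  have "pcong 4 (9 * leg N k - leg (p + N) k) (9 * (u - 1 ^ 2 * of_nat p ^ 2 * d) - (u - 3 ^ 2 * of_nat p ^ 2 * d))"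
    unfolding l[symmetric] by (intro pcong_diff pcong_cmult ud(3)) auto
  also have "\<dots> = 8 * (u - 0 ^ 2 * of_nat p ^ 2 * d)" by simp
  also have "pcong 4 \<dots> (8 * leg_at (0 * of_nat p) k)"
    by (intro pcong_cmult pcong_sym[OF ud(3)]) auto
  finally show ?thesis by (simp add: pcong_sym)
qed

lemma leg_at_leg_cong: "k < p \<Longrightarrow> pcong 2 (leg_at 0 k) (leg N k)"
proof -
  assume "k < p"
  then obtain u d where ud: "Zp u" "Zp d" "\<And>r. Zp r \<Longrightarrow> pcong 4 (leg_at (r * of_nat p) k) (u - r ^ 2 * of_nat p ^ 2 * d)"
    using leg_at_linear by meson
  have l: "leg_at (1 * of_nat p) k = leg N k"
    using leg_at_leg[of N k] p_eq by (simp only: mult_1 flip: p_eq)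
  have "pcong 2 (leg_at (0 * of_nat p) k) (u - 0 ^ 2 * of_nat p ^ 2 * d)"
    by (rule pcong_mono[OF ud(3)]) auto
  also have "\<dots> = (u - 1 ^ 2 * of_nat p ^ 2 * d) + of_nat p ^ 2 * d" by simp
  also have "pcong 2 \<dots> (u - 1 ^ 2 * of_nat p ^ 2 * d)" using ud by (intro pcong_p_multiple)
  also have "pcong 2 \<dots> (leg_at (1 * of_nat p) k)"
    by (rule pcong_sym, rule pcong_mono[OF ud(3)]) auto
  finally show ?thesis using l by simp
qed

lemma pcong_cancel_8: assumes "pcong a (8 * x) (8 * y)" shows "pcong a x y"
proof -
  have "Zp (1 / 8)" using Zp_div_2(3)[OF Zp_num(2)] .
  from pcong_cmult[OF this assms] show ?thesis by simp
qed

lemma sum_leg_at_0: "pcong 3 (\<Sum>k<p. leg_at 0 k) ((- 1) ^ N * (1 - of_nat p ^ 2 * alt_harm2 N / 2))"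
proof (rule pcong_cancel_8)
  have "pcong 3 (8 * (\<Sum>k<p. leg_at 0 k)) (\<Sum>k<p. 9 * leg N k - leg (p + N) k)"
    unfolding sum_distrib_left by (intro pcong_sum pcong_mono[OF leg_at_three_points]) auto
  also have "\<dots> = 9 * (\<Sum>k<p. leg N k) - (\<Sum>k<p. leg (p + N) k)"
    by (simp add: sum_subtractf sum_distrib_left)
  also have "(\<Sum>k<p. leg N k) = (- 1) ^ N" using p_eq by (intro sum_leg_small) simp
  also have "pcong 3 (9 * (- 1) ^ N - (\<Sum>k<p. leg (p + N) k)) (9 * (- 1) ^ N - (- 1) ^ N * (1 + 4 * of_nat p ^ 2 * alt_harm2 N))"
    by (intro pcong_diff sum_leg_large) auto
  also have "\<dots> = 8 * ((- 1) ^ N * (1 - of_nat p ^ 2 * alt_harm2 N / 2))"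
    by (simp add: algebra_simps)
  finally show "pcong 3 (8 * (\<Sum>k<p. leg_at 0 k)) (8 * ((- 1) ^ N * (1 - of_nat p ^ 2 * alt_harm2 N / 2)))" .
qed

lemma Zp_leg_at_0: "k < p \<Longrightarrow> Zp (leg_at 0 k)"
  using pcong_Zp[OF leg_at_leg_cong] by (auto simp: leg_def)

text \<open>To the precision needed, the weight is 1 - p^2 \<open>harm2 k\<close>. In the p^2 term
  \<open>leg_at 0 k\<close> matters only modulo p and may be replaced by \<open>leg N k\<close>,
  whose sum against \<open>harm2\<close> is known. The coefficient 3/2 is -1/2 from the unweighted
  sum plus 2 from this term.\<close>

lemma sum_leg_at_0_weighted:
  "pcong 3 (\<Sum>k<p. leg_at 0 k * (\<Prod>j = 1..k. 1 - of_nat p ^ 2 / of_nat j ^ 2))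
     ((- 1) ^ N * (1 + 3 / 2 * of_nat p ^ 2 * alt_harm2 N))"
proof -
  have "pcong 3 (leg_at 0 k * (\<Prod>j = 1..k. 1 - of_nat p ^ 2 / of_nat j ^ 2)) (leg_at 0 k - of_nat p ^ 2 * (leg N k * harm2 k))"
    if k: "k < p" for k
  proof -
    have Iq: "Zp (leg_at 0 k)" using k by (rule Zp_leg_at_0)
    have "(\<Prod>j = 1..k. 1 - of_nat p ^ 2 / of_nat j ^ 2) = (\<Prod>j = 1..k. 1 + of_nat p ^ 2 * (- (1 / of_nat j ^ 2) :: rat))"
      by simp
    also have "pcong 4 \<dots> (1 + of_nat p ^ 2 * (\<Sum>j = 1..k. - (1 / of_nat j ^ 2)))"
      using k by (intro pcong_prod_one_plus_p2_linear Zp_minus Zp_inv_sq) auto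
    also have "\<dots> = 1 - of_nat p ^ 2 * harm2 k" by (simp add: harm2_def sum_negf)
    finally have "pcong 3 (leg_at 0 k * (\<Prod>j = 1..k. 1 - of_nat p ^ 2 / of_nat j ^ 2)) (leg_at 0 k * (1 - of_nat p ^ 2 * harm2 k))"
      using Iq by (intro pcong_cmult) (auto intro: pcong_mono)
    also have "\<dots> = leg_at 0 k - of_nat p ^ 2 * (leg_at 0 k * harm2 k)" by (simp add: algebra_simps)
    also have "pcong 3 \<dots> (leg_at 0 k - of_nat p ^ 2 * (leg N k * harm2 k))"
    proof -
      have "pcong (1 + 2) (of_nat p ^ 2 * (leg_at 0 k * harm2 k)) (of_nat p ^ 2 * (leg N k * harm2 k))"
        using k by (intro pcong_scale pcong_multc Zp_harm2 pcong_mono[OF leg_at_leg_cong]) auto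
      thus ?thesis by (intro pcong_diff pcong_refl) (simp add: numeral_3_eq_3)
    qed
    finally show ?thesis .
  qed
  hence "pcong 3 (\<Sum>k<p. leg_at 0 k * (\<Prod>j = 1..k. 1 - of_nat p ^ 2 / of_nat j ^ 2))
      (\<Sum>k<p. leg_at 0 k - of_nat p ^ 2 * (leg N k * harm2 k))"
    by (intro pcong_sum) auto
  also have "\<dots> = (\<Sum>k<p. leg_at 0 k) - of_nat p ^ 2 * (\<Sum>k<p. leg N k * harm2 k)"
    by (simp add: sum_subtractf sum_distrib_left)
  also have "(\<Sum>k<p. leg N k * harm2 k) = - 2 * (- 1) ^ N * alt_harm2 N"
    using p_eq by (intro sum_leg_harm2_small) simp
  also have "pcong 3 ((\<Sum>k<p. leg_at 0 k) - of_nat p ^ 2 * (- 2 * (- 1) ^ N * alt_harm2 N))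
      ((- 1) ^ N * (1 - of_nat p ^ 2 * alt_harm2 N / 2) - of_nat p ^ 2 * (- 2 * (- 1) ^ N * alt_harm2 N))"
    by (intro pcong_diff sum_leg_at_0 pcong_refl)
  also have "\<dots> = (- 1) ^ N * (1 + 3 / 2 * of_nat p ^ 2 * alt_harm2 N)"
    by (simp add: algebra_simps)
  finally show ?thesis .
qed

end

section \<open>Summation over n in the second sum\<close>

lemma leg_at_0: "leg_at 0 k = (of_nat (2 * k choose k) / 4 ^ k) ^ 2"
  unfolding leg_at_def central_binomial_prod[symmetric] prod_power_distrib
  by (rule prod.cong) (simp_all add: power_divide power_mult_distrib)

text \<open>Telescoping: 2P + 1 = (P - k) + (P + k + 1), where \<open>choose_double_rec\<close>
  turns the second part into the value at P + 1.\<close>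

lemma alternating_choose_sum:
  "(\<Sum>n<P. (- 1) ^ n * (2 * of_nat n + 1) * of_nat ((n + k) choose (2 * k)) :: rat) =
     - ((- 1) ^ P) * (of_nat P - of_nat k) * of_nat ((P + k) choose (2 * k))"
proof (induction P)
  case (Suc P)
  have "(of_nat (Suc P) - of_nat k) * of_nat ((Suc P + k) choose (2 * k)) =
        ((of_nat P + of_nat k + 1) * of_nat ((P + k) choose (2 * k)) :: rat)"
    unfolding choose_double_rec by simp
  hence e: "of_nat ((Suc P + k) choose (2 * k)) * (of_nat (Suc P) - of_nat k) =
        ((of_nat P + of_nat k + 1) * of_nat ((P + k) choose (2 * k)) :: rat)" by (simp add: mult.commute)
  have "- ((- 1) ^ Suc P) * (of_nat (Suc P) - of_nat k) * of_nat ((Suc P + k) choose (2 * k)) =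
    (- 1) ^ P * ((of_nat P + of_nat k + 1) * of_nat ((P + k) choose (2 * k)) :: rat)"
    unfolding e[symmetric] by simp
  moreover have "(\<Sum>n<Suc P. (- 1) ^ n * (2 * of_nat n + 1) * of_nat ((n + k) choose (2 * k)) :: rat) =
    (- 1) ^ P * ((of_nat P + of_nat k + 1) * of_nat ((P + k) choose (2 * k)))"
    unfolding sum.lessThan_Suc Suc by (simp add: algebra_simps)
  ultimately show ?case by (simp only:)
qed (cases k; simp add: binomial_eq_0)

text \<open>For k < P the left side is (P+k)!/((P-k-1)! k!^2), and (P+k)!/(P-k-1)! = P prod (P^2 -
  j^2). At k = P both sides are 0.\<close>

lemma choose_prod_squares:
  assumes "k \<le> P"
  shows "(of_nat P - of_nat k) * of_nat ((P + k) choose (2 * k)) * of_nat (2 * k choose k) =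
    (of_nat P * (- 1) ^ k * (\<Prod>j = 1..k. 1 - of_nat P ^ 2 / of_nat j ^ 2) :: rat)"
  using assms
proof (induction k)
  case (Suc k)
  have sgn: "a * s * q * - x = a * (- 1 * s) * (q * x)" for a s q x :: rat by simp
  define c d e :: rat where "c = of_nat (2 * k choose k)" and "d = of_nat (2 * Suc k choose Suc k)"
    and "e = of_nat ((P + k) choose (2 * k))"
  have d: "d = 2 * (2 * of_nat k + 1) * c / (of_nat k + 1)"
    using central_binomial_Suc[of k, where 'a = rat] unfolding c_def d_def
    by (simp add: field_simps del: binomial_Suc_Suc)
  have "of_nat ((P + Suc k) choose (2 * Suc k)) = (of_nat (Suc (P + k) choose Suc (Suc (2 * k))) :: rat)" by simp
  also have "\<dots> = of_nat ((P + k) choose Suc (2 * k)) * of_nat (Suc (P + k)) / of_nat (Suc (Suc (2 * k)))"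
    by (rule choose_Suc_Suc)
  also have "of_nat ((P + k) choose Suc (2 * k)) = e * (of_nat (P + k) - of_nat (2 * k)) / of_nat (Suc (2 * k))"
    unfolding e_def by (rule choose_Suc_down)
  finally have f: "of_nat ((P + Suc k) choose (2 * Suc k)) =
      e * (of_nat P - of_nat k) * (of_nat P + of_nat k + 1) / ((2 * of_nat k + 1) * (2 * of_nat k + 2) :: rat)"
    by (simp add: algebra_simps del: binomial_Suc_Suc)
  have nz: "of_nat k + 1 \<noteq> (0::rat)" "2 * of_nat k + 1 \<noteq> (0::rat)" "2 * of_nat k + 2 \<noteq> (0::rat)"
    using of_nat_neq_0[of k, where 'a = rat] of_nat_neq_0[of "2 * k", where 'a = rat]
      of_nat_neq_0[of "2 * k + 1", where 'a = rat] by (simp_all add: add.commute)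
  define Q where "Q = (\<Prod>j = 1..k. 1 - of_nat P ^ 2 / of_nat j ^ 2 :: rat)"
  have IH: "(of_nat P - of_nat k) * e * c = of_nat P * (- 1) ^ k * Q"
    using Suc unfolding e_def c_def Q_def by simp
  have "(of_nat P - of_nat (Suc k)) * of_nat ((P + Suc k) choose (2 * Suc k)) * d =
     ((of_nat P - of_nat k) * e * c) * (((of_nat P - of_nat (Suc k)) * (of_nat P + of_nat k + 1)) / (of_nat k + 1) ^ 2)"
    unfolding f d using nz by (simp add: divide_simps power2_eq_square) (simp add: algebra_simps)
  also have "((of_nat P - of_nat (Suc k)) * (of_nat P + of_nat k + 1)) / (of_nat k + 1) ^ 2 = - (1 - of_nat P ^ 2 / (of_nat (Suc k) ^ 2 :: rat))"
    using nz by (simp add: divide_simps) (simp add: algebra_simps power2_eq_square)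
  also have "((of_nat P - of_nat k) * e * c) * - (1 - of_nat P ^ 2 / (of_nat (Suc k) ^ 2)) =
     of_nat P * (- 1) ^ Suc k * (Q * (1 - of_nat P ^ 2 / of_nat (Suc k) ^ 2))"
    unfolding IH power_Suc by (rule sgn)
  also have "Q * (1 - of_nat P ^ 2 / of_nat (Suc k) ^ 2) = (\<Prod>j = 1..Suc k. 1 - of_nat P ^ 2 / of_nat j ^ 2)"
    unfolding Q_def by (subst prod.nat_ivl_Suc') auto
  finally show ?case unfolding d_def .
qed simp

text \<open>Of the three factors C(2k,k), one is absorbed by \<open>choose_prod_squares\<close>; the
  other two, divided by 16^k, are \<open>leg_at 0 k\<close>. The sign of (-16)^k cancels the sign of
  the product.\<close>

lemma second_sum_formula:
  assumes "odd P"
  shows "(\<Sum>n<P. (2 * of_nat n + 1) / (- 16) ^ n * central_sq_conv n) =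
    of_nat P * (\<Sum>k<P. leg_at 0 k * (\<Prod>j = 1..k. 1 - of_nat P ^ 2 / of_nat j ^ 2))"
proof -
  define e :: "nat \<Rightarrow> rat" where "e k = of_nat (2 * k choose k) ^ 3 / (- 16) ^ k" for k
  have "(\<Sum>n<P. (2 * of_nat n + 1) / (- 16) ^ n * central_sq_conv n) =
      (\<Sum>n<P. \<Sum>k<P. e k * ((- 1) ^ n * (2 * of_nat n + 1) * of_nat ((n + k) choose (2 * k))))"
  proof (rule sum.cong)
    fix n assume "n \<in> {..<P}"
    hence n: "n < P" by simp
    have "(\<Sum>k\<le>n. e k * of_nat ((n + k) choose (2 * k))) = (\<Sum>k<P. e k * of_nat ((n + k) choose (2 * k)))"
      by (rule sum.mono_neutral_left) (use n in \<open>auto simp: binomial_eq_0\<close>)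
    hence "central_sq_conv n = 16 ^ n * (\<Sum>k<P. e k * of_nat ((n + k) choose (2 * k)))"
      using central_sq_conv_formula2[of n] by (simp add: e_def)
    hence "(2 * of_nat n + 1) / (- 16) ^ n * central_sq_conv n =
        (16 ^ n / (- 16) ^ n) * (2 * of_nat n + 1) * (\<Sum>k<P. e k * of_nat ((n + k) choose (2 * k)))" by simp
    also have "16 ^ n / (- 16) ^ n = ((- 1) ^ n :: rat)" by (simp flip: power_divide)
    finally have "(2 * of_nat n + 1) / (- 16) ^ n * central_sq_conv n = (- 1) ^ n * (2 * of_nat n + 1) * (\<Sum>k<P. e k * of_nat ((n + k) choose (2 * k)))"
      .
    thus "(2 * of_nat n + 1) / (- 16) ^ n * central_sq_conv n =
       (\<Sum>k<P. e k * ((- 1) ^ n * (2 * of_nat n + 1) * of_nat ((n + k) choose (2 * k))))"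
      by (simp add: sum_distrib_left ac_simps)
  qed simp
  also have "\<dots> = (\<Sum>k<P. e k * (\<Sum>n<P. (- 1) ^ n * (2 * of_nat n + 1) * of_nat ((n + k) choose (2 * k))))"
    by (subst sum.swap) (simp only: sum_distrib_left)
  also have "\<dots> = (\<Sum>k<P. of_nat P * (leg_at 0 k * (\<Prod>j = 1..k. 1 - of_nat P ^ 2 / of_nat j ^ 2)))"
  proof (rule sum.cong)
    fix k assume k: "k \<in> {..<P}"
    define c :: rat where "c = of_nat (2 * k choose k)"
    have c0: "c \<noteq> 0" by (simp add: c_def)
    have "e k * (\<Sum>n<P. (- 1) ^ n * (2 * of_nat n + 1) * of_nat ((n + k) choose (2 * k))) =
       c ^ 2 / (- 16) ^ k * ((of_nat P - of_nat k) * of_nat ((P + k) choose (2 * k)) * c)"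
      unfolding alternating_choose_sum using assms by (simp add: e_def c_def power3_eq_cube power2_eq_square)
    also have "\<dots> = c ^ 2 / (- 16) ^ k * (of_nat P * (- 1) ^ k * (\<Prod>j = 1..k. 1 - of_nat P ^ 2 / of_nat j ^ 2))"
      unfolding c_def using k by (subst choose_prod_squares) auto
    also have "c ^ 2 / (- 16) ^ k = leg_at 0 k * (- 1) ^ k"
    proof -
      have "(- 16 :: rat) ^ k = (- 1) ^ k * 16 ^ k" by (simp flip: power_mult_distrib)
      moreover have "(16::rat) ^ k = (4 ^ k) ^ 2" by (simp add: power2_eq_square flip: power_mult_distrib)
      ultimately show ?thesis unfolding leg_at_0 c_def[symmetric]
        by (cases "even k") (simp_all add: power_divide)
    qed
    finally show "e k * (\<Sum>n<P. (- 1) ^ n * (2 * of_nat n + 1) * of_nat ((n + k) choose (2 * k))) =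
        of_nat P * (leg_at 0 k * (\<Prod>j = 1..k. 1 - of_nat P ^ 2 / of_nat j ^ 2))"
      by (cases "even k") (simp_all add: ac_simps)
  qed simp
  finally show ?thesis by (simp add: sum_distrib_left)
qed

context prime_gt3
begin

lemma second_sum_cong:
  "pcong 4 (\<Sum>n<p. (2 * of_nat n + 1) / (- 16) ^ n * central_sq_conv n)
     ((- 1) ^ N * (of_nat p + 3 / 2 * of_nat p ^ 3 * alt_harm2 N))"
proof -
  have "odd p" using p_eq by presburger
  hence "(\<Sum>n<p. (2 * of_nat n + 1) / (- 16) ^ n * central_sq_conv n) = 
     of_nat p ^ 1 * (\<Sum>k<p. leg_at 0 k * (\<Prod>j = 1..k. 1 - of_nat p ^ 2 / of_nat j ^ 2))"
    unfolding power_one_right by (rule second_sum_formula)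
  also have "pcong (3 + 1) \<dots> (of_nat p ^ 1 * ((- 1) ^ N * (1 + 3 / 2 * of_nat p ^ 2 * alt_harm2 N)))"
    by (intro pcong_scale sum_leg_at_0_weighted)
  finally show ?thesis by (simp add: algebra_simps power2_eq_square power3_eq_cube)
qed

end

section \<open>A Wilf-Zeilberger pair\<close>

definition half_poch :: "nat \<Rightarrow> rat" where "half_poch n = pochhammer (1/2) n"

lemma half_poch_Suc: "half_poch (Suc n) = (of_nat n + 1/2) * half_poch n"
  by (simp add: half_poch_def pochhammer_Suc algebra_simps)

lemma half_poch_0: "half_poch 0 = 1"
  by (simp add: half_poch_def)

lemma half_poch_eq: "half_poch n = fact n * of_nat (2 * n choose n) / 4 ^ n"
proof (induction n)
  case (Suc n)
  have "fact (Suc n) * of_nat (2 * Suc n choose Suc n) = (fact n * (of_nat (Suc n) * of_nat (2 * Suc n choose Suc n)) :: rat)"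
    by (simp only: fact_Suc of_nat_mult of_nat_Suc ac_simps of_nat_fact)
  also have "\<dots> = fact n * (2 * (2 * of_nat n + 1) * of_nat (2 * n choose n))"
    by (simp only: central_binomial_Suc)
  finally show ?case unfolding half_poch_Suc Suc by (simp add: field_simps del: binomial_Suc_Suc)
qed (simp add: half_poch_0)

lemma half_poch_fact_double: "half_poch n * fact n = fact (2 * n) / 4 ^ n"
proof -
  have "of_nat (2 * n choose n) = (fact (2 * n) / (fact n * fact n) :: rat)"
    using binomial_fact[of n "2 * n", where 'a = rat] by simp
  thus ?thesis by (simp add: half_poch_eq)
qed

text \<open>The summand of S, deformed by a parameter k that is 0 in S. The conditional encodes 1/(n
  - 2k)! = 0 for n < 2k, where subtraction on \<open>nat\<close> would give 1/0! instead;
  \<open>wzG\<close> treats 1/(n - 2k - 1)! in the same way.\<close>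

definition wzF :: "nat \<Rightarrow> nat \<Rightarrow> rat" where
  "wzF n k = (if 2 * k \<le> n then
     (3 * of_nat n - 2 * of_nat k + 1) * half_poch n * half_poch (n - k) ^ 2 * (- 8) ^ n / (4 ^ k * fact n ^ 2 * fact (n - 2 * k)) else 0)"

definition wzG :: "nat \<Rightarrow> nat \<Rightarrow> rat" where
  "wzG n k = (if 2 * k + 1 \<le> n then
     half_poch n * half_poch (n - k - 1) ^ 2 * (- 8) ^ n / (4 ^ (k + 1) * fact (n - 1) ^ 2 * fact (n - 2 * k - 1)) else 0)"

text \<open>In the three boundary cases some of the four terms are cut to 0. In the generic case all
  four are polynomial multiples of a common factor, and a cubic identity in K = k and D = n - 2k - 2
  remains.\<close>

lemma wz_pair: "wzF n (Suc k) - wzF n k = wzG (Suc n) k - wzG n k"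
proof -
  consider "n < 2 * k" | "n = 2 * k" | "n = 2 * k + 1" | d where "n = 2 * k + 2 + d"
    by (metis add_2_eq_Suc' Suc_eq_plus1 less_Suc_eq linorder_neqE_nat le_Suc_ex not_less)
  thus ?thesis
  proof cases
    case 1
    thus ?thesis by (simp add: wzF_def wzG_def)
  next
    case 2
    have "wzF n (Suc k) = 0" "wzG n k = 0" using 2 by (simp_all add: wzF_def wzG_def)
    moreover have "wzF n k = (4 * of_nat k + 1) * half_poch n * half_poch k ^ 2 * (- 8) ^ n / (4 ^ k * fact n ^ 2)"
      using 2 by (simp add: wzF_def)
    moreover have "wzG (Suc n) k = (2 * of_nat k + 1/2) * half_poch n * half_poch k ^ 2 * ((- 8) * (- 8) ^ n) / (4 * 4 ^ k * fact n ^ 2)"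
      using 2 by (simp add: wzG_def half_poch_Suc)
    ultimately show ?thesis by (simp only:) (simp add: field_simps)
  next
    case 3
    define f :: rat where "f = fact (2 * k)"
    define x where "x = half_poch k"
    have f0: "f \<noteq> 0" by (simp add: f_def)
    have fn: "fact n = (2 * of_nat k + 1) * f" using 3 by (simp add: f_def)
    have px: "half_poch (Suc k) = (of_nat k + 1/2) * x" by (simp add: half_poch_Suc x_def)
    have "n - k = Suc k" "n - 2 * k = 1" "n - k - 1 = k" "n - 1 = 2 * k" "Suc n - k - 1 = Suc k" "Suc n - 2 * k - 1 = 1"
      "n - 2 * k - 1 = 0" using 3 by auto
    note s = this
    have a: "wzF n (Suc k) = 0" using 3 by (simp add: wzF_def)
    have b: "wzF n k = (4 * of_nat k + 4) * half_poch n * ((of_nat k + 1/2) * x) ^ 2 * (- 8) ^ n / (4 ^ k * ((2 * of_nat k + 1) * f) ^ 2)"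
      unfolding wzF_def s px fn using 3 by simp
    have c: "wzG (Suc n) k = (2 * of_nat k + 3/2) * half_poch n * ((of_nat k + 1/2) * x) ^ 2 * ((- 8) * (- 8) ^ n) / (4 * 4 ^ k * ((2 * of_nat k + 1) * f) ^ 2)"
      unfolding wzG_def s px using 3 fn by (simp add: half_poch_Suc)
    have d: "wzG n k = half_poch n * x ^ 2 * (- 8) ^ n / (4 * 4 ^ k * f ^ 2)"
      unfolding wzG_def s using 3 by (simp add: x_def f_def)
    have k1: "2 * of_nat k + 1 \<noteq> (0::rat)" using of_nat_neq_0[of "2 * k", where 'a = rat] by (simp add: add.commute)
    have e: "(of_nat k + 1/2) * x = (2 * of_nat k + 1) * (x / 2)" by (simp add: field_simps)
    show ?thesis unfolding a b c d e power_mult_distrib using k1 f0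
      by (simp add: divide_simps) (simp add: algebra_simps)
  next
    case 4
    define f :: rat where "f = fact (n - 1)"
    define g :: rat where "g = fact d"
    define x where "x = half_poch (k + 1 + d)"
    define K D :: rat where "K = of_nat k" and "D = of_nat d"
    have f0: "f \<noteq> 0" "g \<noteq> 0" by (simp_all add: f_def g_def)
    have n: "of_nat n = 2 * K + 2 + D" using 4 by (simp add: K_def D_def)
    have n0: "2 * K + 2 + D \<noteq> 0" using of_nat_neq_0[of "2 * k + 1 + d", where 'a = rat] by (simp add: K_def D_def algebra_simps)
    have d0: "D + 1 \<noteq> 0" "D + 2 \<noteq> 0"
      using of_nat_neq_0[of d, where 'a = rat] of_nat_neq_0[of "Suc d", where 'a = rat] by (simp_all add: D_def add.commute)
    have fn: "fact n = (2 * K + 2 + D) * f"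
      unfolding n[symmetric] f_def using 4 by (subst fact_reduce) auto
    have fd: "fact (Suc (Suc d)) = (D + 2) * ((D + 1) * g)" "fact (Suc d) = (D + 1) * g"
      by (simp_all add: D_def g_def algebra_simps)
    have px: "half_poch (Suc (k + 1 + d)) = (K + D + 3/2) * x"
      by (simp add: half_poch_Suc x_def K_def D_def algebra_simps)
    have pn: "half_poch (Suc n) = (2 * K + D + 5/2) * half_poch n" unfolding half_poch_Suc n by simp
    have s: "n - k = Suc (k + 1 + d)" "n - 2 * k = Suc (Suc d)" "n - Suc k = k + 1 + d" "n - k - 1 = k + 1 + d" 
      "n - 2 * Suc k = d" "Suc n - k - 1 = Suc (k + 1 + d)" "Suc n - 2 * k - 1 = Suc (Suc d)" "n - 2 * k - 1 = Suc d" "Suc n - 1 = n"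
      using 4 by auto
    have a: "wzF n (Suc k) = (4 * K + 5 + 3 * D) * half_poch n * x ^ 2 * (- 8) ^ n / (4 * 4 ^ k * ((2 * K + 2 + D) * f) ^ 2 * g)"
      unfolding wzF_def s fn x_def[symmetric] g_def[symmetric] using 4 n by (simp add: K_def[symmetric] add_ac)
    have b: "wzF n k = (4 * K + 7 + 3 * D) * half_poch n * ((K + D + 3/2) * x) ^ 2 * (- 8) ^ n / (4 ^ k * ((2 * K + 2 + D) * f) ^ 2 * ((D + 2) * ((D + 1) * g)))"
      unfolding wzF_def s fn fd px using 4 n by (simp add: K_def[symmetric] add_ac)
    have c: "wzG (Suc n) k = (2 * K + D + 5/2) * half_poch n * ((K + D + 3/2) * x) ^ 2 * ((- 8) * (- 8) ^ n) / (4 * 4 ^ k * ((2 * K + 2 + D) * f) ^ 2 * ((D + 2) * ((D + 1) * g)))"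
      unfolding wzG_def s fn fd px pn using 4 by (simp add: add_ac)
    have d: "wzG n k = half_poch n * x ^ 2 * (- 8) ^ n / (4 * 4 ^ k * f ^ 2 * ((D + 1) * g))"
      unfolding wzG_def s(4,8) fd x_def[symmetric] f_def[symmetric] using 4 by simp
    define y where "y = half_poch n * x ^ 2 * (- 8) ^ n / (4 * 4 ^ k * ((2 * K + 2 + D) * f) ^ 2 * ((D + 2) * ((D + 1) * g)))"
    have a': "wzF n (Suc k) = y * ((4 * K + 5 + 3 * D) * (D + 1) * (D + 2))"
    proof -
      have "c * P * X * R / (q * E * g) = P * X * R / (q * E * (v * (u * g))) * (c * u * v)"
        if "u \<noteq> 0" "v \<noteq> 0" for c P X R q E u v :: rat
        using that by (simp add: mult_ac)
      from this[OF d0] show ?thesis unfolding a y_def .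
    qed
    have e: "c * P * (s * x) ^ 2 * R / (q * E * G) = P * x ^ 2 * R / (4 * q * E * G) * (4 * c * s ^ 2)"
      "c * P * (s * x) ^ 2 * (- 8 * R) / (4 * q * E * G) = P * x ^ 2 * R / (4 * q * E * G) * (- 8 * c * s ^ 2)"
      for c P s R q E G :: rat
      by (simp_all add: power_mult_distrib mult_ac)
    have b': "wzF n k = y * (4 * (4 * K + 7 + 3 * D) * (K + D + 3/2) ^ 2)"
      unfolding b y_def by (rule e)
    have c': "wzG (Suc n) k = y * (- 8 * (2 * K + D + 5/2) * (K + D + 3/2) ^ 2)"
      unfolding c y_def by (rule e)
    have d': "wzG n k = y * ((2 * K + 2 + D) ^ 2 * (D + 2))"
    proof -
      have "P * X * R / (q * F ^ 2 * G) = P * X * R / (q * (u * F) ^ 2 * (v * G)) * (u ^ 2 * v)"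
        if "u \<noteq> 0" "v \<noteq> 0" for P X R q F G u v :: rat
        using that by (simp add: power_mult_distrib)
      from this[OF n0 d0(2)] show ?thesis unfolding d y_def .
    qed
    have "(4 * K + 5 + 3 * D) * (D + 1) * (D + 2) - 4 * (4 * K + 7 + 3 * D) * (K + D + 3/2) ^ 2 =
      - 8 * (2 * K + D + 5/2) * (K + D + 3/2) ^ 2 - (2 * K + 2 + D) ^ 2 * (D + 2)"
      by (simp add: algebra_simps power2_eq_square)
    thus ?thesis unfolding a' b' c' d' by (simp only: right_diff_distrib[symmetric])
  qed
qed

text \<open>One step in k changes the sum over n by \<open>wzG P k\<close>, the lower end being 0.
  For P = p and K = N the left side keeps only the term n = 2N = p - 1.\<close>

lemma sum_wzF: "(\<Sum>n<P. wzF n K) = (\<Sum>n<P. wzF n 0) + (\<Sum>k<K. wzG P k)"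
proof (induction K)
  case (Suc K)
  have "(\<Sum>n<P. wzF n (Suc K)) - (\<Sum>n<P. wzF n K) = (\<Sum>n<P. wzG (Suc n) K - wzG n K)"
    by (simp only: sum_subtractf[symmetric] wz_pair)
  also have "\<dots> = wzG P K - wzG 0 K" by (rule sum_lessThan_telescope)
  also have "wzG 0 K = 0" by (simp add: wzG_def)
  finally show ?case using Suc by simp
qed simp

lemma wzF_0: "wzF n 0 = (3 * of_nat n + 1) * of_nat (2 * n choose n) ^ 3 / (- 8) ^ n"
proof -
  have "(- 8 :: rat) ^ n * (- 8) ^ n = (4 ^ n) ^ 3"
    by (simp add: power_mult_distrib[symmetric] power_mult[symmetric] mult.commute[of n]) (simp add: power_mult)
  hence e: "(- 8) ^ n / (4 ^ n) ^ 3 = 1 / (- 8 :: rat) ^ n" by (simp add: field_simps)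
  have "wzF n 0 = (3 * of_nat n + 1) * of_nat (2 * n choose n) ^ 3 * ((- 8) ^ n / (4 ^ n) ^ 3)"
    unfolding wzF_def half_poch_eq by (simp add: field_simps power2_eq_square power3_eq_cube)
  thus ?thesis unfolding e by simp
qed

text \<open>Written so that for 2N + 1 = p the two cofactors of p are the quantities in the
  congruences of Wolstenholme and Morley.\<close>

lemma wzF_last: "wzF (2 * N) N = of_nat (2 * N + 1) * (of_nat ((4 * N + 1) choose (2 * N)) * (of_nat (2 * N choose N) / 4 ^ (2 * N)))"
proof -
  have c1: "of_nat ((4 * N + 1) choose (2 * N)) * of_nat (2 * N + 1) = (4 * of_nat N + 1) * (of_nat (2 * (2 * N) choose (2 * N)) :: rat)"
  proof -
    have "(4 * N + 1) choose (2 * N) = (4 * N + 1) choose Suc (2 * N)"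
      using binomial_symmetric[of "2 * N" "4 * N + 1"] by simp
    hence "((4 * N + 1) choose (2 * N)) * (2 * N + 1) = (4 * N + 1) * ((4 * N) choose (2 * N))"
      using Suc_times_binomial_eq[of "4 * N" "2 * N"] by simp
    hence "of_nat ((4 * N + 1) choose (2 * N)) * of_nat (2 * N + 1) = (of_nat (4 * N + 1) * of_nat ((4 * N) choose (2 * N)) :: rat)"
      by (metis of_nat_mult)
    thus ?thesis by simp
  qed
  have c2: "of_nat (2 * N choose N) = (fact (2 * N) / (fact N * fact N) :: rat)"
    using binomial_fact[of N "2 * N", where 'a = rat] by simp
  have p1: "(- 8 :: rat) ^ (2 * N) = 4 ^ N * (4 ^ N) ^ 2" 
    by (simp add: power_mult power2_eq_square flip: power_mult_distrib)
  have p2: "(4 :: rat) ^ (2 * N) = (4 ^ N) ^ 2" by (simp add: power_mult power2_eq_square flip: power_mult_distrib)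
  define q :: rat where "q = 4 ^ N"
  have q: "q \<noteq> 0" by (simp add: q_def)
  have "wzF (2 * N) N = (4 * of_nat N + 1) * half_poch (2 * N) * half_poch N ^ 2 * (q * q ^ 2) / (q * fact (2 * N) ^ 2)"
    unfolding wzF_def p1 q_def[symmetric] by simp
  also have "\<dots> = (4 * of_nat N + 1) * of_nat (2 * (2 * N) choose (2 * N)) * (of_nat (2 * N choose N) / q ^ 2)"
    unfolding half_poch_eq[of "2 * N"] unfolding half_poch_eq[of N] p2 q_def[symmetric] c2
    using q by (simp add: divide_simps power2_eq_square)
  also have "\<dots> = of_nat ((4 * N + 1) choose (2 * N)) * of_nat (2 * N + 1) * (of_nat (2 * N choose N) / q ^ 2)"
    unfolding c1 ..
  finally show ?thesis unfolding p2 q_def by (simp only: ac_simps)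
qed

text \<open>\<open>inv_binom n i\<close> equals \<open>1 / ((i+1) C(n,i+1))\<close> for i < n.\<close>

definition inv_binom :: "nat \<Rightarrow> nat \<Rightarrow> rat" where
  "inv_binom n i = fact i * fact (n - Suc i) / fact n"

lemma inv_binom_add: "i < n \<Longrightarrow> inv_binom (Suc n) i + inv_binom (Suc n) (Suc i) = inv_binom n i"
proof -
  assume "i < n"
  then obtain d where n: "n = i + Suc d" using less_imp_Suc_add by auto
  have "of_nat i + (of_nat d + 1) + 1 \<noteq> (0::rat)" using of_nat_neq_0[of "Suc (i + d)", where 'a = rat] by (simp add: algebra_simps)
  thus ?thesis unfolding inv_binom_def n by (simp add: divide_simps) (simp add: algebra_simps)
qed

lemma inv_binom_ends: "inv_binom (Suc n) 0 = 1 / of_nat (Suc n)" "inv_binom (Suc n) n = 1 / of_nat (Suc n)"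
  unfolding inv_binom_def fact_Suc by simp_all

text \<open>\<open>inv_binom_add\<close> is Pascal's rule for reciprocals; with alternating signs it
  telescopes.\<close>

lemma alternating_inv_binom: "(\<Sum>i<n. (- 1) ^ Suc i * inv_binom n i) = ((- 1) ^ n - 1) / of_nat (Suc n)"
proof -
  have "(\<Sum>i<n. (- 1) ^ Suc i * inv_binom n i) = (\<Sum>i<n. (- 1) ^ Suc i * inv_binom (Suc n) i - (- 1) ^ Suc (Suc i) * inv_binom (Suc n) (Suc i))"
  proof (rule sum.cong)
    fix i assume "i \<in> {..<n}"
    hence "inv_binom n i = inv_binom (Suc n) i + inv_binom (Suc n) (Suc i)" by (simp add: inv_binom_add)
    thus "(- 1) ^ Suc i * inv_binom n i = (- 1) ^ Suc i * inv_binom (Suc n) i - (- 1) ^ Suc (Suc i) * inv_binom (Suc n) (Suc i)"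
      by (simp add: algebra_simps)
  qed simp
  also have "\<dots> = (- 1) ^ Suc 0 * inv_binom (Suc n) 0 - (- 1) ^ Suc n * inv_binom (Suc n) n"
    by (rule sum_lessThan_telescope')
  also have "\<dots> = ((- 1) ^ n - 1) / of_nat (Suc n)"
    by (simp add: inv_binom_ends diff_divide_distrib)
  finally show ?thesis .
qed

text \<open>Division by i + 1 turns the second term of \<open>inv_binom_add\<close> into
  \<open>inv_binom n i\<close> / (n+1), whose alternating sum is known. Together with the new term i
  = n, passing from n to n + 1 adds (1 + 2 (-1)^(n+1))/(n+1)^2.\<close>

lemma alternating_inv_binom_div:
  "(\<Sum>i<n. (- 1) ^ Suc i * (inv_binom n i / of_nat (Suc i))) = (\<Sum>j = 1..n. 1 / of_nat j ^ 2) + 2 * (\<Sum>j = 1..n. (- 1) ^ j / of_nat j ^ 2)"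
proof (induction n)
  case (Suc n)
  have aux: "h + 2 * a - (e - 1) / s / s + (- 1 * e) * (1 / s / s) = (h + 1 / s ^ 2) + 2 * (a + (- 1 * e) / s ^ 2)"
    for h a e s :: rat by (simp add: power2_eq_square diff_divide_distrib)
  have e: "inv_binom (Suc n) (Suc i) / of_nat (Suc i) = inv_binom n i / of_nat (Suc n)" for i
    unfolding inv_binom_def by (simp add: divide_simps)
  have "(\<Sum>i<n. (- 1) ^ Suc i * (inv_binom n i / of_nat (Suc i))) =
     (\<Sum>i<n. (- 1) ^ Suc i * (inv_binom (Suc n) i / of_nat (Suc i)) + (- 1) ^ Suc i * inv_binom n i / of_nat (Suc n))"
  proof (rule sum.cong)
    fix i assume "i \<in> {..<n}"
    hence "inv_binom n i = inv_binom (Suc n) i + inv_binom (Suc n) (Suc i)" by (simp add: inv_binom_add)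
    hence "inv_binom n i / of_nat (Suc i) = inv_binom (Suc n) i / of_nat (Suc i) + inv_binom n i / of_nat (Suc n)"
      unfolding e[symmetric] by (simp only: add_divide_distrib)
    thus "(- 1) ^ Suc i * (inv_binom n i / of_nat (Suc i)) = (- 1) ^ Suc i * (inv_binom (Suc n) i / of_nat (Suc i)) + (- 1) ^ Suc i * inv_binom n i / of_nat (Suc n)"
      by (simp only: distrib_left times_divide_eq_right)
  qed simp
  also have "\<dots> = (\<Sum>i<n. (- 1) ^ Suc i * (inv_binom (Suc n) i / of_nat (Suc i))) + ((- 1) ^ n - 1) / of_nat (Suc n) / of_nat (Suc n)"
    by (simp only: sum.distrib sum_divide_distrib[symmetric] alternating_inv_binom)
  finally have "(\<Sum>i<n. (- 1) ^ Suc i * (inv_binom (Suc n) i / of_nat (Suc i))) = 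
     (\<Sum>i<n. (- 1) ^ Suc i * (inv_binom n i / of_nat (Suc i))) - ((- 1) ^ n - 1) / of_nat (Suc n) / of_nat (Suc n)"
    by simp
  moreover note inv_binom_ends(2)[of n]
  ultimately have "(\<Sum>i<Suc n. (- 1) ^ Suc i * (inv_binom (Suc n) i / of_nat (Suc i))) =
    (\<Sum>j = 1..n. 1 / of_nat j ^ 2) + 2 * (\<Sum>j = 1..n. (- 1) ^ j / of_nat j ^ 2)
     - ((- 1) ^ n - 1) / of_nat (Suc n) / of_nat (Suc n) + (- 1) ^ Suc n * (1 / of_nat (Suc n) / of_nat (Suc n))"
    unfolding sum.lessThan_Suc Suc by (simp only:)
  also have "\<dots> = ((\<Sum>j = 1..n. 1 / of_nat j ^ 2) + 1 / of_nat (Suc n) ^ 2)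
      + 2 * ((\<Sum>j = 1..n. (- 1) ^ j / of_nat j ^ 2) + (- 1) ^ Suc n / of_nat (Suc n) ^ 2)"
    unfolding power_Suc[of "- 1"] by (rule aux)
  finally show ?case by simp
qed simp

section \<open>The boundary terms of the pair modulo p^4\<close>

context prime_gt3
begin

text \<open>The factor N + 1/2 = p/2 is the first one divisible by p, and the factors after it are
  p/2 + j.\<close>

lemma half_poch_N_plus: "half_poch (N + 1 + i) = of_nat p / 2 * half_poch N * (\<Prod>j = 1..i. of_nat p / 2 + of_nat j)"
proof (induction i)
  case 0
  show ?case by (simp add: half_poch_Suc of_nat_p add_divide_distrib)
next
  case (Suc i)
  have "half_poch (N + 1 + Suc i) = (of_nat (N + 1 + i) + 1/2) * half_poch (N + 1 + i)" using half_poch_Suc[of "N + 1 + i"] by simp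
  also have "of_nat (N + 1 + i) + 1/2 = (of_nat p / 2 + of_nat (Suc i) :: rat)" unfolding of_nat_p by (simp add: add_divide_distrib)
  finally show ?case unfolding Suc by (simp add: ac_simps)
qed

lemma shifted_fact_cong: "pcong 1 (\<Prod>j = 1..i. of_nat p / 2 + of_nat j) (fact i)"
proof -
  have "pcong 1 (\<Prod>j = 1..i. of_nat p / 2 + of_nat j) (\<Prod>j = 1..i. of_nat j)"
  proof (intro pcong_prod conjI)
    show "pcong 1 (of_nat p / 2 + of_nat j) (of_nat j)" for j
      using pcong_p_multiple[OF Zp_div_2(1)[OF Zp_num(2)], of 1 "of_nat j"] by (simp add: add.commute)
  qed (auto intro: Zp_div_2)
  thus ?thesis by (simp add: fact_prod)
qed

lemma Zp_fact: "Zp (fact n)"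
  using Zp_of_nat[of "fact n"] by simp

text \<open>Modulo p the number 1/2 is -N, and the rising factorial of -N is (-1)^j
  N!/(N-j)!.\<close>

lemma half_poch_cong: "j \<le> N \<Longrightarrow> pcong 1 (half_poch j) ((- 1) ^ j * (fact N / fact (N - j)))"
proof (induction j)
  case (Suc j)
  have "pcong 1 (half_poch (Suc j)) ((of_nat j + 1/2) * ((- 1) ^ j * (fact N / fact (N - j))))"
    unfolding half_poch_Suc using Suc Zp_add[OF _ Zp_div_2(1)[OF Zp_num(2)], of "of_nat j"] by (intro pcong_cmult) auto
  also have "pcong 1 \<dots> (- (of_nat N - of_nat j) * ((- 1) ^ j * (fact N / fact (N - j))))"
  proof (rule pcong_multc)
    have "Zp (of_nat (fact N) / of_nat (fact (N - j)))" using p_eq by (intro Zp_div_nat not_dvd_fact) (auto simp: Zp_fact)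
    thus "Zp ((- 1) ^ j * (fact N / fact (N - j)))" by (intro Zp_mult Zp_power Zp_minus) simp_all
    have "of_nat j + 1/2 = - (of_nat N - of_nat j) + of_nat p ^ 1 * (1/2 :: rat)" by (simp add: of_nat_p add_divide_distrib)
    thus "pcong 1 (of_nat j + 1/2) (- (of_nat N - of_nat j))"
      using pcong_p_multiple[OF Zp_div_2(1)[OF Zp_num(2)], of 1 "- (of_nat N - of_nat j)"] by (simp only:)
  qed
  also have "\<dots> = (- 1) ^ Suc j * (fact N / fact (N - Suc j))"
  proof -
    have "fact (N - j) = (of_nat N - of_nat j) * (fact (N - Suc j) :: rat)"
      using Suc.prems by (subst fact_reduce) (auto simp: of_nat_diff)
    moreover have "of_nat N - of_nat j \<noteq> (0::rat)" using Suc.prems by auto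
    moreover have "- a * (e * (f / (a * b))) = (- 1 * e) * (f / b)" if "a \<noteq> 0" for a b e f :: rat
      using that by simp
    ultimately show ?thesis unfolding power_Suc by (simp only: refl if_True simp_thms)
  qed
  finally show ?case .
qed (simp add: half_poch_0)


lemma pcong_power_4: "pcong 1 (4 ^ N) 1"
proof -
  have "[2 ^ (p - 1) = 1] (mod p)"
    using fermat_theorem[OF prime_p not_dvd_less[of 2]] p_gt3 by simp
  hence "[int (2 ^ (p - 1)) = int 1] (mod int p)" by (simp only: cong_int_iff)
  hence "pcong 1 (of_int (int (2 ^ (p - 1)))) (of_int (int 1))" by (intro pcong_of_int) simp
  moreover have "of_int (int (2 ^ (p - 1))) = (4 ^ N :: rat)"
    unfolding p_minus_1 by (simp add: power_mult)
  ultimately show ?thesis by (simp only: of_nat_1 of_int_1)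
qed

lemma Zp_inverse_fact: "n < p \<Longrightarrow> Zp (inverse (fact n))"
  using Zp_inverse_nat[OF not_dvd_fact, of n] by simp

lemma Zp_half_poch: "Zp (half_poch n)"
proof (induction n)
  case (Suc n)
  thus ?case unfolding half_poch_Suc by (intro Zp_mult Zp_add Zp_of_nat) (use Zp_div_2(1)[OF Zp_num(2)] in simp_all)
qed (simp add: half_poch_0)

lemma Zp_inverse_half_poch:
  assumes "j \<le> N"
  shows "Zp (inverse (half_poch j))" "half_poch j \<noteq> 0"
proof -
  show nz: "half_poch j \<noteq> 0" using half_poch_fact_double[of j] by auto
  have "fact (2 * j) = 4 ^ j * (half_poch j * fact j)" unfolding half_poch_fact_double by simp
  hence "inverse (half_poch j) = 4 ^ j * fact j * inverse (fact (2 * j))"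
    using nz by (simp add: field_simps)
  moreover have "Zp (4 ^ j * fact j * inverse (fact (2 * j)))"
    using assms p_eq by (intro Zp_mult Zp_power Zp_num Zp_fact Zp_inverse_fact) auto
  ultimately show "Zp (inverse (half_poch j))" by simp
qed

lemma inverse_half_poch_cong:
  assumes "j \<le> N"
  shows "pcong 1 (inverse (half_poch j)) ((- 1) ^ j * fact (N - j) * inverse (fact N))"
proof -
  have "pcong 1 (inverse (half_poch j)) (inverse ((- 1) ^ j * (fact N / fact (N - j))))"
  proof (rule pcong_inverse[OF half_poch_cong[OF assms]])
    have "inverse ((- 1) ^ j * (fact N / fact (N - j))) = (- 1) ^ j * fact (N - j) * inverse (fact N :: rat)"
      by (cases "even j") (simp_all add: field_simps)
    also have "Zp \<dots>" using p_eq by (intro Zp_mult Zp_power Zp_minus Zp_num Zp_fact Zp_inverse_fact) auto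
    finally show "Zp (inverse ((- 1) ^ j * (fact N / fact (N - j))))" .
  qed (use Zp_inverse_half_poch[OF assms] in auto)
  also have "inverse ((- 1) ^ j * (fact N / fact (N - j))) = (- 1) ^ j * fact (N - j) * inverse (fact N :: rat)"
    by (cases "even j") (simp_all add: field_simps)
  finally show ?thesis .
qed

text \<open>The duplication formula \<open>half_poch_fact_double\<close> at N is used twice. One
  remaining factor \<open>half_poch N\<close> is (-1)^N N! modulo p, and 4^N is 1 modulo p.\<close>

lemma half_poch_cube_cong: "pcong 1 (half_poch N ^ 3 * fact N * inverse (fact (2 * N)) ^ 2) ((- 1) ^ N)"
proof -
  have IF: "Zp (inverse (fact (2 * N)))" using p_eq by (intro Zp_inverse_fact) simp
  have I4: "Zp (inverse (4 ^ N))" using Zp_inverse_nat[OF not_dvd_2power, of "2 * N"] by (simp add: power_mult)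
  have d: "half_poch N * fact N * inverse (fact (2 * N)) = inverse (4 ^ N)"
    unfolding half_poch_fact_double by (simp add: field_simps)
  have "half_poch N ^ 3 * fact N * inverse (fact (2 * N)) ^ 2 =
      half_poch N * inverse (fact (2 * N)) * (half_poch N * fact N * inverse (fact (2 * N))) * half_poch N"
    by (simp add: power2_eq_square power3_eq_cube ac_simps)
  also have "\<dots> = half_poch N * inverse (fact (2 * N)) * inverse (4 ^ N) * half_poch N" unfolding d ..
  also have "pcong 1 \<dots> (half_poch N * inverse (fact (2 * N)) * inverse (4 ^ N) * ((- 1) ^ N * (fact N / fact (N - N))))"
    by (intro pcong_cmult Zp_mult Zp_half_poch IF I4 half_poch_cong) simp
  also have "\<dots> = (half_poch N * fact N * inverse (fact (2 * N))) * inverse (4 ^ N) * (- 1) ^ N" by simp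
  also have "\<dots> = inverse (4 ^ N) * inverse (4 ^ N) * (- 1) ^ N" unfolding d ..
  also have "pcong 1 \<dots> (1 * 1 * (- 1) ^ N)"
  proof (intro pcong_multc pcong_mult)
    have "pcong 1 (inverse (4 ^ N)) (inverse 1)" by (rule pcong_inverse[OF pcong_power_4 I4]) auto
    thus "pcong 1 (inverse (4 ^ N)) 1" "pcong 1 (inverse (4 ^ N)) 1" by simp_all
  qed (use I4 in auto)
  finally show ?thesis by simp
qed

text \<open>Counted from the top, k = N - j gives the squared Pochhammer symbol the index N + j, so
  it contributes p^2; \<open>half_poch p\<close> contributes the third p. The denominators are prime
  to p, and the p-integral cofactor of p^3 is needed only modulo p.\<close>

lemma wzG_cong:
  assumes "j \<in> {1..N}"
  shows "pcong 4 (wzG p (N - j)) (of_nat p ^ 3 * (- (1/4) * (- 1) ^ N * ((- 1) ^ j * (inv_binom N (j - 1) / of_nat j))))"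
proof -
  have j: "1 \<le> j" "j \<le> N" using assms by auto
  define Q :: "nat \<Rightarrow> rat" where "Q i = (\<Prod>j = 1..i. of_nat p / 2 + of_nat j)" for i
  have IQ: "Zp (Q i)" for i using pcong_Zp[OF shifted_fact_cong Zp_fact] unfolding Q_def .
  have Qc: "pcong 1 (Q i) (fact i)" for i using shifted_fact_cong unfolding Q_def .
  have idx: "2 * (N - j) + 1 \<le> p" "p - (N - j) - 1 = N + 1 + (j - 1)" "p - 2 * (N - j) - 1 = 2 * j" "p - 1 = 2 * N"
    using j p_eq by auto
  have php: "half_poch p = of_nat p / 2 * half_poch N * Q N"
  proof -
    have "N + 1 + N = p" using p_eq by simp
    thus ?thesis using half_poch_N_plus[of N] unfolding Q_def by (simp only:)
  qed
  have phj: "half_poch (N + 1 + (j - 1)) = of_nat p / 2 * half_poch N * Q (j - 1)"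
    unfolding Q_def by (rule half_poch_N_plus)
  have f2j: "fact (2 * j) = 4 ^ j * (half_poch j * fact j)" unfolding half_poch_fact_double by simp
  have p8: "(- 8 :: rat) ^ p = - 8 * (4 ^ N * (4 ^ N) ^ 2)"
  proof -
    have "Suc (2 * N) = p" using p_eq by simp
    hence "(- 8 :: rat) ^ p = (- 8) ^ Suc (2 * N)" by (simp only:)
    also have "\<dots> = - 8 * ((- 8) ^ 2) ^ N" by (simp add: power_mult)
    finally show ?thesis by (simp add: power2_eq_square flip: power_mult_distrib)
  qed
  have p4: "4 ^ (N - j + 1) * 4 ^ j = (4 * 4 ^ N :: rat)" using j by (simp flip: power_add)
  have "wzG p (N - j) = half_poch p * half_poch (N + 1 + (j - 1)) ^ 2 * (- 8) ^ p / (4 ^ (N - j + 1) * fact (2 * N) ^ 2 * fact (2 * j))"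
    unfolding wzG_def idx(2,3,4) using idx(1) by simp
  also have "\<dots> = of_nat p ^ 3 * half_poch N ^ 3 * Q N * Q (j - 1) ^ 2 / 8 * (- 8) ^ p / ((4 ^ (N - j + 1) * 4 ^ j) * fact (2 * N) ^ 2 * (half_poch j * fact j))"
    unfolding php phj f2j by (simp add: power2_eq_square power3_eq_cube mult_ac)
  \<comment> \<open>The constant -1/4 collects 1/8 from the three factors p/2, the -8 left over from
    (-8)^p and 1/4 from the surplus power of 4.\<close>
  also have "\<dots> = of_nat p ^ 3 * (- (1/4) * (half_poch N ^ 3 * inverse (fact (2 * N)) ^ 2 * (4 ^ N) ^ 2 * Q N * Q (j - 1) ^ 2 * inverse (fact j) * inverse (half_poch j)))"
  proof -
    have "a * b * c * d / 8 * (- 8 * (q * q2)) / (4 * q * f ^ 2 * (h * i)) =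
        a * (- (1/4) * (b * inverse f ^ 2 * q2 * c * d * inverse i * inverse h))" if "q \<noteq> 0" "f \<noteq> 0" "h \<noteq> 0" "i \<noteq> 0" for a b c d f h i q q2 :: rat
      using that by (simp add: field_simps)
    note e = this
    show ?thesis unfolding p8 p4 by (rule e) (use Zp_inverse_half_poch[OF j(2)] in simp_all)
  qed
  finally have eq: "wzG p (N - j) = \<dots>" .
  have cc: "pcong 1 (half_poch N ^ 3 * inverse (fact (2 * N)) ^ 2 * (4 ^ N) ^ 2 * Q N * Q (j - 1) ^ 2 * inverse (fact j) * inverse (half_poch j))
     (half_poch N ^ 3 * inverse (fact (2 * N)) ^ 2 * 1 ^ 2 * fact N * fact (j - 1) ^ 2 * inverse (fact j) * ((- 1) ^ j * fact (N - j) * inverse (fact N)))"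
  proof -
    have IF: "Zp (inverse (fact (2 * N)))" "Zp (inverse (fact j))" "Zp (inverse (fact N))"
      using p_eq j by (auto intro!: Zp_inverse_fact)
    show ?thesis
      by (intro pcong_mult pcong_refl pcong_power Qc pcong_power_4 inverse_half_poch_cong j Zp_mult Zp_power IQ Zp_half_poch IF Zp_fact Zp_minus Zp_num)
  qed
  have h: "inv_binom N (j - 1) / of_nat j = fact (j - 1) ^ 2 * inverse (fact j) * fact (N - j) * inverse (fact N)"
  proof -
    have "fact j = of_nat j * (fact (j - 1) :: rat)" using j by (subst fact_reduce) auto
    moreover have "N - Suc (j - 1) = N - j" using j by simp
    moreover have "F * A / B / J = F ^ 2 * inverse (J * F) * A * inverse B"
      if "J \<noteq> 0" "F \<noteq> 0" for F A B J :: rat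
      using that by (simp add: power2_eq_square divide_inverse)
    ultimately show ?thesis using j unfolding inv_binom_def by simp
  qed
  have "half_poch N ^ 3 * inverse (fact (2 * N)) ^ 2 * 1 ^ 2 * fact N * fact (j - 1) ^ 2 * inverse (fact j) * ((- 1) ^ j * fact (N - j) * inverse (fact N)) =
     (half_poch N ^ 3 * fact N * inverse (fact (2 * N)) ^ 2) * ((- 1) ^ j * (inv_binom N (j - 1) / of_nat j))"
    unfolding h by (simp only: power_one mult_1_left mult_1_right mult_ac)
  note cc = cc[unfolded this]
  have Ib: "Zp ((- 1) ^ j * (inv_binom N (j - 1) / of_nat j))"
  proof -
    have "inv_binom N (j - 1) / of_nat j = fact (j - 1) * fact (N - j) * inverse (fact N) * inverse (of_nat j)"
      using j by (simp add: inv_binom_def divide_inverse)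
    moreover have "Zp \<dots>" using j p_eq by (intro Zp_mult Zp_fact Zp_inverse_fact Zp_inverse_nat not_dvd_less) auto
    ultimately show ?thesis by (intro Zp_mult Zp_power Zp_minus Zp_num) simp
  qed
  note cc
  also have "pcong 1 ((half_poch N ^ 3 * fact N * inverse (fact (2 * N)) ^ 2) * ((- 1) ^ j * (inv_binom N (j - 1) / of_nat j))) 
     ((- 1) ^ N * ((- 1) ^ j * (inv_binom N (j - 1) / of_nat j)))"
    by (intro pcong_multc Ib half_poch_cube_cong)
  finally have "pcong (1 + 3) (wzG p (N - j)) (of_nat p ^ 3 * (- (1/4) * ((- 1) ^ N * ((- 1) ^ j * (inv_binom N (j - 1) / of_nat j)))))"
    unfolding eq using Zp_minus[OF Zp_div_2(2)[OF Zp_num(2)]] by (intro pcong_scale pcong_cmult)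
  thus ?thesis by (simp add: mult.assoc)
qed

text \<open>\<open>wzF (2 * N) N\<close> is (-1)^N p modulo p^4 without further correction; the
  whole p^3 term comes from the \<open>wzG\<close> terms, where \<open>harm2 N\<close> drops out
  modulo p.\<close>

lemma sum_3k1_cong:
  "pcong 4 (\<Sum>k<p. (3 * of_nat k + 1) * of_nat (2 * k choose k) ^ 3 / (- 8) ^ k)
     ((- 1) ^ N * (of_nat p + 1 / 2 * of_nat p ^ 3 * alt_harm2 N))"
proof -
  have last: "(\<Sum>n<p. wzF n N) = wzF (2 * N) N"
  proof -
    have "(\<Sum>n<p. wzF n N) = (\<Sum>n\<in>{2 * N}. wzF n N)"
      by (rule sum.mono_neutral_right) (use p_eq in \<open>auto simp: wzF_def\<close>)
    thus ?thesis by simp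
  qed
  have "(\<Sum>k<p. (3 * of_nat k + 1) * of_nat (2 * k choose k) ^ 3 / (- 8) ^ k) = wzF (2 * N) N - (\<Sum>k<N. wzG p k)"
    using sum_wzF[of N p] unfolding last wzF_0 by simp
  also have "pcong 4 \<dots> ((- 1) ^ N * of_nat p - of_nat p ^ 3 * (- (1/2) * (- 1) ^ N * alt_harm2 N))"
  proof (rule pcong_diff)
    have idx: "4 * N + 1 = 2 * p - 1" "2 * N = p - 1" "2 * N + 1 = p" using p_eq by auto
    have "wzF (2 * N) N = of_nat p ^ 1 * (of_nat ((2 * p - 1) choose (p - 1)) * (of_nat ((p - 1) choose N) / 4 ^ (p - 1)))"
      unfolding wzF_last unfolding idx(1,3) unfolding idx(2) by simp
    also have "pcong (3 + 1) \<dots> (of_nat p ^ 1 * (1 * (- 1) ^ N))"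
      by (intro pcong_scale pcong_mult wolstenholme morley) auto
    finally show "pcong 4 (wzF (2 * N) N) ((- 1) ^ N * of_nat p)" by (simp add: mult.commute)
    have "(\<Sum>k<N. wzG p k) = (\<Sum>j = 1..N. wzG p (N - j))"
      by (rule sum.reindex_bij_witness[of _ "\<lambda>j. N - j" "\<lambda>j. N - j"]) auto
    also have "pcong 4 \<dots> (\<Sum>j = 1..N. of_nat p ^ 3 * (- (1/4) * (- 1) ^ N * ((- 1) ^ j * (inv_binom N (j - 1) / of_nat j))))"
      by (intro pcong_sum wzG_cong)
    also have "\<dots> = of_nat p ^ 3 * (- (1/4) * (- 1) ^ N * (\<Sum>j = 1..N. (- 1) ^ j * (inv_binom N (j - 1) / of_nat j)))"
      by (simp only: sum_distrib_left)
    also have "(\<Sum>j = 1..N. (- 1) ^ j * (inv_binom N (j - 1) / of_nat j)) = (\<Sum>i<N. (- 1) ^ Suc i * (inv_binom N i / of_nat (Suc i)))"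
      by (rule sum.reindex_bij_witness[of _ Suc "\<lambda>j. j - 1"]) auto
    also have "\<dots> = harm2 N + 2 * alt_harm2 N" unfolding alternating_inv_binom_div harm2_def alt_harm2_def ..
    also have "pcong 4 (of_nat p ^ 3 * (- (1/4) * (- 1) ^ N * (harm2 N + 2 * alt_harm2 N))) (of_nat p ^ 3 * (- (1/4) * (- 1) ^ N * (0 + 2 * alt_harm2 N)))"
    proof -
      have "pcong (1 + 3) (of_nat p ^ 3 * (- (1/4) * (- 1) ^ N * (harm2 N + 2 * alt_harm2 N))) (of_nat p ^ 3 * (- (1/4) * (- 1) ^ N * (0 + 2 * alt_harm2 N)))"
        using Zp_div_2(2)[OF Zp_num(2)] by (intro pcong_scale pcong_cmult pcong_add harm2_N pcong_refl Zp_mult Zp_power Zp_minus Zp_num) simp_all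
      thus ?thesis by simp
    qed
    finally show "pcong 4 (\<Sum>k<N. wzG p k) (of_nat p ^ 3 * (- (1/2) * (- 1) ^ N * alt_harm2 N))"
      by (simp add: mult.commute)
  qed
  also have "\<dots> = (- 1) ^ N * (of_nat p + 1 / 2 * of_nat p ^ 3 * alt_harm2 N)" by (simp add: algebra_simps)
  finally show ?thesis .
qed

end

section \<open>The first sum\<close>

text \<open>The binomial series of (1 - x)^(-(m+1)), cut after x^m.\<close>

definition trunc_binom :: "rat \<Rightarrow> nat \<Rightarrow> rat" where
  "trunc_binom x m = (\<Sum>j\<le>m. of_nat ((m + j) choose j) * x ^ j)"

lemma trunc_binom_rec:
  "(1 - x) * trunc_binom x (Suc m) = trunc_binom x m + of_nat (2 * Suc m choose Suc m) * (x ^ Suc m / 2 - x ^ Suc (Suc m))"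
proof -
  have half: "of_nat ((m + Suc m) choose Suc m) = (of_nat (2 * Suc m choose Suc m) / 2 :: rat)"
  proof -
    have "2 * Suc m choose Suc m = 2 * ((m + Suc m) choose Suc m)"
      using binomial_symmetric[of m "m + Suc m"] by (simp add: mult_2)
    thus ?thesis by simp
  qed
  have "trunc_binom x (Suc m) = (\<Sum>j\<le>Suc m. of_nat ((m + j) choose j) * x ^ j) + (\<Sum>j\<le>m. of_nat ((Suc m + j) choose j) * x ^ Suc j)"
    unfolding trunc_binom_def sum.atMost_Suc_shift[of _ m] by (simp add: algebra_simps sum.distrib)
  also have "(\<Sum>j\<le>Suc m. of_nat ((m + j) choose j) * x ^ j) = trunc_binom x m + of_nat ((m + Suc m) choose Suc m) * x ^ Suc m"
    unfolding trunc_binom_def by simp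
  also have "(\<Sum>j\<le>m. of_nat ((Suc m + j) choose j) * x ^ Suc j) = x * (trunc_binom x (Suc m) - of_nat (2 * Suc m choose Suc m) * x ^ Suc m)"
  proof -
    have "trunc_binom x (Suc m) - of_nat (2 * Suc m choose Suc m) * x ^ Suc m = (\<Sum>j\<le>m. of_nat ((Suc m + j) choose j) * x ^ j)"
      unfolding trunc_binom_def sum.atMost_Suc mult_2 by (simp del: binomial_Suc_Suc)
    thus ?thesis by (simp add: sum_distrib_left ac_simps)
  qed
  finally show ?thesis unfolding half by (simp add: algebra_simps del: binomial_Suc_Suc)
qed

text \<open>The Chaundy-Bullard identity (1-x)^(m+1) T(x) + x^(m+1) T(1-x) = 1 at x = 2, for T(x) =
  \<open>trunc_binom x m\<close>. In the induction the central binomial terms at 2 and -1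
  cancel.\<close>

lemma trunc_binom_2_minus_1: "trunc_binom 2 m - 2 * (- 2) ^ m * trunc_binom (- 1) m = - ((- 1) ^ m)"
proof (induction m)
  case (Suc m)
  define c :: rat where "c = of_nat (2 * Suc m choose Suc m)"
  have a: "trunc_binom 2 (Suc m) = - trunc_binom 2 m + 3 / 2 * 2 ^ Suc m * c"
    using trunc_binom_rec[of 2 m, folded c_def] by (simp add: algebra_simps)
  have "2 * trunc_binom (- 1) (Suc m) = trunc_binom (- 1) m + 3 / 2 * (- 1) ^ Suc m * c"
    using trunc_binom_rec[of "- 1" m, folded c_def] by (simp add: algebra_simps)
  hence "(- 2) ^ Suc m * (2 * trunc_binom (- 1) (Suc m)) = (- 2) ^ Suc m * (trunc_binom (- 1) m + 3 / 2 * (- 1) ^ Suc m * c)" by simp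
  also have "\<dots> = - (2 * (- 2) ^ m * trunc_binom (- 1) m) + 3 / 2 * ((- 2) ^ Suc m * (- 1) ^ Suc m) * c"
    by (simp add: algebra_simps)
  also have "(- 2) ^ Suc m * (- 1) ^ Suc m = (2 ^ Suc m :: rat)" by (simp flip: power_mult_distrib)
  finally have b: "2 * (- 2) ^ Suc m * trunc_binom (- 1) (Suc m) = - (2 * (- 2) ^ m * trunc_binom (- 1) m) + 3 / 2 * 2 ^ Suc m * c"
    by (simp only: ac_simps)
  have "trunc_binom 2 (Suc m) - 2 * (- 2) ^ Suc m * trunc_binom (- 1) (Suc m) = - (trunc_binom 2 m - 2 * (- 2) ^ m * trunc_binom (- 1) m)"
    unfolding a b by simp
  thus ?case unfolding Suc by simp
qed (simp add: trunc_binom_def)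

text \<open>With this linear weight the summand is a difference of consecutive values of j C(m+j,j)
  x^j.\<close>

lemma trunc_binom_telescope:
  fixes x :: rat
  shows "(\<Sum>j\<le>m. ((of_nat m + 1) * x + (x - 1) * of_nat j) * (of_nat ((m + j) choose j) * x ^ j)) =
    (of_nat m + 1) * of_nat ((m + Suc m) choose Suc m) * x ^ Suc m"
proof -
  define Z :: "nat \<Rightarrow> rat" where "Z j = of_nat j * of_nat ((m + j) choose j) * x ^ j" for j
  have "((of_nat m + 1) * x + (x - 1) * of_nat j) * (of_nat ((m + j) choose j) * x ^ j) = Z (Suc j) - Z j" for j
  proof -
    have "of_nat (Suc j) * of_nat (Suc (m + j) choose Suc j) = (of_nat (Suc (m + j)) * of_nat ((m + j) choose j) :: rat)"
      using choose_Suc_Suc[of "m + j" j] by (simp del: binomial_Suc_Suc)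
    hence "Z (Suc j) = of_nat (Suc (m + j)) * of_nat ((m + j) choose j) * x ^ Suc j"
      unfolding Z_def by (simp only: add_Suc_right)
    thus ?thesis unfolding Z_def by (simp add: algebra_simps)
  qed
  hence "(\<Sum>j\<le>m. ((of_nat m + 1) * x + (x - 1) * of_nat j) * (of_nat ((m + j) choose j) * x ^ j)) = (\<Sum>j<Suc m. Z (Suc j) - Z j)"
    by (simp only: lessThan_Suc_atMost)
  also have "\<dots> = Z (Suc m) - Z 0" by (rule sum_lessThan_telescope)
  finally show ?thesis by (simp add: Z_def algebra_simps del: binomial_Suc_Suc)
qed

text \<open>Up to sign, both weights are telescoping weights minus 3m + 2: j - m = (2(m+1) + j) -
  (3m+2) and 2j - 2m - 1 = (m + 1 + 2j) - (3m+2). The telescoped parts agree, and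
  \<open>trunc_binom_2_minus_1\<close> settles the rest.\<close>

lemma trunc_binom_identity:
  "(\<Sum>j\<le>m. of_nat ((m + j) choose j) * 2 ^ j * (of_nat j - of_nat m)) - (- 1) ^ m * (3 * of_nat m + 2) =
    2 * (- 2) ^ m * (\<Sum>j\<le>m. of_nat ((m + j) choose j) * (- 1) ^ j * (2 * of_nat j - 2 * of_nat m - 1) :: rat)"
proof -
  define R :: rat where "R = (of_nat m + 1) * of_nat ((m + Suc m) choose Suc m)"
  define M :: rat where "M = of_nat m"
  have "(\<Sum>j\<le>m. of_nat ((m + j) choose j) * 2 ^ j * (of_nat j - of_nat m)) =
     (\<Sum>j\<le>m. ((of_nat m + 1) * 2 + (2 - 1) * of_nat j) * (of_nat ((m + j) choose j) * 2 ^ j)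
        - (3 * M + 2) * (of_nat ((m + j) choose j) * 2 ^ j))"
    unfolding M_def by (rule sum.cong) (simp_all add: algebra_simps)
  also have "\<dots> = R * 2 ^ Suc m - (3 * M + 2) * trunc_binom 2 m"
    unfolding sum_subtractf trunc_binom_telescope R_def trunc_binom_def sum_distrib_left ..
  finally have a: "(\<Sum>j\<le>m. of_nat ((m + j) choose j) * 2 ^ j * (of_nat j - of_nat m)) = R * 2 ^ Suc m - (3 * M + 2) * trunc_binom 2 m" .
  have "(\<Sum>j\<le>m. of_nat ((m + j) choose j) * (- 1) ^ j * (2 * of_nat j - 2 * of_nat m - 1)) =
     (\<Sum>j\<le>m. - (((of_nat m + 1) * (- 1) + (- 1 - 1) * of_nat j) * (of_nat ((m + j) choose j) * (- 1) ^ j))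
        - (3 * M + 2) * (of_nat ((m + j) choose j) * (- 1) ^ j))"
    unfolding M_def by (rule sum.cong) (simp_all add: algebra_simps)
  also have "\<dots> = - (R * (- 1) ^ Suc m) - (3 * M + 2) * trunc_binom (- 1) m"
    unfolding sum_subtractf sum_negf trunc_binom_telescope R_def trunc_binom_def sum_distrib_left ..
  finally have b: "(\<Sum>j\<le>m. of_nat ((m + j) choose j) * (- 1) ^ j * (2 * of_nat j - 2 * of_nat m - 1)) =
     R * (- 1) ^ m - (3 * M + 2) * trunc_binom (- 1) m" by simp
  have s: "(- 2) ^ m * (- 1) ^ m = (2 ^ m :: rat)" by (simp flip: power_mult_distrib)
  have t: "trunc_binom 2 m = 2 * (- 2) ^ m * trunc_binom (- 1) m - (- 1) ^ m" using trunc_binom_2_minus_1[of m] by simp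
  have "2 * (- 2) ^ m * (R * (- 1) ^ m - (3 * M + 2) * trunc_binom (- 1) m) =
     2 * R * ((- 2) ^ m * (- 1) ^ m) - (3 * M + 2) * (2 * (- 2) ^ m * trunc_binom (- 1) m)"
    by (simp add: algebra_simps)
  also have "\<dots> = R * 2 ^ Suc m - (3 * M + 2) * trunc_binom 2 m - (- 1) ^ m * (3 * M + 2)"
    unfolding s t by (simp add: algebra_simps)
  finally show ?thesis unfolding a b unfolding M_def by simp
qed

lemma binomial_weighted_sum:
  fixes y :: rat
  shows "(1 + y) * (\<Sum>j\<le>k. of_nat j * (of_nat (k choose j) * y ^ j)) = of_nat k * y * (1 + y) ^ k"
proof -
  define Z :: "nat \<Rightarrow> rat" where "Z j = of_nat j * of_nat (k choose j) * y ^ j" for j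
  have b: "(\<Sum>j\<le>k. of_nat (k choose j) * y ^ j) = (1 + y) ^ k"
    using binomial_ring[of y 1 k] by (simp add: add.commute)
  have e: "Z (Suc j) - Z j = of_nat k * y * (of_nat (k choose j) * y ^ j) - (1 + y) * (of_nat j * (of_nat (k choose j) * y ^ j))" for j
  proof -
    have "of_nat (Suc j) * of_nat (k choose Suc j) = (of_nat (k choose j) * (of_nat k - of_nat j) :: rat)"
      using choose_Suc_down[of k j] by simp
    hence "Z (Suc j) = of_nat (k choose j) * (of_nat k - of_nat j) * y ^ Suc j"
      unfolding Z_def by (simp only:)
    thus ?thesis unfolding Z_def by (simp add: algebra_simps)
  qed
  have "(\<Sum>j<Suc k. Z (Suc j) - Z j) = Z (Suc k) - Z 0" by (rule sum_lessThan_telescope)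
  hence "(\<Sum>j\<le>k. Z (Suc j) - Z j) = 0" by (simp add: Z_def lessThan_Suc_atMost)
  thus ?thesis unfolding e sum_subtractf sum_distrib_left[symmetric] b by simp
qed

text \<open>With x free this serves both sums: the base -16x is -2 at x = 1/8 and 1 at x = -1/16.
  Writing n = k + j cuts j at P - k, short of the full range j <= k as soon as 2k >= P.\<close>

lemma central_sq_conv_power_sum:
  "(\<Sum>n<P. w n * x ^ n * central_sq_conv n) =
    (\<Sum>k<P. of_nat (2 * k choose k) ^ 3 * x ^ k * (\<Sum>j<P - k. of_nat (k choose j) * (- 16 * x) ^ j * w (k + j)))"
proof -
  define g where "g n k = w n * x ^ n * (of_nat (2 * k choose k) ^ 3 * of_nat (k choose (n - k)) * (- 16) ^ (n - k))" for n k
  have "(\<Sum>n<P. w n * x ^ n * central_sq_conv n) = (\<Sum>n<P. \<Sum>k\<le>n. g n k)"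
    unfolding central_sq_conv_formula1 g_def sum_distrib_left ..
  also have "\<dots> = (\<Sum>(n, k)\<in>(SIGMA n:{..<P}. {..n}). g n k)" by (simp add: sum.Sigma)
  also have "\<dots> = (\<Sum>(k, j)\<in>(SIGMA k:{..<P}. {..<P - k}). g (k + j) k)"
    by (rule sum.reindex_bij_witness[of _ "\<lambda>(k, j). (k + j, k)" "\<lambda>(n, k). (k, n - k)"]) auto
  also have "\<dots> = (\<Sum>k<P. \<Sum>j<P - k. g (k + j) k)" by (simp add: sum.Sigma)
  also have "\<dots> = (\<Sum>k<P. of_nat (2 * k choose k) ^ 3 * x ^ k * (\<Sum>j<P - k. of_nat (k choose j) * (- 16 * x) ^ j * w (k + j)))"
    unfolding sum_distrib_left g_def power_mult_distrib power_add diff_add_inverse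
    by (intro sum.cong refl) (simp only: mult_ac)
  finally show ?thesis .
qed

section \<open>Comparison of the inner sums\<close>

context prime_gt3
begin

text \<open>Modulo p, the upper index k is -(m+1).\<close>

lemma choose_neg_cong:
  assumes "k + m + 1 = p" "j \<le> m"
  shows "pcong 1 (of_nat (k choose j)) ((- 1) ^ j * of_nat ((m + j) choose j))"
  using assms(2)
proof (induction j)
  case (Suc j)
  have Ij: "Zp (inverse (of_nat (Suc j)))" using Suc.prems assms(1) by (intro Zp_inverse_nat not_dvd_less) auto
  have kj: "of_nat k - of_nat j = - of_nat (Suc (m + j)) + of_nat p ^ 1 * (1::rat)"
    unfolding assms(1)[symmetric] by simp
  have "of_nat (k choose Suc j) = (of_nat (k choose j) * (of_nat k - of_nat j) * inverse (of_nat (Suc j)) :: rat)"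
    unfolding choose_Suc_down by (simp only: divide_inverse)
  also have "pcong 1 \<dots> ((- 1) ^ j * of_nat ((m + j) choose j) * (- of_nat (Suc (m + j))) * inverse (of_nat (Suc j)))"
  proof (intro pcong_multc pcong_mult Ij)
    show "pcong 1 (of_nat (k choose j)) ((- 1) ^ j * of_nat ((m + j) choose j))" using Suc by simp
    show "pcong 1 (of_nat k - of_nat j) (- of_nat (Suc (m + j)))" unfolding kj by (rule pcong_p_multiple) simp
  qed auto
  also have "\<dots> = (- 1) ^ Suc j * of_nat ((m + Suc j) choose Suc j)"
    unfolding add_Suc_right choose_Suc_Suc by (simp add: divide_inverse del: of_nat_Suc)
  finally show ?case .
qed simp

text \<open>p <= 2k makes p divide (2k)! but not k!^2. The cube of this coefficient supplies the
  factor p^3 in the upper half of the range.\<close>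

lemma central_binomial_p_dvd:
  assumes "N < k" "k < p"
  obtains z where "Zp z" "of_nat (2 * k choose k) = of_nat p * z"
proof -
  have "p \<le> 2 * k" using assms p_eq by simp
  hence "p dvd fact (2 * k)" using prime_p by (simp add: prime_dvd_fact_iff)
  also have "fact (2 * k) = fact k * fact k * (2 * k choose k)"
    using binomial_fact_lemma[of k "2 * k"] by (simp add: mult_2)
  finally have "p dvd (2 * k choose k)"
    using prime_p not_dvd_fact[OF assms(2)] by (simp add: prime_dvd_mult_iff)
  then obtain c where "2 * k choose k = p * c" ..
  thus ?thesis using that[of "of_nat c"] by simp
qed

text \<open>Here j <= k < p - k, so the inner sums are complete and come from (1 - 2)^k and (1 +
  1)^k; each side is 2 (-1)^k (3k + 1).\<close>

lemma weight_identity_small: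
  assumes "k \<le> N"
  shows "(\<Sum>j<p - k. of_nat (k choose j) * (- 2) ^ j * (of_nat (k + j) + 1)) + (- 1) ^ k * (3 * of_nat k + 1)
     = 2 * (- 1 / 2) ^ k * (\<Sum>j<p - k. of_nat (k choose j) * 1 ^ j * (2 * of_nat (k + j) + 1) :: rat)"
proof -
  have ext: "(\<Sum>j<p - k. of_nat (k choose j) * f j) = (\<Sum>j\<le>k. of_nat (k choose j) * f j)" for f :: "nat \<Rightarrow> rat"
    by (rule sum.mono_neutral_right) (use assms p_eq in \<open>auto simp: binomial_eq_0\<close>)
  have b: "(\<Sum>j\<le>k. of_nat (k choose j) * y ^ j) = (1 + y) ^ k" for y :: rat
    using binomial_ring[of y 1 k] by (simp add: add.commute)
  have w: "(\<Sum>j\<le>k. of_nat j * (of_nat (k choose j) * (- 2) ^ j)) = 2 * of_nat k * (- 1 :: rat) ^ k"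
    using binomial_weighted_sum[of "- 2" k] by simp
  have w1: "(\<Sum>j\<le>k. of_nat j * (of_nat (k choose j) * 1 ^ j)) = of_nat k * 2 ^ k / (2 :: rat)"
    using binomial_weighted_sum[of 1 k] by simp
  have "(\<Sum>j<p - k. of_nat (k choose j) * (- 2) ^ j * (of_nat (k + j) + 1)) =
     (\<Sum>j\<le>k. (of_nat k + 1) * (of_nat (k choose j) * (- 2) ^ j) + of_nat j * (of_nat (k choose j) * (- 2) ^ j) :: rat)"
    unfolding mult.assoc ext by (rule sum.cong) (simp_all add: algebra_simps)
  also have "\<dots> = (of_nat k + 1) * (- 1) ^ k + 2 * of_nat k * (- 1) ^ k"
    unfolding sum.distrib sum_distrib_left[symmetric] b w by simp
  finally have A: "(\<Sum>j<p - k. of_nat (k choose j) * (- 2) ^ j * (of_nat (k + j) + 1)) = (- 1) ^ k * (3 * of_nat k + 1 :: rat)"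
    by (simp add: algebra_simps)
  have "(\<Sum>j<p - k. of_nat (k choose j) * 1 ^ j * (2 * of_nat (k + j) + 1)) =
     (\<Sum>j\<le>k. (2 * of_nat k + 1) * (of_nat (k choose j) * 1 ^ j) + 2 * (of_nat j * (of_nat (k choose j) * 1 ^ j)) :: rat)"
    unfolding mult.assoc ext by (rule sum.cong) (simp_all add: algebra_simps)
  also have "\<dots> = (2 * of_nat k + 1) * 2 ^ k + 2 * (of_nat k * 2 ^ k / 2)"
    unfolding sum.distrib sum_distrib_left[symmetric] b w1 by simp
  finally have B: "(\<Sum>j<p - k. of_nat (k choose j) * 1 ^ j * (2 * of_nat (k + j) + 1)) = 2 ^ k * (3 * of_nat k + 1 :: rat)"
    by (simp add: algebra_simps)
  have "(- 1 / 2) ^ k * 2 ^ k = ((- 1) ^ k :: rat)" by (simp flip: power_mult_distrib)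
  hence "2 * (- 1 / 2) ^ k * (2 ^ k * (3 * of_nat k + 1)) = 2 * ((- 1) ^ k * (3 * of_nat k + 1 :: rat))"
    by (simp only: mult.assoc[symmetric]) (simp only: mult.assoc)
  thus ?thesis unfolding A B by simp
qed

text \<open>The inner sums have m + 1 = p - k terms. Replacing k by -(m+1) turns them into the sums
  of \<open>trunc_binom_identity\<close>, and (-1/2)^k is (-2)^m modulo p because k + m = 2N and 4^N
  is 1.\<close>

lemma weight_cong_large:
  assumes "k < p"
  shows "pcong 1 ((\<Sum>j<p - k. of_nat (k choose j) * (- 2) ^ j * (of_nat (k + j) + 1)) + (- 1) ^ k * (3 * of_nat k + 1))
     (2 * (- 1 / 2) ^ k * (\<Sum>j<p - k. of_nat (k choose j) * 1 ^ j * (2 * of_nat (k + j) + 1)))"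
proof -
  define m where "m = p - 1 - k"
  have m: "k + m + 1 = p" "p - k = Suc m" using assms by (auto simp: m_def)
  have km: "of_nat k = - of_nat m - 1 + of_nat p ^ 1 * (1::rat)" unfolding m(1)[symmetric] by simp
  have Ih: "Zp (- 1 / 2)" using Zp_minus[OF Zp_div_2(1)[OF Zp_num(2)]] by simp
  have A: "pcong 1 (\<Sum>j\<le>m. of_nat (k choose j) * (- 2) ^ j * (of_nat (k + j) + 1))
     (\<Sum>j\<le>m. of_nat ((m + j) choose j) * 2 ^ j * (of_nat j - of_nat m))"
  proof (rule pcong_sum)
    fix j assume "j \<in> {..m}"
    hence "pcong 1 (of_nat (k choose j) * (- 2) ^ j * (of_nat (k + j) + 1)) ((- 1) ^ j * of_nat ((m + j) choose j) * (- 2) ^ j * (of_nat j - of_nat m))"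
    proof (intro pcong_mult pcong_refl choose_neg_cong[OF m(1)])
      have "of_nat (k + j) + 1 = of_nat j - of_nat m + of_nat p ^ 1 * (1::rat)" unfolding of_nat_add km by simp
      thus "pcong 1 (of_nat (k + j) + 1) (of_nat j - of_nat m)" by (simp only: pcong_p_multiple[OF Zp_num(2)])
    qed auto
    also have "(- 1) ^ j * of_nat ((m + j) choose j) * (- 2) ^ j * (of_nat j - of_nat m) = of_nat ((m + j) choose j) * ((- 1) ^ j * (- 2) ^ j) * (of_nat j - of_nat m :: rat)"
      by (simp only: mult_ac)
    also have "(- 1) ^ j * (- 2) ^ j = (2 ^ j :: rat)" by (simp flip: power_mult_distrib)
    finally show "pcong 1 (of_nat (k choose j) * (- 2) ^ j * (of_nat (k + j) + 1)) (of_nat ((m + j) choose j) * 2 ^ j * (of_nat j - of_nat m))" .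
  qed
  have B: "pcong 1 (\<Sum>j\<le>m. of_nat (k choose j) * 1 ^ j * (2 * of_nat (k + j) + 1))
     (\<Sum>j\<le>m. of_nat ((m + j) choose j) * (- 1) ^ j * (2 * of_nat j - 2 * of_nat m - 1))"
  proof (rule pcong_sum)
    fix j assume "j \<in> {..m}"
    hence "pcong 1 (of_nat (k choose j) * (2 * of_nat (k + j) + 1)) ((- 1) ^ j * of_nat ((m + j) choose j) * (2 * of_nat j - 2 * of_nat m - 1))"
    proof (intro pcong_mult choose_neg_cong[OF m(1)])
      have "2 * of_nat (k + j) + 1 = 2 * of_nat j - 2 * of_nat m - 1 + of_nat p ^ 1 * (2::rat)" unfolding of_nat_add km by simp
      thus "pcong 1 (2 * of_nat (k + j) + 1) (2 * of_nat j - 2 * of_nat m - 1)" by (simp only: pcong_p_multiple[OF Zp_num(3)])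
    qed auto
    thus "pcong 1 (of_nat (k choose j) * 1 ^ j * (2 * of_nat (k + j) + 1)) (of_nat ((m + j) choose j) * (- 1) ^ j * (2 * of_nat j - 2 * of_nat m - 1))"
      by (simp only: power_one mult_1_right mult.commute[of "(- 1) ^ j"])
  qed
  have km2: "k + m = 2 * N" using m(1) p_eq by simp
  have s: "(- 1) ^ k = ((- 1) ^ m :: rat)"
  proof -
    have "(- 1) ^ k * (- 1) ^ m = (1 :: rat)" using km2 by (simp flip: power_add)
    moreover have "(- 1) ^ m * (- 1) ^ m = (1 :: rat)" by (simp flip: power_mult_distrib)
    ultimately show ?thesis by (metis mult.assoc mult.commute mult_1)
  qed
  have C: "pcong 1 ((- 2) ^ m) ((- 1 / 2) ^ k)"
  proof -
    have "(- 1 / 2) ^ k * 4 ^ N = ((- 1 / 2) ^ k * (- 2) ^ k) * (- 2 :: rat) ^ m"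
    proof -
      have "(4 :: rat) ^ N = (- 2) ^ (k + m)" unfolding km2 by (simp add: power_mult)
      thus ?thesis by (simp only: power_add mult.assoc)
    qed
    also have "(- 1 / 2) ^ k * (- 2) ^ k = (1 :: rat)" by (simp flip: power_mult_distrib)
    finally have "(- 2 :: rat) ^ m = (- 1 / 2) ^ k * 4 ^ N" by simp
    also have "pcong 1 \<dots> ((- 1 / 2) ^ k * 1)" using Ih by (intro pcong_cmult pcong_power_4) auto
    finally show ?thesis by (simp only: mult_1_right)
  qed
  have "pcong 1 ((\<Sum>j\<le>m. of_nat (k choose j) * (- 2) ^ j * (of_nat (k + j) + 1)) + (- 1) ^ k * (3 * of_nat k + 1))
    ((\<Sum>j\<le>m. of_nat ((m + j) choose j) * 2 ^ j * (of_nat j - of_nat m)) + (- 1) ^ m * (- (3 * of_nat m + 2)))"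
    unfolding s
  proof (intro pcong_add A pcong_cmult)
    have "3 * of_nat k + 1 = - (3 * of_nat m + 2) + of_nat p ^ 1 * (3::rat)" unfolding km by simp
    thus "pcong 1 (3 * of_nat k + 1) (- (3 * of_nat m + 2))" by (simp only: pcong_p_multiple[OF Zp_num(3)])
  qed auto
  also have "\<dots> = 2 * (- 2) ^ m * (\<Sum>j\<le>m. of_nat ((m + j) choose j) * (- 1) ^ j * (2 * of_nat j - 2 * of_nat m - 1))"
    using trunc_binom_identity[of m] by (simp only: mult_minus_right add_uminus_conv_diff)
  also have "pcong 1 \<dots> (2 * (- 1 / 2) ^ k * (\<Sum>j\<le>m. of_nat (k choose j) * 1 ^ j * (2 * of_nat (k + j) + 1)))"
    by (intro pcong_mult pcong_refl C pcong_sym[OF B] Zp_mult Zp_sum Zp_power Ih Zp_num Zp_minus Zp_add Zp_of_nat)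
  finally show ?thesis unfolding m(2) lessThan_Suc_atMost .
qed

lemma first_sum_plus_sum_3k1:
  "pcong 4 ((\<Sum>n<p. (of_nat n + 1) / 8 ^ n * central_sq_conv n) + (\<Sum>k<p. (3 * of_nat k + 1) * of_nat (2 * k choose k) ^ 3 / (- 8) ^ k))
     (2 * (\<Sum>n<p. (2 * of_nat n + 1) / (- 16) ^ n * central_sq_conv n))"
proof -
  define a :: "nat \<Rightarrow> rat" where "a k = (\<Sum>j<p - k. of_nat (k choose j) * (- 2) ^ j * (of_nat (k + j) + 1))" for k
  define b :: "nat \<Rightarrow> rat" where "b k = (\<Sum>j<p - k. of_nat (k choose j) * 1 ^ j * (2 * of_nat (k + j) + 1))" for k
  define c :: "nat \<Rightarrow> rat" where "c k = of_nat (2 * k choose k) ^ 3" for k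
  have "(\<Sum>n<p. (of_nat n + 1) / 8 ^ n * central_sq_conv n) = (\<Sum>n<p. (of_nat n + 1) * (1 / 8) ^ n * central_sq_conv n)"
    by (simp add: power_one_over)
  hence A: "(\<Sum>n<p. (of_nat n + 1) / 8 ^ n * central_sq_conv n) = (\<Sum>k<p. c k * (1 / 8) ^ k * a k)"
    unfolding central_sq_conv_power_sum a_def c_def by simp
  have q: "(- 1 / 16) ^ n = 1 / (- 16 :: rat) ^ n" for n
    using power_one_over[of "- 16 :: rat" n] by simp
  have "(\<Sum>n<p. (2 * of_nat n + 1) / (- 16) ^ n * central_sq_conv n) = (\<Sum>n<p. (2 * of_nat n + 1) * (- 1 / 16) ^ n * central_sq_conv n)"
    unfolding q by simp
  hence B: "(\<Sum>n<p. (2 * of_nat n + 1) / (- 16) ^ n * central_sq_conv n) = (\<Sum>k<p. c k * (- 1 / 16) ^ k * b k)"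
    unfolding central_sq_conv_power_sum b_def c_def by simp
  have p16: "(- 1 / 16) ^ k = ((1 / 8) ^ k * (- 1 / 2) ^ k :: rat)" for k by (simp flip: power_mult_distrib)
  have p8: "x / (- 8) ^ k = (1 / 8) ^ k * (- 1) ^ k * (x :: rat)" for x k
    by (simp add: power_divide minus_one_power_iff)
  have I8: "Zp ((1 / 8) ^ k)" for k using Zp_div_2(3)[OF Zp_num(2)] by (rule Zp_power)
  have "pcong 4 (\<Sum>k<p. c k * (1 / 8) ^ k * a k + (3 * of_nat k + 1) * c k / (- 8) ^ k) (\<Sum>k<p. 2 * (c k * (- 1 / 16) ^ k * b k))"
  proof (rule pcong_sum)
    fix k assume "k \<in> {..<p}"
    hence k: "k < p" by simp
    have l: "c k * (1 / 8) ^ k * a k + (3 * of_nat k + 1) * c k / (- 8) ^ k = c k * ((1 / 8) ^ k * (a k + (- 1) ^ k * (3 * of_nat k + 1)))"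
      unfolding p8 by (simp add: algebra_simps)
    have r: "2 * (c k * (- 1 / 16) ^ k * b k) = c k * ((1 / 8) ^ k * (2 * (- 1 / 2) ^ k * b k))"
      unfolding p16 by (simp only: mult_ac)
    show "pcong 4 (c k * (1 / 8) ^ k * a k + (3 * of_nat k + 1) * c k / (- 8) ^ k) (2 * (c k * (- 1 / 16) ^ k * b k))"
    \<comment> \<open>The terms are equal in the lower half; in the upper half p^3 divides
      \<open>c k\<close>, so a congruence modulo p is enough.\<close>
    proof (cases "k \<le> N")
      case True
      show ?thesis unfolding l r unfolding a_def b_def weight_identity_small[OF True] by (rule pcong_refl)
    next
      case False
      then obtain z where z: "Zp z" "of_nat (2 * k choose k) = of_nat p * z"
        using central_binomial_p_dvd[of k] k by auto
      have ck: "c k * x = of_nat p ^ 3 * (z ^ 3 * x)" for x unfolding c_def z(2) by (simp add: power_mult_distrib)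
      have "pcong (1 + 3) (of_nat p ^ 3 * (z ^ 3 * ((1 / 8) ^ k * (a k + (- 1) ^ k * (3 * of_nat k + 1)))))
          (of_nat p ^ 3 * (z ^ 3 * ((1 / 8) ^ k * (2 * (- 1 / 2) ^ k * b k))))"
        unfolding a_def b_def using z by (intro pcong_scale pcong_cmult weight_cong_large k I8) auto
      thus ?thesis unfolding l r unfolding ck by simp
    qed
  qed
  thus ?thesis unfolding A B c_def[symmetric] by (simp only: sum.distrib sum_distrib_left)
qed

lemma first_sum_cong:
  "pcong 4 (\<Sum>n<p. (of_nat n + 1) / 8 ^ n * central_sq_conv n)
     ((- 1) ^ N * (of_nat p + 5 / 2 * of_nat p ^ 3 * alt_harm2 N))"
proof -
  define A B S where "A = (\<Sum>n<p. (of_nat n + 1) / 8 ^ n * central_sq_conv n)"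
    and "B = (\<Sum>n<p. (2 * of_nat n + 1) / (- 16) ^ n * central_sq_conv n)"
    and "S = (\<Sum>k<p. (3 * of_nat k + 1) * of_nat (2 * k choose k) ^ 3 / (- 8) ^ k :: rat)"
  have "pcong 4 (A + S - S) (2 * B - S)"
    using first_sum_plus_sum_3k1 unfolding A_def[symmetric] B_def[symmetric] S_def[symmetric] by (intro pcong_diff pcong_refl)
  also have "pcong 4 \<dots> (2 * ((- 1) ^ N * (of_nat p + 3 / 2 * of_nat p ^ 3 * alt_harm2 N)) - (- 1) ^ N * (of_nat p + 1 / 2 * of_nat p ^ 3 * alt_harm2 N))"
    unfolding B_def S_def by (intro pcong_diff pcong_cmult second_sum_cong sum_3k1_cong) auto
  \<comment> \<open>The coefficient is 5/2 = 2 * 3/2 - 1/2.\<close>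
  also have "\<dots> = (- 1) ^ N * (of_nat p + 5 / 2 * of_nat p ^ 3 * alt_harm2 N)" by (simp add: algebra_simps)
  finally show ?thesis unfolding A_def by simp
qed

text \<open>\<open>alt_harm2 N\<close> is 2 (-1)^N times the Euler number modulo p: the 2 cancels
  the half in c/2, and the sign cancels the outer (-1)^N in the p^3 term only.\<close>

lemma euler_scale:
  assumes "Zp c"
  shows "pcong 4 ((- 1) ^ N * (of_nat p + c / 2 * of_nat p ^ 3 * alt_harm2 N))
     ((- 1) ^ ((p - 1) div 2) * of_nat p + c * of_nat p ^ 3 * of_int (euler_number (p - 3)))"
proof -
  have "pcong (1 + 3) (of_nat p ^ 3 * (c * ((- 1) ^ N / 2 * alt_harm2 N))) (of_nat p ^ 3 * (c * of_int (euler_number (p - 3))))"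
    using assms by (intro pcong_scale pcong_cmult pcong_sym[OF euler_number_cong])
  hence "pcong 4 ((- 1) ^ N * of_nat p + of_nat p ^ 3 * (c * ((- 1) ^ N / 2 * alt_harm2 N)))
      ((- 1) ^ N * of_nat p + of_nat p ^ 3 * (c * of_int (euler_number (p - 3))))"
    by (intro pcong_add pcong_refl) simp
  thus ?thesis unfolding N_def[symmetric] by (simp add: algebra_simps)
qed

end

theorem theorem1p1:
  fixes p :: nat
  assumes "prime p" and "p > 3"
  shows "p_cong p 4
      (\<Sum>n = 0..p - 1. (of_nat n + 1) / 8 ^ n *
         (\<Sum>k = 0..n. of_nat ((2 * k) choose k) ^ 2 *
            of_nat ((2 * n - 2 * k) choose (n - k)) ^ 2))
      ((- 1) ^ ((p - 1) div 2) * of_nat p + 5 * of_nat p ^ 3 * of_int (euler_number (p - 3)))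
    \<and> p_cong p 4
      (\<Sum>n = 0..p - 1. (2 * of_nat n + 1) / (- 16) ^ n *
         (\<Sum>k = 0..n. of_nat ((2 * k) choose k) ^ 2 *
            of_nat ((2 * n - 2 * k) choose (n - k)) ^ 2))
      ((- 1) ^ ((p - 1) div 2) * of_nat p + 3 * of_nat p ^ 3 * of_int (euler_number (p - 3)))"
proof -
  interpret prime_gt3 p using assms by unfold_locales
  have set: "{0..p - 1} = {..<p}" using assms(2) by auto
  show ?thesis
    unfolding central_sq_conv_def[symmetric] set p_cong_iff
  proof (intro conjI)
    show "pcong 4 (\<Sum>n<p. (of_nat n + 1) / 8 ^ n * central_sq_conv n)
       ((- 1) ^ ((p - 1) div 2) * of_nat p + 5 * of_nat p ^ 3 * of_int (euler_number (p - 3)))"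
      by (rule pcong_trans[OF first_sum_cong euler_scale[of 5]]) simp
    show "pcong 4 (\<Sum>n<p. (2 * of_nat n + 1) / (- 16) ^ n * central_sq_conv n)
       ((- 1) ^ ((p - 1) div 2) * of_nat p + 3 * of_nat p ^ 3 * of_int (euler_number (p - 3)))"
      by (rule pcong_trans[OF second_sum_cong euler_scale[of 3]]) simp
  qed (intro Zp_add Zp_mult Zp_power Zp_minus Zp_num Zp_of_nat Zp_of_int)+
qed

end
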